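(* In the setting of the context, assume the controller $(\mathcal{G}_1,\mathcal{G}_2,K)$ stabilizes the closed-loop system strongly in such a way that the Sylvester equation $\Sigma S=A_e\Sigma+B_e$ on $\mathcal{D}(S)$ has a solution $\Sigma\in\mathcal{L}(W,X_e)$ satisfying $\mathcal{R}(\Sigma)\subset\mathcal{D}(C_{e\Lambda})$. Then the following are equivalent: (a) The controller $(\mathcal{G}_1,\mathcal{G}_2,K)$ solves the output regulation problem. (b) The regulator equations $$\Sigma S=A_e\Sigma+B_e,\qquad 0=C_{e\Lambda}\Sigma+D_e$$ on $\mathcal{D}(S)$ have a solution $\Sigma\in\mathcal{L}(W,X_e)$ satisfying $\mathcal{R}(\Sigma)\subset\mathcal{D}(C_{e\Lambda})$.
   Context: $\mathcal{D},\mathcal{R}$ denote domain and range; $R(\lambda,A)=(\lambda-A)^{-1}$. Plant. $X,U_d$ are Banach spaces, $U,Y$ Hilbert spaces. $A$ generates a strongly continuous semigroup on $X$; $X_1=\mathcal{D}(A)$ with norm $\|(\lambda_0-A)\cdot\|$, $X_{-1}$ is the completion of $X$ in the norm $\|R(\lambda_0,A)\cdot\|$; the extension of $A$ to $X_{-1}$ is denoted by $A$. $B\in\mathcal{L}(U,X_{-1})$, $B_d\in\mathcal{L}(U_d,X_{-1})$, $C\in\mathcal{L}(X_1,Y)$ are admissible for $A$, $D\in\mathcal{L}(U,Y)$. $C_\Lambda x=\lim_{\lambda\to\infty}\lambda CR(\lambda,A)x$ on the set where the limit exists (similarly for other observation operators). The system is regular (Weiss): $\mathcal{R}(R(\lambda_0,A)[B,B_d])\subset\mathcal{D}(C_\Lambda)$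 and $C_\Lambda R(\lambda,A)(Bu+B_dw)\to0$ as $\lambda\to+\infty$. Plant: $\dot x=Ax+Bu+B_dw$, $y=C_\Lambda x+Du$. Exosystem. $W=\ell^2(\mathbb{Z};\mathbb{C})$ with canonical basis $(\phi_k)$, $S=\mathrm{diag}(i\omega_k)_{k\in\mathbb{Z}}$, $\omega_k\in\mathbb{R}$ distinct, $\inf_{k\ne l}|\omega_k-\omega_l|>0$. $E\in\mathcal{L}(W,U_d)$, $F\in\mathcal{L}(W,Y)$ are Hilbert–Schmidt: $(E\phi_k)\in\ell^2(U_d)$, $(F\phi_k)\in\ell^2(Y)$. $\dot v=Sv$, $v(0)=v_0\in W$, $w=Ev$, $y_{ref}=-Fv$. Controller. $\mathcal{G}_1$ generates a strongly continuous semigroup on a Banach space $Z$ (scale spaces $Z_1,Z_{-1}$), $\mathcal{G}_2\in\mathcal{L}(Y,Z_{-1})$ and $K\in\mathcal{L}(Z_1,U)$ are admissible and $(\mathcal{G}_1,\mathcal{G}_2,K)$ is a regular linear system: $\dot z=\mathcal{G}_1z+\mathcal{G}_2e$, $u=K_\Lambda z$, $e=y-y_{ref}$. Closed-loop system on $X_e=X\times Z$: $\dot x_e=A_ex_e+B_ev$, $x_e(0)=x_{e0}$, $e=C_{e\Lambda}x_e+D_ev$, with $A_e=\begin{bmatrix}A&BK_\Lambda\\\mathcal{G}_2C_\Lambda&\mathcal{G}_1+\mathcal{G}_2DK_\Lambda\end{bmatrix}$ (with domain the elements of $(\mathcal{D}(A)+\mathcal{R}(R(\lambda_0,A)B))\times(\mathcal{D}(\mathcal{G}_1)+\mathcal{R}(R(\lambda_0,\mathcal{G}_1)\mathcal{G}_2))$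 mapped into $X\times Z$), $B_e=\begin{bmatrix}B_dE\\\mathcal{G}_2F\end{bmatrix}$, $C_e=[C_\Lambda,DK_\Lambda]$, $D_e=F$. It is a regular linear system; $A_e$ generates a semigroup $T_e(t)$ on $X_e$, the extension of $A_e$ to $X_e\to X_{e,-1}$ is denoted by $A_e$, and the Sylvester equation is understood in $X_{e,-1}$. The controller solves the output regulation problem if $T_e(t)$ is strongly stable and $\int_t^{t+1}\|e(s)\|ds\to0$ as $t\to\infty$ for all $x_{e0}\in X_e$, $v_0\in W$. *)

theory Defs
  imports "HOL-Analysis.Analysis"
begin

section \<open>Complex Banach and Hilbert spaces\<close>

class complex_normed_vector = real_normed_vector +
  fixes scaleC :: "complex \<Rightarrow> 'a \<Rightarrow> 'a"  (infixr \<open>*\<^sub>C\<close> 75)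
  assumes scaleC_add_right: "a *\<^sub>C (x + y) = a *\<^sub>C x + a *\<^sub>C y"
    and scaleC_add_left: "(a + b) *\<^sub>C x = a *\<^sub>C x + b *\<^sub>C x"
    and scaleC_scaleC: "a *\<^sub>C b *\<^sub>C x = (a * b) *\<^sub>C x"
    and scaleC_of_real: "of_real r *\<^sub>C x = r *\<^sub>R x"
    and norm_scaleC: "norm (a *\<^sub>C x) = cmod a * norm x"

class complex_banach = complex_normed_vector + complete_space
begin
subclass banach ..
end

class complex_hilbert = complex_banach +
  fixes cinner :: "'a \<Rightarrow> 'a \<Rightarrow> complex"
  assumes cinner_commute: "cinner x y = cnj (cinner y x)"
    and cinner_add_left: "cinner (x + y) z = cinner x z + cinner y z"
    and cinner_scaleC_left: "cinner (a *\<^sub>C x) y = a * cinner x y"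
    and cinner_self: "cinner x x = of_real ((norm x)\<^sup>2)"

instantiation prod :: (complex_normed_vector, complex_normed_vector) complex_normed_vector
begin

definition scaleC_prod :: "complex \<Rightarrow> 'a \<times> 'b \<Rightarrow> 'a \<times> 'b" where
  "scaleC_prod a p = (a *\<^sub>C fst p, a *\<^sub>C snd p)"

instance
proof
  fix a b :: complex and r :: real and p q :: "'a \<times> 'b"
  show "a *\<^sub>C (p + q) = a *\<^sub>C p + a *\<^sub>C q"
    by (simp add: scaleC_prod_def scaleC_add_right)
  show "(a + b) *\<^sub>C p = a *\<^sub>C p + b *\<^sub>C p"
    by (simp add: scaleC_prod_def scaleC_add_left)
  show "a *\<^sub>C b *\<^sub>C p = (a * b) *\<^sub>C p"
    by (simp add: scaleC_prod_def scaleC_scaleC)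
  show "of_real r *\<^sub>C p = r *\<^sub>R p"
    by (simp add: scaleC_prod_def scaleC_of_real prod_eq_iff)
  have "(cmod a * norm (fst p))\<^sup>2 + (cmod a * norm (snd p))\<^sup>2
      = (cmod a)\<^sup>2 * ((norm (fst p))\<^sup>2 + (norm (snd p))\<^sup>2)"
    by (simp add: power_mult_distrib distrib_left)
  then show "norm (a *\<^sub>C p) = cmod a * norm p"
    by (simp add: scaleC_prod_def norm_prod_def norm_scaleC real_sqrt_mult)
qed

end

instance prod :: (complex_banach, complex_banach) complex_banach ..

definition bounded_clinear :: "('a::complex_normed_vector \<Rightarrow> 'b::complex_normed_vector) \<Rightarrow> bool" where
  "bounded_clinear f \<longleftrightarrow> bounded_linear f \<and> (\<forall>a x. f (a *\<^sub>C x) = a *\<^sub>C f x)"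


section \<open>The sequence space over the integers\<close>

typedef ell2 = "{x :: int \<Rightarrow> complex. (\<lambda>k. (cmod (x k))\<^sup>2) summable_on UNIV}"
  morphisms coord ell2
  by (rule exI[of _ "\<lambda>_. 0"]) simp

lemma coord_summable: "(\<lambda>k. (cmod (coord v k))\<^sup>2) summable_on UNIV"
  using coord[of v] by simp

lemma ell2I:
  assumes "\<And>F. finite F \<Longrightarrow> L2_set (\<lambda>k. cmod (x k)) F \<le> c"
  shows "x \<in> {x. (\<lambda>k. (cmod (x k))\<^sup>2) summable_on UNIV}"
proof -
  have "(\<Sum>k\<in>F. (cmod (x k))\<^sup>2) \<le> c\<^sup>2" if "finite F" for F
  proof -
    have "(L2_set (\<lambda>k. cmod (x k)) F)\<^sup>2 \<le> c\<^sup>2"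
      by (intro power_mono assms that L2_set_nonneg)
    then show ?thesis by (simp add: L2_set_def sum_nonneg)
  qed
  then show ?thesis
    by (auto intro!: nonneg_bdd_above_summable_on bdd_aboveI2)
qed

instantiation ell2 :: real_normed_vector
begin

definition zero_ell2 :: ell2 where "0 = ell2 (\<lambda>_. 0)"
definition plus_ell2 :: "ell2 \<Rightarrow> ell2 \<Rightarrow> ell2" where
  "v + w = ell2 (\<lambda>k. coord v k + coord w k)"
definition minus_ell2 :: "ell2 \<Rightarrow> ell2 \<Rightarrow> ell2" where
  "v - w = ell2 (\<lambda>k. coord v k - coord w k)"
definition uminus_ell2 :: "ell2 \<Rightarrow> ell2" where
  "- v = ell2 (\<lambda>k. - coord v k)"
definition scaleR_ell2 :: "real \<Rightarrow> ell2 \<Rightarrow> ell2" where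
  "r *\<^sub>R v = ell2 (\<lambda>k. of_real r * coord v k)"
definition norm_ell2 :: "ell2 \<Rightarrow> real" where
  "norm v = sqrt (\<Sum>\<^sub>\<infinity>k. (cmod (coord v k))\<^sup>2)"
definition dist_ell2 :: "ell2 \<Rightarrow> ell2 \<Rightarrow> real" where
  "dist (v::ell2) w = norm (v - w)"
definition sgn_ell2 :: "ell2 \<Rightarrow> ell2" where
  "sgn (v::ell2) = inverse (norm v) *\<^sub>R v"
definition uniformity_ell2 :: "(ell2 \<times> ell2) filter" where
  "uniformity_ell2 = (INF e\<in>{0<..}. principal {(v, w). dist v w < e})"
definition open_ell2 :: "ell2 set \<Rightarrow> bool" where
  "open_ell2 U \<longleftrightarrow> (\<forall>x\<in>U. eventually (\<lambda>(x', y). x' = x \<longrightarrow> y \<in> U) uniformity)"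

lemma L2_set_coord_le: "finite F \<Longrightarrow> L2_set (\<lambda>k. cmod (coord v k)) F \<le> norm v"
  unfolding norm_ell2_def L2_set_def
  by (intro real_sqrt_le_mono finite_sum_le_infsum coord_summable) auto

lemma norm_ell2_leI:
  assumes "\<And>F. finite F \<Longrightarrow> L2_set (\<lambda>k. cmod (coord v k)) F \<le> c"
  shows "norm v \<le> c"
proof -
  have c: "0 \<le> c" using assms[of "{}"] by simp
  have "(\<Sum>k\<in>F. (cmod (coord v k))\<^sup>2) \<le> c\<^sup>2" if "finite F" for F
  proof -
    have "(L2_set (\<lambda>k. cmod (coord v k)) F)\<^sup>2 \<le> c\<^sup>2"
      by (intro power_mono assms that L2_set_nonneg)
    then show ?thesis by (simp add: L2_set_def sum_nonneg)
  qed
  then have "(\<Sum>\<^sub>\<infinity>k. (cmod (coord v k))\<^sup>2) \<le> c\<^sup>2"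
    by (intro infsum_le_finite_sums coord_summable) auto
  then show ?thesis unfolding norm_ell2_def
    using c by (intro real_le_lsqrt)
qed

lemma L2_set_cmod_add_le:
  "L2_set (\<lambda>k. cmod (x k + y k)) F \<le> L2_set (\<lambda>k. cmod (x k)) F + L2_set (\<lambda>k. cmod (y k)) F"
proof -
  have "L2_set (\<lambda>k. cmod (x k + y k)) F \<le> L2_set (\<lambda>k. cmod (x k) + cmod (y k)) F"
    by (intro L2_set_mono norm_triangle_ineq) auto
  also have "\<dots> \<le> L2_set (\<lambda>k. cmod (x k)) F + L2_set (\<lambda>k. cmod (y k)) F"
    by (rule L2_set_triangle_ineq)
  finally show ?thesis .
qed

lemma coord_zero: "coord 0 k = 0"
  unfolding zero_ell2_def by (subst ell2_inverse) auto

lemma coord_add: "coord (v + w) k = coord v k + coord w k"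
proof -
  have "(\<lambda>k. coord v k + coord w k) \<in> {x. (\<lambda>k. (cmod (x k))\<^sup>2) summable_on UNIV}"
    by (rule ell2I[where c = "norm v + norm w"])
      (intro order_trans[OF L2_set_cmod_add_le] add_mono L2_set_coord_le)
  then show ?thesis unfolding plus_ell2_def by (subst ell2_inverse) auto
qed

lemma coord_multiple: "coord (ell2 (\<lambda>k. a * coord v k)) k = a * coord v k"
proof -
  have "(\<lambda>k. (cmod a)\<^sup>2 * (cmod (coord v k))\<^sup>2) summable_on UNIV"
    by (rule summable_on_cmult_right[OF coord_summable])
  then show ?thesis
    by (subst ell2_inverse) (auto simp: norm_mult power_mult_distrib)
qed

lemma coord_scaleR: "coord (r *\<^sub>R v) k = of_real r * coord v k"
  unfolding scaleR_ell2_def by (rule coord_multiple)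

lemma coord_uminus: "coord (- v) k = - coord v k"
  using coord_multiple[of "-1" v k] by (simp add: uminus_ell2_def)

lemma coord_diff: "coord (v - w) k = coord v k - coord w k"
  using coord_add[of v "- w" k] by (simp add: minus_ell2_def plus_ell2_def coord_uminus)

lemma ell2_eqI: "(\<And>k. coord v k = coord w k) \<Longrightarrow> v = w"
  by (metis coord_inject ext)

lemmas coord_simps = coord_zero coord_add coord_scaleR coord_uminus coord_diff

lemma norm_multiple: "norm (ell2 (\<lambda>k. a * coord v k)) = cmod a * norm v"
proof -
  have "(\<Sum>\<^sub>\<infinity>k. (cmod a)\<^sup>2 * (cmod (coord v k))\<^sup>2) = (cmod a)\<^sup>2 * (\<Sum>\<^sub>\<infinity>k. (cmod (coord v k))\<^sup>2)"
    by (rule infsum_cmult_right')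
  then show ?thesis
    by (simp add: norm_ell2_def coord_multiple norm_mult power_mult_distrib real_sqrt_mult)
qed

lemma coord_le_norm: "cmod (coord v k) \<le> norm v"
  using L2_set_coord_le[of "{k}" v] by simp

instance
proof
  fix r s :: real and u v w :: ell2 and U :: "ell2 set"
  show "u + v + w = u + (v + w)" "u + v = v + u" "0 + v = v" "- v + v = 0" "v - w = v + - w"
    "r *\<^sub>R (v + w) = r *\<^sub>R v + r *\<^sub>R w" "(r + s) *\<^sub>R v = r *\<^sub>R v + s *\<^sub>R v"
    "r *\<^sub>R s *\<^sub>R v = (r * s) *\<^sub>R v" "1 *\<^sub>R v = v"
    by (auto intro!: ell2_eqI simp: coord_simps algebra_simps)
  show "dist v w = norm (v - w)" by (rule dist_ell2_def)
  show "sgn v = inverse (norm v) *\<^sub>R v" by (simp add: sgn_ell2_def)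
  show "(uniformity :: (ell2 \<times> ell2) filter) = (INF e\<in>{0<..}. principal {(v, w). dist v w < e})"
    by (rule uniformity_ell2_def)
  show "open U = (\<forall>x\<in>U. \<forall>\<^sub>F (x', y) in uniformity. x' = x \<longrightarrow> y \<in> U)"
    by (rule open_ell2_def)
  show "norm v = 0 \<longleftrightarrow> v = 0"
  proof
    assume "norm v = 0"
    then have "coord v k = 0" for k using coord_le_norm[of v k] by simp
    then show "v = 0" by (intro ell2_eqI) (simp add: coord_zero)
  qed (simp add: norm_ell2_def coord_zero)
  show "norm (v + w) \<le> norm v + norm w"
    by (rule norm_ell2_leI)
      (simp only: coord_add, intro order_trans[OF L2_set_cmod_add_le] add_mono L2_set_coord_le)
  show "norm (r *\<^sub>R v) = \<bar>r\<bar> * norm v"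
    using norm_multiple[of "of_real r" v] by (simp add: scaleR_ell2_def)
qed

end

instantiation ell2 :: complex_normed_vector
begin

definition scaleC_ell2 :: "complex \<Rightarrow> ell2 \<Rightarrow> ell2" where
  "a *\<^sub>C v = ell2 (\<lambda>k. a * coord v k)"

lemma coord_scaleC: "coord (a *\<^sub>C v) k = a * coord v k"
  unfolding scaleC_ell2_def by (rule coord_multiple)

instance
proof
  fix a b :: complex and r :: real and v w :: ell2
  show "a *\<^sub>C (v + w) = a *\<^sub>C v + a *\<^sub>C w" "(a + b) *\<^sub>C v = a *\<^sub>C v + b *\<^sub>C v"
    "a *\<^sub>C b *\<^sub>C v = (a * b) *\<^sub>C v" "of_real r *\<^sub>C v = r *\<^sub>R v"
    by (auto intro!: ell2_eqI simp: coord_simps coord_scaleC algebra_simps)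
  show "norm (a *\<^sub>C v) = cmod a * norm v"
    unfolding scaleC_ell2_def by (rule norm_multiple)
qed

end

instance ell2 :: complex_banach
proof
  fix X :: "nat \<Rightarrow> ell2"
  assume X: "Cauchy X"
  have "Cauchy (\<lambda>n. coord (X n) k)" for k
  proof (rule metric_CauchyI)
    fix e :: real assume "0 < e"
    then obtain M where M: "\<And>m n. M \<le> m \<Longrightarrow> M \<le> n \<Longrightarrow> dist (X m) (X n) < e"
      using X by (meson Cauchy_def)
    have "dist (coord (X m) k) (coord (X n) k) \<le> dist (X m) (X n)" for m n
      using coord_le_norm[of "X m - X n" k] by (simp add: dist_norm coord_diff)
    then show "\<exists>M. \<forall>m\<ge>M. \<forall>n\<ge>M. dist (coord (X m) k) (coord (X n) k) < e"
      using M by (meson le_less_trans)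
  qed
  then have "\<exists>l. (\<lambda>n. coord (X n) k) \<longlonglongrightarrow> l" for k
    by (simp add: Cauchy_convergent_iff convergent_def)
  then obtain x where x: "\<And>k. (\<lambda>n. coord (X n) k) \<longlonglongrightarrow> x k" by metis
  have L2_lim: "(\<lambda>n. L2_set (\<lambda>k. cmod (coord (X n) k - y k)) F) \<longlonglongrightarrow> L2_set (\<lambda>k. cmod (x k - y k)) F"
    for y :: "int \<Rightarrow> complex" and F
    unfolding L2_set_def by (intro tendsto_intros x)
  obtain c where c: "\<And>n. norm (X n) \<le> c"
    using Cauchy_Bseq[OF X] by (auto simp: Bseq_def)
  have "L2_set (\<lambda>k. cmod (x k)) F \<le> c" if "finite F" for F
  proof (rule LIMSEQ_le_const2)
    show "(\<lambda>n. L2_set (\<lambda>k. cmod (coord (X n) k)) F) \<longlonglongrightarrow> L2_set (\<lambda>k. cmod (x k)) F"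
      using L2_lim[of "\<lambda>_. 0" F] by simp
    show "\<exists>N. \<forall>n\<ge>N. L2_set (\<lambda>k. cmod (coord (X n) k)) F \<le> c"
      using L2_set_coord_le[OF that] c by (meson order_trans)
  qed
  then have coord_x: "coord (ell2 x) = x"
    by (intro ell2_inverse ell2I)
  have "X \<longlonglongrightarrow> ell2 x"
  proof (rule metric_LIMSEQ_I)
    fix e :: real assume "0 < e"
    then obtain M where M: "\<And>m n. M \<le> m \<Longrightarrow> M \<le> n \<Longrightarrow> dist (X m) (X n) < e / 2"
      using X by (meson Cauchy_def half_gt_zero)
    have "dist (X n) (ell2 x) \<le> e / 2" if n: "M \<le> n" for n
    proof -
      have "L2_set (\<lambda>k. cmod (x k - coord (X n) k)) F \<le> e / 2" if "finite F" for F
      proof (rule LIMSEQ_le_const2[OF L2_lim])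
        have "L2_set (\<lambda>k. cmod (coord (X m) k - coord (X n) k)) F \<le> e / 2" if "M \<le> m" for m
          using L2_set_coord_le[OF \<open>finite F\<close>, of "X m - X n"] M[OF that n]
          by (simp add: dist_norm coord_diff)
        then show "\<exists>N. \<forall>m\<ge>N. L2_set (\<lambda>k. cmod (coord (X m) k - coord (X n) k)) F \<le> e / 2"
          by blast
      qed
      then have "norm (ell2 x - X n) \<le> e / 2"
        by (intro norm_ell2_leI) (simp add: coord_diff coord_x)
      then show ?thesis by (simp add: dist_norm norm_minus_commute)
    qed
    then show "\<exists>M. \<forall>n\<ge>M. dist (X n) (ell2 x) < e"
      using \<open>0 < e\<close> by (intro exI[of _ M]) fastforce
  qed
  then show "convergent X" by (rule convergentI)
qed

definition phi :: "int \<Rightarrow> ell2" where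
  "phi k = ell2 (\<lambda>l. if l = k then 1 else 0)"

definition diag_op :: "(int \<Rightarrow> complex) \<Rightarrow> ell2 \<rightharpoonup> ell2" where
  "diag_op a v = (if (\<lambda>k. (cmod (a k * coord v k))\<^sup>2) summable_on UNIV
                  then Some (ell2 (\<lambda>k. a k * coord v k)) else None)"


section \<open>Semigroups, resolvents and extrapolation spaces\<close>

text \<open>An unbounded operator \<^term>\<open>A\<close> is a partial function and its domain is \<^term>\<open>dom A\<close>. Only the
  values of a semigroup at nonnegative times are relevant.\<close>

definition C0_semigroup :: "(real \<Rightarrow> 'a \<Rightarrow> 'a::complex_normed_vector) \<Rightarrow> bool" where
  "C0_semigroup T \<longleftrightarrow> (\<forall>t\<ge>0. bounded_clinear (T t)) \<and> T 0 = id \<and>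
     (\<forall>s\<ge>0. \<forall>t\<ge>0. T (s + t) = T s \<circ> T t) \<and>
     (\<forall>x. ((\<lambda>t. T t x) \<longlongrightarrow> x) (at_right 0))"

definition generates :: "('a \<rightharpoonup> 'a) \<Rightarrow> (real \<Rightarrow> 'a \<Rightarrow> 'a::complex_normed_vector) \<Rightarrow> bool" where
  "generates A T \<longleftrightarrow> C0_semigroup T \<and>
     (\<forall>x y. A x = Some y \<longleftrightarrow> ((\<lambda>h. (T h x - x) /\<^sub>R h) \<longlongrightarrow> y) (at_right 0))"

definition strongly_stable :: "(real \<Rightarrow> 'a \<Rightarrow> 'a::complex_normed_vector) \<Rightarrow> bool" where
  "strongly_stable T \<longleftrightarrow> (\<forall>x. ((\<lambda>t. T t x) \<longlongrightarrow> 0) at_top)"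

definition resolvent :: "('a \<rightharpoonup> 'a) \<Rightarrow> complex \<Rightarrow> 'a \<Rightarrow> 'a::complex_normed_vector" where
  "resolvent A \<mu> y = (THE x. x \<in> dom A \<and> \<mu> *\<^sub>C x - the (A x) = y)"

definition resolvent_set :: "('a::complex_normed_vector \<rightharpoonup> 'a) \<Rightarrow> complex set" where
  "resolvent_set A = {\<mu>. (\<forall>y. \<exists>!x. x \<in> dom A \<and> \<mu> *\<^sub>C x - the (A x) = y) \<and>
                         bounded_clinear (resolvent A \<mu>)}"

text \<open>\<open>extrapolation_space A \<alpha> i\<close>: the codomain of \<open>i\<close> is the completion of \<open>X\<close> in the norm
  \<open>\<parallel>R(\<alpha>, A) \<cdot>\<parallel>\<close>, and \<open>i\<close> is the embedding of \<open>X\<close>.\<close>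

definition extrapolation_space ::
  "('a::complex_normed_vector \<rightharpoonup> 'a) \<Rightarrow> complex \<Rightarrow> ('a \<Rightarrow> 'm::complex_banach) \<Rightarrow> bool" where
  "extrapolation_space A \<alpha> i \<longleftrightarrow> \<alpha> \<in> resolvent_set A \<and> bounded_clinear i \<and>
     (\<forall>x. norm (i x) = norm (resolvent A \<alpha> x)) \<and> closure (range i) = UNIV"

text \<open>The extension of \<open>A\<close> to an operator from \<open>X\<close> to \<open>X\<^sub>-\<^sub>1\<close>, its resolvent as a map from
  \<open>X\<^sub>-\<^sub>1\<close> to \<open>X\<close>, and the extension of the semigroup to \<open>X\<^sub>-\<^sub>1\<close>.\<close>

definition op_ext ::
  "('a \<rightharpoonup> 'a) \<Rightarrow> ('a \<Rightarrow> 'm) \<Rightarrow> 'a::complex_normed_vector \<Rightarrow> 'm::complex_normed_vector" where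
  "op_ext A i = (THE g. bounded_clinear g \<and> (\<forall>x y. A x = Some y \<longrightarrow> g x = i y))"

definition resolvent_ext ::
  "('a \<rightharpoonup> 'a) \<Rightarrow> ('a \<Rightarrow> 'm) \<Rightarrow> complex \<Rightarrow> 'm::complex_normed_vector \<Rightarrow> 'a::complex_normed_vector" where
  "resolvent_ext A i \<mu> b = (THE x. \<mu> *\<^sub>C i x - op_ext A i x = b)"

definition semigroup_ext ::
  "(real \<Rightarrow> 'a \<Rightarrow> 'a) \<Rightarrow> ('a::complex_normed_vector \<Rightarrow> 'm) \<Rightarrow> real \<Rightarrow> 'm \<Rightarrow> 'm::complex_normed_vector" where
  "semigroup_ext T i t = (THE g. bounded_clinear g \<and> (\<forall>x. g (i x) = i (T t x)))"


section \<open>Admissibility and regularity\<close>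

text \<open>Bochner square integrability; the library's Bochner integral is restricted to separable spaces.\<close>

definition square_integrable_on :: "(real \<Rightarrow> 'a::real_normed_vector) \<Rightarrow> real set \<Rightarrow> bool" where
  "square_integrable_on f S \<longleftrightarrow>
     (\<exists>s. (\<forall>n. simple_function lebesgue (s n)) \<and>
          (AE t in lebesgue. t \<in> S \<longrightarrow> (\<lambda>n. s n t) \<longlonglongrightarrow> f t)) \<and>
     (\<integral>\<^sup>+t\<in>S. ennreal ((norm (f t))\<^sup>2) \<partial>lebesgue) < \<infinity>"

definition admissible_control ::
  "(real \<Rightarrow> 'a \<Rightarrow> 'a::complex_normed_vector) \<Rightarrow> ('a \<Rightarrow> 'm::complex_banach) \<Rightarrow>
   ('u::complex_normed_vector \<Rightarrow> 'm) \<Rightarrow> bool" where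
  "admissible_control T i B \<longleftrightarrow> bounded_clinear B \<and>
     (\<exists>\<tau>>0. \<forall>u. square_integrable_on u {0..\<tau>} \<longrightarrow>
        (\<exists>x. ((\<lambda>s. semigroup_ext T i (\<tau> - s) (B (u s))) has_integral i x) {0..\<tau>}))"

text \<open>Observation operators are total functions of which only the restriction to \<open>X\<^sub>1 = dom A\<close>
  is relevant.\<close>

definition bounded_clinear_X1 ::
  "('a::complex_normed_vector \<rightharpoonup> 'a) \<Rightarrow> complex \<Rightarrow> ('a \<Rightarrow> 'y::complex_normed_vector) \<Rightarrow> bool" where
  "bounded_clinear_X1 A \<alpha> C \<longleftrightarrow>
     (\<forall>x\<in>dom A. \<forall>y\<in>dom A. C (x + y) = C x + C y) \<and>
     (\<forall>a. \<forall>x\<in>dom A. C (a *\<^sub>C x) = a *\<^sub>C C x) \<and>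
     (\<exists>M. \<forall>x\<in>dom A. norm (C x) \<le> M * norm (\<alpha> *\<^sub>C x - the (A x)))"

definition admissible_observation ::
  "('a \<rightharpoonup> 'a) \<Rightarrow> (real \<Rightarrow> 'a \<Rightarrow> 'a::complex_normed_vector) \<Rightarrow> complex \<Rightarrow>
   ('a \<Rightarrow> 'y::complex_normed_vector) \<Rightarrow> bool" where
  "admissible_observation A T \<alpha> C \<longleftrightarrow> bounded_clinear_X1 A \<alpha> C \<and>
     (\<exists>\<tau>>0. \<exists>M. \<forall>x\<in>dom A.
        (\<integral>\<^sup>+t\<in>{0..\<tau>}. ennreal ((norm (C (T t x)))\<^sup>2) \<partial>lebesgue) \<le> ennreal (M * (norm x)\<^sup>2))"

definition Lambda_dom ::
  "('a::complex_normed_vector \<rightharpoonup> 'a) \<Rightarrow> ('a \<Rightarrow> 'y::complex_normed_vector) \<Rightarrow> 'a set" where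
  "Lambda_dom A C = {x. \<exists>y. ((\<lambda>\<mu>::real. \<mu> *\<^sub>R C (resolvent A (of_real \<mu>) x)) \<longlongrightarrow> y) at_top}"

definition Lambda_ext ::
  "('a::complex_normed_vector \<rightharpoonup> 'a) \<Rightarrow> ('a \<Rightarrow> 'y::complex_normed_vector) \<Rightarrow> 'a \<Rightarrow> 'y" where
  "Lambda_ext A C x = Lim at_top (\<lambda>\<mu>::real. \<mu> *\<^sub>R C (resolvent A (of_real \<mu>) x))"

definition regular ::
  "('a::complex_normed_vector \<rightharpoonup> 'a) \<Rightarrow> complex \<Rightarrow> ('a \<Rightarrow> 'm::complex_banach) \<Rightarrow>
   ('u \<Rightarrow> 'm) \<Rightarrow> ('a \<Rightarrow> 'y::complex_normed_vector) \<Rightarrow> bool" where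
  "regular A \<alpha> i B C \<longleftrightarrow> range (\<lambda>u. resolvent_ext A i \<alpha> (B u)) \<subseteq> Lambda_dom A C \<and>
     (\<forall>u. ((\<lambda>\<mu>::real. Lambda_ext A C (resolvent_ext A i (of_real \<mu>) (B u))) \<longlongrightarrow> 0) at_top)"

definition regular_linear_system ::
  "('a \<rightharpoonup> 'a) \<Rightarrow> (real \<Rightarrow> 'a \<Rightarrow> 'a::complex_normed_vector) \<Rightarrow> complex \<Rightarrow> ('a \<Rightarrow> 'm::complex_banach) \<Rightarrow>
   ('u::complex_normed_vector \<Rightarrow> 'm) \<Rightarrow> ('a \<Rightarrow> 'y::complex_normed_vector) \<Rightarrow> ('u \<Rightarrow> 'y) \<Rightarrow> bool" where
  "regular_linear_system A T \<alpha> i B C D \<longleftrightarrow> generates A T \<and> extrapolation_space A \<alpha> i \<and>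
     admissible_control T i B \<and> admissible_observation A T \<alpha> C \<and> bounded_clinear D \<and>
     regular A \<alpha> i B C"

text \<open>The state \<open>x(t) = T(t) x\<^sub>0 + \<integral>\<^sub>0\<^sup>t T(t - s) B f(s) ds\<close>, the integral being taken
  in \<open>X\<^sub>-\<^sub>1\<close>.\<close>

definition mild_state ::
  "(real \<Rightarrow> 'a \<Rightarrow> 'a) \<Rightarrow> ('a::complex_normed_vector \<Rightarrow> 'm::complex_banach) \<Rightarrow> ('u \<Rightarrow> 'm) \<Rightarrow>
   (real \<Rightarrow> 'u) \<Rightarrow> 'a \<Rightarrow> real \<Rightarrow> 'a" where
  "mild_state T i B f x\<^sub>0 t =
     (THE x. ((\<lambda>s. semigroup_ext T i (t - s) (B (f s))) has_integral (i x - i (T t x\<^sub>0))) {0..t})"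


section \<open>The closed-loop system\<close>

definition extended_dom ::
  "('a::complex_normed_vector \<rightharpoonup> 'a) \<Rightarrow> complex \<Rightarrow> ('a \<Rightarrow> 'm::complex_banach) \<Rightarrow> ('u \<Rightarrow> 'm) \<Rightarrow> 'a set" where
  "extended_dom A \<alpha> i B = {x + resolvent_ext A i \<alpha> (B u) | x u. x \<in> dom A}"

definition closed_loop_matrix ::
  "('x::complex_banach \<rightharpoonup> 'x) \<Rightarrow> ('x \<Rightarrow> 'xm::complex_banach) \<Rightarrow>
   ('u::complex_hilbert \<Rightarrow> 'xm) \<Rightarrow> ('x \<Rightarrow> 'y::complex_hilbert) \<Rightarrow> ('u \<Rightarrow> 'y) \<Rightarrow>
   ('z::complex_banach \<rightharpoonup> 'z) \<Rightarrow> ('z \<Rightarrow> 'zm::complex_banach) \<Rightarrow> ('y \<Rightarrow> 'zm) \<Rightarrow> ('z \<Rightarrow> 'u) \<Rightarrow>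
   'x \<times> 'z \<Rightarrow> 'xm \<times> 'zm" where
  "closed_loop_matrix A i B C D G1 j G2 K = (\<lambda>(x, z).
     (op_ext A i x + B (Lambda_ext G1 K z),
      G2 (Lambda_ext A C x) + (op_ext G1 j z + G2 (D (Lambda_ext G1 K z)))))"

definition closed_loop_generator ::
  "('x::complex_banach \<rightharpoonup> 'x) \<Rightarrow> complex \<Rightarrow> ('x \<Rightarrow> 'xm::complex_banach) \<Rightarrow>
   ('u::complex_hilbert \<Rightarrow> 'xm) \<Rightarrow> ('x \<Rightarrow> 'y::complex_hilbert) \<Rightarrow> ('u \<Rightarrow> 'y) \<Rightarrow>
   ('z::complex_banach \<rightharpoonup> 'z) \<Rightarrow> complex \<Rightarrow> ('z \<Rightarrow> 'zm::complex_banach) \<Rightarrow> ('y \<Rightarrow> 'zm) \<Rightarrow> ('z \<Rightarrow> 'u) \<Rightarrow>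
   ('x \<times> 'z \<rightharpoonup> 'x \<times> 'z)" where
  "closed_loop_generator A \<alpha> i B C D G1 \<beta> j G2 K xe =
     (if xe \<in> extended_dom A \<alpha> i B \<times> extended_dom G1 \<beta> j G2 \<and>
         closed_loop_matrix A i B C D G1 j G2 K xe \<in> range (map_prod i j)
      then Some (inv (map_prod i j) (closed_loop_matrix A i B C D G1 j G2 K xe))
      else None)"

definition closed_loop_output ::
  "('x::complex_banach \<rightharpoonup> 'x) \<Rightarrow> ('x \<Rightarrow> 'y::complex_hilbert) \<Rightarrow> ('u::complex_hilbert \<Rightarrow> 'y) \<Rightarrow>
   ('z::complex_banach \<rightharpoonup> 'z) \<Rightarrow> ('z \<Rightarrow> 'u) \<Rightarrow> 'x \<times> 'z \<Rightarrow> 'y" where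
  "closed_loop_output A C D G1 K = (\<lambda>(x, z). Lambda_ext A C x + D (Lambda_ext G1 K z))"

text \<open>The columns of \<open>B\<^sub>e\<close> have values in \<open>X\<^sub>-\<^sub>1 \<times> Z\<^sub>-\<^sub>1\<close>, whereas \<open>B\<^sub>e\<close> itself has values in
  \<open>X\<^sub>e\<^sub>,\<^sub>-\<^sub>1\<close>, the extrapolation space of the closed-loop generator (with embedding \<open>k\<close>); neither
  space contains the other. An element \<open>b\<close> of \<open>X\<^sub>e\<^sub>,\<^sub>-\<^sub>1\<close> is identified with
  \<open>h\<close> in \<open>X\<^sub>-\<^sub>1 \<times> Z\<^sub>-\<^sub>1\<close> if, for some \<open>xe\<close> and \<open>ye\<close> in \<open>X\<^sub>e\<close>, the identity \<open>A\<^sub>e xe + h = ye\<close> with the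
  operator matrix \<open>A\<^sub>e\<close> in \<open>X\<^sub>-\<^sub>1 \<times> Z\<^sub>-\<^sub>1\<close> corresponds to \<open>A\<^sub>e xe + b = ye\<close> with the
  extension of \<open>A\<^sub>e\<close> in \<open>X\<^sub>e\<^sub>,\<^sub>-\<^sub>1\<close>. Equivalently,
  \<open>xe = R(\<mu>, A\<^sub>e) b\<close> is the solution of the closed-loop resolvent equation with
  right-hand side \<open>h\<close>. At most one \<open>b\<close> is identified with a given \<open>h\<close>, since two
  choices of \<open>xe\<close> differ by an element of the domain of \<open>A\<^sub>e\<close>.\<close>

definition closed_loop_identified ::
  "('x::complex_banach \<rightharpoonup> 'x) \<Rightarrow> complex \<Rightarrow> ('x \<Rightarrow> 'xm::complex_banach) \<Rightarrow>
   ('u::complex_hilbert \<Rightarrow> 'xm) \<Rightarrow> ('ud::complex_banach \<Rightarrow> 'xm) \<Rightarrow>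
   ('x \<Rightarrow> 'y::complex_hilbert) \<Rightarrow> ('u \<Rightarrow> 'y) \<Rightarrow>
   ('z::complex_banach \<rightharpoonup> 'z) \<Rightarrow> complex \<Rightarrow> ('z \<Rightarrow> 'zm::complex_banach) \<Rightarrow> ('y \<Rightarrow> 'zm) \<Rightarrow> ('z \<Rightarrow> 'u) \<Rightarrow>
   ('x \<times> 'z \<Rightarrow> 'em::complex_banach) \<Rightarrow> 'xm \<times> 'zm \<Rightarrow> 'em \<Rightarrow> bool" where
  "closed_loop_identified A \<alpha> i B Bd C D G1 \<beta> j G2 K k h b \<longleftrightarrow>
     (\<exists>xe \<in> extended_dom A \<alpha> i (\<lambda>(u, w). B u + Bd w) \<times> extended_dom G1 \<beta> j G2. \<exists>ye.
        closed_loop_matrix A i B C D G1 j G2 K xe + h = map_prod i j ye \<and>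
        op_ext (closed_loop_generator A \<alpha> i B C D G1 \<beta> j G2 K) k xe + b = k ye)"


section \<open>Output regulation\<close>

definition sylvester_equation ::
  "('w \<rightharpoonup> 'w) \<Rightarrow> ('a \<rightharpoonup> 'a) \<Rightarrow> ('a::complex_normed_vector \<Rightarrow> 'm::complex_banach) \<Rightarrow> ('w \<Rightarrow> 'm) \<Rightarrow>
   ('w \<Rightarrow> 'a) \<Rightarrow> bool" where
  "sylvester_equation S A i B \<Sigma> \<longleftrightarrow>
     (\<forall>v\<in>dom S. i (\<Sigma> (the (S v))) = op_ext A i (\<Sigma> v) + B v)"

text \<open>For a regular linear system the state lies in \<^term>\<open>Lambda_dom A C\<close> at almost every time, so
  the arbitrary values of \<^term>\<open>Lambda_ext A C\<close> elsewhere do not affect the integral of the error.\<close>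

definition regulation_error ::
  "('a \<rightharpoonup> 'a) \<Rightarrow> (real \<Rightarrow> 'a \<Rightarrow> 'a::complex_normed_vector) \<Rightarrow> ('a \<Rightarrow> 'm::complex_banach) \<Rightarrow> ('w \<Rightarrow> 'm) \<Rightarrow>
   ('a \<Rightarrow> 'y::complex_normed_vector) \<Rightarrow> ('w \<Rightarrow> 'y) \<Rightarrow> (real \<Rightarrow> 'w) \<Rightarrow> 'a \<Rightarrow> real \<Rightarrow> 'y" where
  "regulation_error A T i B C D v x\<^sub>0 t = Lambda_ext A C (mild_state T i B v x\<^sub>0 t) + D (v t)"

definition solves_output_regulation ::
  "('a \<rightharpoonup> 'a) \<Rightarrow> (real \<Rightarrow> 'a \<Rightarrow> 'a::complex_normed_vector) \<Rightarrow> ('a \<Rightarrow> 'm::complex_banach) \<Rightarrow> ('w \<Rightarrow> 'm) \<Rightarrow>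
   ('a \<Rightarrow> 'y::complex_normed_vector) \<Rightarrow> ('w \<Rightarrow> 'y) \<Rightarrow> (real \<Rightarrow> 'w \<Rightarrow> 'w) \<Rightarrow> bool" where
  "solves_output_regulation A T i B C D TS \<longleftrightarrow> strongly_stable T \<and>
     (\<forall>x\<^sub>0 v\<^sub>0. ((\<lambda>t. \<integral>\<^sup>+s\<in>{t..t + 1}.
        ennreal (norm (regulation_error A T i B C D (\<lambda>r. TS r v\<^sub>0) x\<^sub>0 s)) \<partial>lebesgue) \<longlongrightarrow> 0) at_top)"

end

theory Submission
  imports Defs "HOL-Real_Asymp.Real_Asymp"
begin

text \<open>Write \<open>v(t)\<close> for the exosystem state. The Sylvester equation turns the closed-loop state into
  \<open>x(t) = T(t) (x(0) - \<Sigma> v(0)) + \<Sigma> v(t)\<close>; this is checked on the eigenvectors \<open>\<phi>\<^sub>n\<close> of \<open>S\<close> and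
  extended by density. Hence the error is \<open>C\<^sub>\<Lambda> T(t) z + (C\<^sub>\<Lambda> \<Sigma> + D) v(t)\<close> for almost every \<open>t\<close>,
  with \<open>z = x(0) - \<Sigma> v(0)\<close>. By admissibility, the integral of the norm of the first term over
  \<open>[t, t + 1]\<close> is at most a multiple of the norm of \<open>T(t) z\<close>, which tends to \<open>0\<close>. For \<open>z = 0\<close> and
  \<open>v(0) = \<phi>\<^sub>n\<close> the second term has constant norm, so regulation forces \<open>(C\<^sub>\<Lambda> \<Sigma> + D) \<phi>\<^sub>n = 0\<close>; as
  \<open>C\<^sub>\<Lambda> \<Sigma>\<close> is bounded by the Banach-Steinhaus theorem, \<open>C\<^sub>\<Lambda> \<Sigma> + D = 0\<close>.

  That \<open>T(t) x\<close> lies in the domain of \<open>C\<^sub>\<Lambda>\<close> for almost every \<open>t\<close> (Weiss) follows from a maximal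
  inequality: approximate \<open>x\<close> rapidly by elements of the domain of \<open>A\<close>, and bound the output of the tails
  by averages of the integrable function \<open>\<Sum>\<^sub>m exp (- s) \<parallel>C T(s) d\<^sub>m\<parallel>\<close> of \<open>s\<close>, where \<open>d\<^sub>m\<close> are the increments.\<close>


section \<open>Strongly continuous semigroups\<close>

text \<open>The mild solution is an integral in the extrapolation space, but the calculus happens in
  the state space. There is an isometry \<open>J\<close> of the state space onto the extrapolation
  space, the extension of \<gamma> - A; the embedding is \<open>J\<close> after the resolvent, and
  the extended semigroup is the conjugate of \<open>T\<close> by \<open>J\<close>. For an
  eigenvector v of S the Sylvester equation becomes a formula for the inverse image of B v that
  involves only an element of \<open>dom A\<close>, and the integrand is then an exact derivative.
  Strong stability also gives, by Banach-Steinhaus, one bound on \<open>T\<close> for all times, so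
  every l > 0 has a resolvent given by a Laplace transform; as \<Lambda>-extensions use only large
  l, this is all the spectral information required. The delicate point is pointwise in time:
  estimates of outputs in the mean do not allow the limit l to infinity to be exchanged with an
  approximation of the state at a fixed t. A maximal inequality makes the approximation uniform in l
  for almost every t. The weight exp(-s) makes outputs integrable on the half-line and costs only a
  shift from l to l - 1.\<close>

lemma scaleC_one: "1 *\<^sub>C (x::'a::complex_normed_vector) = x"
  using scaleC_of_real[of 1 x] by simp

lemma scaleC_zero_left: "0 *\<^sub>C (x::'a::complex_normed_vector) = 0"
  using scaleC_of_real[of 0 x] by simp

lemma scaleC_minus_left: "(- a) *\<^sub>C (x::'a::complex_normed_vector) = - (a *\<^sub>C x)"
  using scaleC_add_left[of "-a" a x] by (simp add: scaleC_zero_left add_eq_0_iff2)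

lemma scaleC_diff_left: "(a - b) *\<^sub>C (x::'a::complex_normed_vector) = a *\<^sub>C x - b *\<^sub>C x"
  using scaleC_add_left[of a "-b" x] by (simp add: scaleC_minus_left)

lemma bounded_bilinear_scaleC:
  "bounded_bilinear ((*\<^sub>C) :: complex \<Rightarrow> 'a \<Rightarrow> 'a::complex_normed_vector)"
proof
  show "\<exists>K. \<forall>a (b::'a). norm (a *\<^sub>C b) \<le> norm a * norm b * K"
    by (intro exI[of _ 1]) (simp add: norm_scaleC)
  show "(r *\<^sub>R a) *\<^sub>C b = r *\<^sub>R (a *\<^sub>C b)" for r a and b :: 'a
    by (simp add: scaleC_scaleC scaleR_conv_of_real flip: scaleC_of_real)
  show "a *\<^sub>C r *\<^sub>R b = r *\<^sub>R (a *\<^sub>C b)" for r a and b :: 'a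
    by (simp add: scaleC_scaleC mult.commute flip: scaleC_of_real)
qed (simp_all add: scaleC_add_left scaleC_add_right)

lemmas bounded_linear_scaleC = bounded_bilinear.bounded_linear_right[OF bounded_bilinear_scaleC]
lemmas scaleC_right_simps = linear_0[OF bounded_linear.linear[OF bounded_linear_scaleC]]
  linear_diff[OF bounded_linear.linear[OF bounded_linear_scaleC]]
  linear_scale[OF bounded_linear.linear[OF bounded_linear_scaleC]]

lemma bounded_clinear_imp_bounded_linear: "bounded_clinear f \<Longrightarrow> bounded_linear f"
  and bounded_clinear_scaleC: "bounded_clinear f \<Longrightarrow> f (a *\<^sub>C x) = a *\<^sub>C f x"
  by (auto simp: bounded_clinear_def)

lemma bounded_clinear_compose:
  "bounded_clinear f \<Longrightarrow> bounded_clinear g \<Longrightarrow> bounded_clinear (\<lambda>x. f (g x))"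
  by (auto simp: bounded_clinear_def intro: bounded_linear_compose)

text \<open>Baire category: the sets \<open>U N\<close> where some member of the family exceeds
  \<open>N\<close> are open. If all of them were dense they would share a point, against pointwise
  boundedness, so one of them misses a ball. The index set may be uncountable; in one application it
  is the time axis.\<close>

lemma uniform_boundedness:
  fixes f :: "'i \<Rightarrow> 'a::banach \<Rightarrow> 'b::real_normed_vector"
  assumes f: "\<And>i. i \<in> I \<Longrightarrow> bounded_linear (f i)"
    and bounded: "\<And>x. \<exists>c. \<forall>i\<in>I. norm (f i x) \<le> c"
  obtains M where "0 \<le> M" "\<And>i x. i \<in> I \<Longrightarrow> norm (f i x) \<le> M * norm x"
proof -
  define U where "U N = (\<Union>i\<in>I. {x. real N < norm (f i x)})" for N
  have "open (U N)" for N
    unfolding U_def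
    by (intro open_UN ballI open_Collect_less continuous_intros
        linear_continuous_on[OF f, THEN continuous_on_compose2[OF continuous_on_norm_id]]) auto
  have "\<exists>N. closure (U N) \<noteq> UNIV"
  proof (rule ccontr)
    assume "\<not> ?thesis"
    then have "\<And>N. closure (U N) = UNIV" by auto
    then have "Met_TC.mtopology closure_of \<Inter>(range U) = (UNIV :: 'a set)"
      using \<open>\<And>N. open (U N)\<close>
      by (intro Met_TC.metric_Baire_category) (auto simp: mcomplete_iff_complete complete_UNIV)
    then have "closure (\<Inter>(range U)) = UNIV" by simp
    then obtain x where x: "x \<in> \<Inter>(range U)" by (metis UNIV_not_empty closure_empty ex_in_conv)
    obtain c where c: "\<forall>i\<in>I. norm (f i x) \<le> c" using bounded by blast
    obtain N :: nat where "c \<le> N" using real_arch_simple by blast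
    moreover obtain i where "i \<in> I" "real N < norm (f i x)" using x by (auto simp: U_def)
    ultimately show False using c by fastforce
  qed
  then obtain N x where x: "x \<notin> closure (U N)" by blast
  then obtain r where r: "0 < r" "\<And>y. dist y x < r \<Longrightarrow> y \<notin> U N"
    unfolding closure_approachable by (metis not_le)
  have N: "norm (f i y) \<le> N" if "dist y x < r" "i \<in> I" for i y
    using r(2)[OF that(1)] that(2) by (force simp: U_def)
  have "norm (f i y) \<le> (4 * N / r) * norm y" if i: "i \<in> I" for i y
  proof (cases "y = 0")
    case True
    then show ?thesis using f[OF i] by (simp add: linear_simps)
  next
    case False
    interpret f: bounded_linear "f i" by (rule f[OF i])
    \<comment> \<open>With this scale \<open>x + a *\<^sub>R y\<close> is at distance
      \<open>r / 2\<close> from \<open>x\<close>, so both values in the difference below are at most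
      \<open>N\<close>; dividing \<open>2 * N\<close> by \<open>a\<close> yields the constant
      \<open>4 * N / r\<close>.\<close>
    define a where "a = r / (2 * norm y)"
    have a: "0 < a" using r(1) False by (simp add: a_def)
    have "norm (a *\<^sub>R f i y) = norm (f i (x + a *\<^sub>R y) - f i x)"
      by (simp add: f.add f.scaleR)
    also have "\<dots> \<le> norm (f i (x + a *\<^sub>R y)) + norm (f i x)" by (rule norm_triangle_ineq4)
    also have "\<dots> \<le> real N + real N"
      using r(1) False by (intro add_mono N i) (auto simp: dist_norm a_def)
    finally have "norm (f i y) * a \<le> 2 * N" using a by (simp add: mult.commute)
    then show ?thesis using r(1) False by (simp add: a_def field_simps)
  qed
  then show ?thesis using r(1) by (intro that[of "4 * N / r"]) auto
qed

text \<open>Uniform boundedness gives one constant for the whole sequence, and it survives the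
  limit.\<close>

lemma bounded_linear_pointwise_limit:
  fixes f :: "nat \<Rightarrow> 'a::banach \<Rightarrow> 'b::real_normed_vector"
  assumes f: "\<And>n. bounded_linear (f n)" and lim: "\<And>x. (\<lambda>n. f n x) \<longlonglongrightarrow> g x"
  shows "bounded_linear g"
proof -
  have "\<exists>c. \<forall>n\<in>UNIV. norm (f n x) \<le> c" for x
    using convergent_imp_Bseq[OF convergentI[OF lim[of x]]] by (auto simp: Bseq_def)
  then obtain M where M: "\<And>n x. norm (f n x) \<le> M * norm x"
    using uniform_boundedness[of UNIV f] f by (metis UNIV_I)
  show ?thesis
  proof (rule bounded_linear_intro[where K = M])
    show "g (x + y) = g x + g y" for x y
      using tendsto_add[OF lim[of x] lim[of y]] lim[of "x + y"]
      by (intro LIMSEQ_unique) (simp_all add: linear_simps[OF f])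
    show "g (r *\<^sub>R x) = r *\<^sub>R g x" for r x
      using tendsto_scaleR[OF tendsto_const lim[of x], of r] lim[of "r *\<^sub>R x"]
      by (intro LIMSEQ_unique) (simp_all add: linear_simps[OF f])
    show "norm (g x) \<le> norm x * M" for x
      using M by (intro LIMSEQ_le_const2[OF tendsto_norm[OF lim]]) (auto simp: mult.commute)
  qed
qed

lemma bounded_linear_eq_on_dense:
  assumes "bounded_linear f" "bounded_linear g" "closure V = UNIV" "\<And>x. x \<in> V \<Longrightarrow> f x = g x"
  shows "f = g"
proof
  fix x
  have "x \<in> closure V" using assms(3) by simp
  then show "f x = g x"
    using continuous_constant_on_closure[of V "\<lambda>x. f x - g x" 0 x]
    by (simp add: assms continuous_on_diff linear_continuous_on)
qed

section \<open>Continuity and differentiability of semigroup orbits\<close>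

lemma C0_semigroupD:
  assumes "C0_semigroup T"
  shows "0 \<le> t \<Longrightarrow> bounded_clinear (T t)" "0 \<le> t \<Longrightarrow> bounded_linear (T t)" "T 0 x = x"
    "0 \<le> s \<Longrightarrow> 0 \<le> t \<Longrightarrow> T (s + t) x = T s (T t x)"
    "((\<lambda>t. T t x) \<longlongrightarrow> x) (at_right 0)"
  using assms by (auto simp: C0_semigroup_def bounded_clinear_def)

text \<open>Without a uniform bound near time 0 there would be times \<open>t n\<close> tending to 0
  at which \<open>T (t n)\<close> has norm above \<open>n\<close>, whereas strong continuity at 0
  bounds each sequence \<open>T (t n) y\<close>, against uniform boundedness. The semigroup law then
  carries the bound of one short interval up to \<open>b\<close>.\<close>

lemma C0_semigroup_locally_bounded:
  fixes T :: "real \<Rightarrow> 'a \<Rightarrow> 'a::complex_banach"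
  assumes T: "C0_semigroup T"
  obtains M where "0 \<le> M" "\<And>t x. 0 \<le> t \<Longrightarrow> t \<le> b \<Longrightarrow> norm (T t x) \<le> M * norm x"
proof -
  note TD = C0_semigroupD[OF T]
  have "\<exists>\<delta>>0. \<exists>M. \<forall>t x. 0 \<le> t \<longrightarrow> t \<le> \<delta> \<longrightarrow> norm (T t x) \<le> M * norm x"
  proof (rule ccontr)
    assume "\<not> ?thesis"
    then have "\<forall>n::nat. \<exists>t x. 0 \<le> t \<and> t \<le> 1 / (Suc n) \<and> norm (T t x) > n * norm x"
      by (metis not_le of_nat_0_less_iff zero_less_Suc zero_less_divide_1_iff)
    then obtain t x where t: "\<And>n. 0 \<le> t n" "\<And>n::nat. t n \<le> 1 / Suc n"
      and x: "\<And>n::nat. norm (T (t n) (x n)) > n * norm (x n)" by metis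
    have t_lim: "t \<longlonglongrightarrow> 0"
      by (rule tendsto_sandwich[OF _ _ tendsto_const LIMSEQ_inverse_real_of_nat])
        (use t in \<open>auto simp: inverse_eq_divide\<close>)
    have "(\<lambda>n. T (t n) y) \<longlonglongrightarrow> y" for y
    proof -
      have "((\<lambda>t. T t y) \<longlongrightarrow> y) (at 0 within {0..})"
        using TD(5)[of y] by (simp add: at_within_Ici_at_right)
      then have "continuous (at 0 within {0..}) (\<lambda>t. T t y)"
        by (simp add: continuous_within TD(3))
      then show ?thesis
        using t(1) t_lim TD(3)[of y] by (auto simp: continuous_within_sequentially o_def)
    qed
    then have "\<exists>c. \<forall>n\<in>UNIV. norm (T (t n) y) \<le> c" for y
      using convergent_imp_Bseq[OF convergentI] by (fastforce simp: Bseq_def)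
    then obtain M where M: "\<And>n y. norm (T (t n) y) \<le> M * norm y"
      using uniform_boundedness[of UNIV "\<lambda>n. T (t n)"] TD(2)[OF t(1)] by (metis UNIV_I)
    obtain n :: nat where "M \<le> n" using real_arch_simple by blast
    then have "M * norm (x n) \<le> n * norm (x n)" by (simp add: mult_right_mono)
    with M[of n "x n"] x[of n] show False by simp
  qed
  then obtain \<delta> M where \<delta>: "0 < \<delta>"
    and M: "\<And>t x. 0 \<le> t \<Longrightarrow> t \<le> \<delta> \<Longrightarrow> norm (T t x) \<le> M * norm x" by blast
  \<comment> \<open>A constant of at least 1 has increasing powers, as the induction needs for times
    below \<delta>.\<close>
  define M' where "M' = max 1 M"
  have M': "norm (T t x) \<le> M' * norm x" if "0 \<le> t" "t \<le> \<delta>" for t x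
    using M[OF that, of x] mult_right_mono[of M M' "norm x"] by (simp add: M'_def)
  have pow: "0 \<le> t \<Longrightarrow> t \<le> n * \<delta> \<Longrightarrow> norm (T t x) \<le> M' ^ n * norm x" for n :: nat and t x
  proof (induction n arbitrary: t)
    case 0
    then show ?case by (simp add: TD(3))
  next
    case (Suc n)
    show ?case
    proof (cases "t \<le> \<delta>")
      case True
      have "M' ^ 1 \<le> M' ^ Suc n" by (intro power_increasing) (auto simp: M'_def)
      then show ?thesis
        using M'[OF Suc.prems(1) True, of x] mult_right_mono[of M' "M' ^ Suc n" "norm x"] by simp
    next
      case False
      have "T t x = T \<delta> (T (t - \<delta>) x)" using False \<delta> TD(4)[of \<delta> "t - \<delta>" x] by simp
      then have "norm (T t x) \<le> M' * norm (T (t - \<delta>) x)" using M'[of \<delta>] \<delta> by simp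
      also have "\<dots> \<le> M' * (M' ^ n * norm x)"
        using False Suc.prems by (intro mult_left_mono Suc.IH) (auto simp: M'_def algebra_simps)
      finally show ?thesis by simp
    qed
  qed
  obtain n :: nat where "b / \<delta> \<le> n" using real_arch_simple by blast
  then have "b \<le> n * \<delta>" using \<delta> by (simp add: field_simps)
  then show ?thesis
    using pow[of _ n] by (intro that[of "M' ^ n"]) (auto simp: M'_def)
qed

lemma C0_semigroup_at_0:
  assumes "C0_semigroup T"
  shows "((\<lambda>s. T \<bar>s - t\<bar> x) \<longlongrightarrow> x) (at t within S)"
proof -
  have "((\<lambda>t. T t x) \<longlongrightarrow> x) (at 0 within {0..})"
    using C0_semigroupD(5)[OF assms, of x] by (simp add: at_within_Ici_at_right)
  moreover have "filterlim (\<lambda>s. \<bar>s - t\<bar>) (at 0 within {0..}) (at t within S)"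
    unfolding filterlim_at
    by (auto intro!: tendsto_eq_intros simp: eventually_at_filter)
  ultimately show ?thesis by (rule filterlim_compose)
qed

text \<open>Extracting the smaller time leaves an increment starting at time 0, so that right
  continuity at 0 yields continuity from both sides.\<close>

lemma C0_semigroup_diff:
  assumes T: "C0_semigroup T" and s: "0 \<le> s" and t: "0 \<le> t"
  shows "T s x - T t x = (if t \<le> s then T t (T \<bar>s - t\<bar> x - x) else - T s (T \<bar>s - t\<bar> x - x))"
proof (cases "t \<le> s")
  case True
  then show ?thesis
    using C0_semigroupD(4)[OF T t, of "s - t" x] linear_simps(2)[OF C0_semigroupD(2)[OF T t]] by simp
next
  case False
  then show ?thesis
    using C0_semigroupD(4)[OF T s, of "t - s" x] linear_simps(2)[OF C0_semigroupD(2)[OF T s]]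
    by (simp add: abs_minus_commute)
qed

lemma C0_semigroup_continuous_on:
  fixes T :: "real \<Rightarrow> 'a \<Rightarrow> 'a::complex_banach"
  assumes T: "C0_semigroup T"
  shows "continuous_on {0..} (\<lambda>t. T t x)"
  unfolding continuous_on_def
proof
  fix t :: real assume "t \<in> {0..}"
  then have t: "0 \<le> t" by simp
  obtain M where M: "0 \<le> M" "\<And>s x. 0 \<le> s \<Longrightarrow> s \<le> t + 1 \<Longrightarrow> norm (T s x) \<le> M * norm x"
    using C0_semigroup_locally_bounded[OF T] by blast
  have "((\<lambda>s. norm (T s x - T t x)) \<longlongrightarrow> 0) (at t within {0..})"
  proof (rule tendsto_sandwich[OF _ _ tendsto_const])
    show "((\<lambda>s. M * norm (T \<bar>s - t\<bar> x - x)) \<longlongrightarrow> 0) (at t within {0..})"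
      by (intro tendsto_mult_right_zero tendsto_norm_zero LIM_zero C0_semigroup_at_0[OF T])
    have "\<forall>\<^sub>F s in at t within {0..}. s \<in> {0..} \<and> s < t + 1"
      by (auto simp: eventually_at dist_real_def intro!: exI[of _ 1])
    then show "\<forall>\<^sub>F s in at t within {0..}. norm (T s x - T t x) \<le> M * norm (T \<bar>s - t\<bar> x - x)"
      by eventually_elim (use t in \<open>auto simp: C0_semigroup_diff[OF T _ t] intro!: M(2)\<close>)
  qed simp
  then show "((\<lambda>t. T t x) \<longlongrightarrow> T t x) (at t within {0..})"
    by (simp add: tendsto_norm_zero_iff LIM_zero_iff)
qed

lemma generatesD:
  assumes "generates A T"
  shows "C0_semigroup T" "A x = Some y \<longleftrightarrow> ((\<lambda>h. (T h x - x) /\<^sub>R h) \<longlongrightarrow> y) (at_right 0)"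
  using assms by (auto simp: generates_def)

lemma generator_linear:
  assumes A: "generates A T" and "A x = Some x'" "A y = Some y'"
  shows "A (x + y) = Some (x' + y')" "A (x - y) = Some (x' - y')" "A (a *\<^sub>C x) = Some (a *\<^sub>C x')"
proof -
  note T = C0_semigroupD(1,2)[OF generatesD(1)[OF A]] and gen = generatesD(2)[OF A]
  have lim: "((\<lambda>h. (T h x - x) /\<^sub>R h) \<longlongrightarrow> x') (at_right 0)"
    "((\<lambda>h. (T h y - y) /\<^sub>R h) \<longlongrightarrow> y') (at_right 0)"
    using assms(2,3) gen by auto
  show "A (x + y) = Some (x' + y')"
    unfolding gen
    by (rule Lim_transform_eventually[OF tendsto_add[OF lim]])
      (auto simp: eventually_at_filter linear_simps[OF T(2)] algebra_simps)
  show "A (x - y) = Some (x' - y')"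
    unfolding gen
    by (rule Lim_transform_eventually[OF tendsto_diff[OF lim]])
      (auto simp: eventually_at_filter linear_simps[OF T(2)] algebra_simps)
  show "A (a *\<^sub>C x) = Some (a *\<^sub>C x')"
    unfolding gen
    by (rule Lim_transform_eventually[OF bounded_linear.tendsto[OF bounded_linear_scaleC lim(1)]])
      (auto simp: eventually_at_filter bounded_clinear_scaleC[OF T(1)] scaleC_right_simps)
qed

text \<open>\<open>generates\<close> provides only a right derivative at 0. From the right, the
  quotient at \<open>t\<close> is \<open>T t\<close> applied to the quotient at 0; from the left the
  outer operator is \<open>T s\<close> and varies too, which adds the error
  \<open>T s y - T t y\<close>.\<close>

lemma generator_vector_derivative:
  fixes T :: "real \<Rightarrow> 'a \<Rightarrow> 'a::complex_banach"
  assumes A: "generates A T" and x: "A x = Some y" and t: "0 \<le> t"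
  shows "((\<lambda>t. T t x) has_vector_derivative T t y) (at t within {0..})"
proof -
  note T = generatesD(1)[OF A]
  obtain M where M: "0 \<le> M" "\<And>s x. 0 \<le> s \<Longrightarrow> s \<le> t + 1 \<Longrightarrow> norm (T s x) \<le> M * norm x"
    using C0_semigroup_locally_bounded[OF T] by blast
  let ?d = "\<lambda>h. (T h x - x) /\<^sub>R h - y"
  have "((\<lambda>h. norm (?d h)) \<longlongrightarrow> 0) (at_right 0)"
    using x unfolding generatesD(2)[OF A] by (auto simp: tendsto_norm_zero_iff LIM_zero)
  moreover have "filterlim (\<lambda>s. \<bar>s - t\<bar>) (at_right 0) (at t within {0..})"
    unfolding filterlim_at
    by (auto intro!: tendsto_eq_intros simp: eventually_at_filter)
  ultimately have lim1: "((\<lambda>s. norm (?d \<bar>s - t\<bar>)) \<longlongrightarrow> 0) (at t within {0..})"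
    by (rule filterlim_compose)
  have lim2: "((\<lambda>s. norm (T s y - T t y)) \<longlongrightarrow> 0) (at t within {0..})"
    using C0_semigroup_continuous_on[OF T, of y] t
    by (auto simp: continuous_on_def tendsto_norm_zero_iff LIM_zero)
  have "((\<lambda>s. norm ((T s x - (T t x + (s - t) *\<^sub>R T t y)) /\<^sub>R norm (s - t))) \<longlongrightarrow> 0)
      (at t within {0..})"
  proof (rule tendsto_sandwich[OF _ _ tendsto_const])
    show "((\<lambda>s. M * norm (?d \<bar>s - t\<bar>) + norm (T s y - T t y)) \<longlongrightarrow> 0) (at t within {0..})"
      using tendsto_add[OF tendsto_mult_right_zero[OF lim1] lim2] by simp
    have "\<forall>\<^sub>F s in at t within {0..}. s \<in> {0..} \<and> s < t + 1 \<and> s \<noteq> t"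
      by (auto simp: eventually_at dist_real_def intro!: exI[of _ 1])
    then show "\<forall>\<^sub>F s in at t within {0..}. norm ((T s x - (T t x + (s - t) *\<^sub>R T t y)) /\<^sub>R norm (s - t))
        \<le> M * norm (?d \<bar>s - t\<bar>) + norm (T s y - T t y)"
    proof eventually_elim
      case (elim s)
      then have s: "0 \<le> s" "s \<le> t + 1" "s \<noteq> t" by auto
      note lin = linear_simps[OF C0_semigroupD(2)[OF T t]] linear_simps[OF C0_semigroupD(2)[OF T s(1)]]
      show ?case
      proof (cases "t \<le> s")
        case True
        have "(T s x - (T t x + (s - t) *\<^sub>R T t y)) /\<^sub>R norm (s - t)
            = (T s x - T t x) /\<^sub>R \<bar>s - t\<bar> - T t y"
          using True s by (simp add: diff_diff_add[symmetric] scaleR_diff_right del: scaleR_left_diff_distrib)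
        also have "\<dots> = T t (?d \<bar>s - t\<bar>)"
          using True C0_semigroup_diff[OF T s(1) t, of x] by (simp add: lin)
        finally have "(T s x - (T t x + (s - t) *\<^sub>R T t y)) /\<^sub>R norm (s - t) = T t (?d \<bar>s - t\<bar>)" .
        then show ?thesis using M(2)[OF t, of "?d \<bar>s - t\<bar>"] by (simp add: add_increasing2)
      next
        case False
        have "(s - t) *\<^sub>R T t y = - ((t - s) *\<^sub>R T t y)" by (simp add: algebra_simps)
        then have "(T s x - (T t x + (s - t) *\<^sub>R T t y)) /\<^sub>R norm (s - t)
            = (T s x - T t x) /\<^sub>R \<bar>s - t\<bar> + T t y"
          using False s
          by (simp add: diff_diff_add[symmetric] scaleR_add_right scaleR_diff_right)
        also have "\<dots> = - T s (?d \<bar>s - t\<bar>) - (T s y - T t y)"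
          using False C0_semigroup_diff[OF T s(1) t, of x]
          by (simp add: lin flip: scaleR_minus_right)
        finally have "(T s x - (T t x + (s - t) *\<^sub>R T t y)) /\<^sub>R norm (s - t)
            = - T s (?d \<bar>s - t\<bar>) - (T s y - T t y)" .
        then show ?thesis
          using M(2)[OF s(1,2), of "?d \<bar>s - t\<bar>"] norm_triangle_ineq4[of "- T s (?d \<bar>s - t\<bar>)" "T s y - T t y"]
          by simp
      qed
    qed
  qed simp
  then show ?thesis
    unfolding has_vector_derivative_def has_derivative_within tendsto_norm_zero_iff
    by (auto simp: bounded_linear_scaleR_left inverse_eq_divide)
qed

lemma has_vector_derivative_exp_scaleC:
  assumes "(f has_vector_derivative f') (at s within S)"
  shows "((\<lambda>s. exp (\<mu> * of_real s) *\<^sub>C f s) has_vector_derivative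
    exp (\<mu> * of_real s) *\<^sub>C (\<mu> *\<^sub>C f s + f')) (at s within S)"
proof -
  have "((\<lambda>s. exp (\<mu> * of_real s)) has_vector_derivative (\<mu> * exp (\<mu> * of_real s))) (at s within S)"
    by (rule has_vector_derivative_real_field[where f = "\<lambda>z. exp (\<mu> * z)"])
      (auto intro!: derivative_eq_intros)
  from bounded_bilinear.has_vector_derivative[OF bounded_bilinear_scaleC this assms]
  show ?thesis by (simp add: scaleC_add_right scaleC_scaleC mult.commute add.commute)
qed

text \<open>Discounted by the exponential, the orbit has derivative zero. This serves both the
  exosystem and the uniqueness of resolvents.\<close>

lemma semigroup_eigenvector:
  fixes T :: "real \<Rightarrow> 'a \<Rightarrow> 'a::complex_banach"
  assumes A: "generates A T" and x: "A x = Some (\<mu> *\<^sub>C x)" and t: "0 \<le> t"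
  shows "T t x = exp (\<mu> * of_real t) *\<^sub>C x"
proof -
  note T = generatesD(1)[OF A]
  have "((\<lambda>s. exp (- \<mu> * of_real s) *\<^sub>C T s x) has_vector_derivative 0) (at s within {0..})"
    if "s \<in> {0..}" for s
    using has_vector_derivative_exp_scaleC[OF generator_vector_derivative[OF A x, of s], of "- \<mu>"] that
    by (simp add: bounded_clinear_scaleC[OF C0_semigroupD(1)[OF T]] scaleC_minus_left
        scaleC_right_simps)
  then obtain c where c: "\<And>s. s \<in> {0..} \<Longrightarrow> exp (- \<mu> * of_real s) *\<^sub>C T s x = c"
    using has_vector_derivative_zero_constant[OF convex_real_interval(1)] by blast
  have "c = x" using c[of 0] by (simp add: C0_semigroupD(3)[OF T] scaleC_one)
  then have "exp (\<mu> * of_real t) *\<^sub>C x = exp (\<mu> * of_real t) *\<^sub>C exp (- \<mu> * of_real t) *\<^sub>C T t x"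
    using c[of t] t by simp
  also have "\<dots> = T t x" by (simp add: scaleC_scaleC scaleC_one exp_minus_inverse)
  finally show ?thesis by simp
qed

text \<open>Each orbit is locally bounded, and beyond some time it is below 1 by stability; uniform
  boundedness over all times then gives a common constant.\<close>

lemma strongly_stable_imp_bounded:
  fixes T :: "real \<Rightarrow> 'a \<Rightarrow> 'a::complex_banach"
  assumes T: "C0_semigroup T" and stable: "strongly_stable T"
  obtains M where "0 \<le> M" "\<And>t x. 0 \<le> t \<Longrightarrow> norm (T t x) \<le> M * norm x"
proof -
  have "\<exists>c. \<forall>t\<in>{0..}. norm (T t x) \<le> c" for x
  proof -
    have "((\<lambda>t. T t x) \<longlongrightarrow> 0) at_top" using stable by (simp add: strongly_stable_def)
    then have "\<forall>\<^sub>F t in at_top. norm (T t x) < 1"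
      using order_tendstoD(2)[OF tendsto_norm] by fastforce
    then obtain b where b: "\<And>t. b \<le> t \<Longrightarrow> norm (T t x) < 1" by (auto simp: eventually_at_top_linorder)
    obtain M where "\<And>t. 0 \<le> t \<Longrightarrow> t \<le> b \<Longrightarrow> norm (T t x) \<le> M * norm x"
      using C0_semigroup_locally_bounded[OF T] by metis
    then have "\<forall>t\<in>{0..}. norm (T t x) \<le> max 1 (M * norm x)"
      using b by (metis atLeast_iff le_cases less_imp_le max.coboundedI1 max.coboundedI2)
    then show ?thesis by blast
  qed
  then show ?thesis
    using uniform_boundedness[of "{0..}" T] C0_semigroupD(2)[OF T] that by auto
qed


section \<open>Laplace transform and resolvent of a bounded semigroup\<close>

lemma nn_integral_exp_atLeast:
  assumes "0 < l"
  shows "(\<integral>\<^sup>+s. ennreal (exp (- (l * s))) * indicator {a..} s \<partial>lborel) = ennreal (exp (- (l * a)) / l)"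
proof -
  let ?F = "\<lambda>s. - exp (- (l * s)) / l"
  have "(?F \<longlongrightarrow> 0) at_top"
    using assms by real_asymp
  moreover have "(?F has_real_derivative exp (- (l * s))) (at s)" for s
    using assms by (auto intro!: derivative_eq_intros)
  ultimately show ?thesis
    using nn_integral_FTC_atLeast[of "\<lambda>s. exp (- (l * s))" a ?F 0] assms by simp
qed

text \<open>The affine factor has two uses: a bound that is small near 0 and grows linearly, and
  averages of size \<open>c * h\<close>.\<close>

lemma nn_integral_linear_exp_atLeast:
  assumes l: "0 < l" and "0 \<le> e" "0 \<le> (k::real)"
  shows "(\<integral>\<^sup>+s. ennreal (exp (- (l * s)) * (e + k * s)) * indicator {0..} s \<partial>lborel) = ennreal (e / l + k / l\<^sup>2)"
proof -
  let ?F = "\<lambda>s. - exp (- (l * s)) * ((e + k * s) / l + k / l\<^sup>2)"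
  have "(?F \<longlongrightarrow> 0) at_top"
    using l by real_asymp
  moreover have "(?F has_real_derivative exp (- (l * s)) * (e + k * s)) (at s)" for s
    using l by (auto intro!: derivative_eq_intros simp: field_simps power2_eq_square)
  ultimately show ?thesis
    using nn_integral_FTC_atLeast[of "\<lambda>s. exp (- (l * s)) * (e + k * s)" 0 ?F 0] assms by simp
qed

lemma continuous_on_exp_scaleR:
  fixes f :: "real \<Rightarrow> 'a::real_normed_vector"
  assumes "continuous_on S f"
  shows "continuous_on S (\<lambda>s. exp (- (l * s)) *\<^sub>R f s)"
  by (intro continuous_intros assms)

lemma norm_integral_exp_le:
  fixes f :: "real \<Rightarrow> 'a::banach"
  assumes "continuous_on {a..b} f"
  shows "ennreal (norm (integral {a..b} (\<lambda>s. exp (- (l * s)) *\<^sub>R f s)))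
    \<le> (\<integral>\<^sup>+s. ennreal (exp (- (l * s)) * norm (f s)) * indicator {a..b} s \<partial>lborel)"
proof -
  let ?g = "\<lambda>s. exp (- (l * s)) * norm (f s)"
  have g: "?g integrable_on {a..b}"
    by (intro integrable_continuous_interval continuous_intros assms)
  have "norm (integral {a..b} (\<lambda>s. exp (- (l * s)) *\<^sub>R f s)) \<le> integral {a..b} ?g"
    by (intro integral_norm_bound_integral integrable_continuous_interval continuous_on_exp_scaleR
        assms g) simp
  moreover have "(\<integral>\<^sup>+s. ennreal (?g s) * indicator {a..b} s \<partial>lborel) = ennreal (integral {a..b} ?g)"
    by (rule nn_integral_has_integral_lebesgue') (auto intro: integrable_integral g)
  ultimately show ?thesis by (simp add: ennreal_leI)
qed

text \<open>The Laplace transform is taken as the limit of these integrals for \<open>b\<close>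
  tending to infinity; on each compact interval a continuous integrand with values in any Banach
  space is gauge integrable.\<close>

abbreviation truncated_laplace :: "real \<Rightarrow> (real \<Rightarrow> 'a::banach) \<Rightarrow> real \<Rightarrow> 'a" where
  "truncated_laplace l f b \<equiv> integral {0..b} (\<lambda>s. exp (- (l * s)) *\<^sub>R f s)"

lemma truncated_laplace_combine:
  fixes f :: "real \<Rightarrow> 'a::banach"
  assumes "continuous_on {0..} f" "0 \<le> a" "a \<le> b"
  shows "truncated_laplace l f b = truncated_laplace l f a + integral {a..b} (\<lambda>s. exp (- (l * s)) *\<^sub>R f s)"
proof (rule Henstock_Kurzweil_Integration.integral_combine[symmetric])
  show "(\<lambda>s. exp (- (l * s)) *\<^sub>R f s) integrable_on {0..b}"
    by (intro integrable_continuous_interval continuous_on_exp_scaleR continuous_on_subset[OF assms(1)]) auto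
qed (use assms in auto)

text \<open>The contribution beyond \<open>a\<close> is at most
  \<open>c * exp (- (l * a)) / l\<close>. This makes the integrals up to natural numbers Cauchy, and
  passing to the limit in the same estimate gives convergence along all reals.\<close>

lemma truncated_laplace_converges:
  fixes f :: "real \<Rightarrow> 'a::banach"
  assumes f: "continuous_on {0..} f" and bound: "\<And>s. 0 \<le> s \<Longrightarrow> norm (f s) \<le> c" and l: "0 < l"
  obtains y where "(truncated_laplace l f \<longlongrightarrow> y) at_top"
proof -
  have c: "0 \<le> c" using bound[of 0] norm_ge_zero order_trans by blast
  have diff: "norm (truncated_laplace l f b - truncated_laplace l f a) \<le> c * exp (- (l * a)) / l"
    if ab: "0 \<le> a" "a \<le> b" for a b
  proof -
    have "ennreal (norm (truncated_laplace l f b - truncated_laplace l f a))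
        \<le> (\<integral>\<^sup>+s. ennreal (exp (- (l * s)) * norm (f s)) * indicator {a..b} s \<partial>lborel)"
      unfolding truncated_laplace_combine[OF f ab] add_diff_cancel_left'
      by (intro norm_integral_exp_le continuous_on_subset[OF f]) (use ab in auto)
    also have "\<dots> \<le> (\<integral>\<^sup>+s. ennreal c * (ennreal (exp (- (l * s))) * indicator {a..} s) \<partial>lborel)"
      using bound ab c by (intro nn_integral_mono)
        (auto simp: indicator_def mult.commute mult_left_mono simp flip: ennreal_mult intro!: ennreal_leI)
    also have "\<dots> = ennreal (c * exp (- (l * a)) / l)"
      using c l by (simp add: nn_integral_cmult nn_integral_exp_atLeast flip: ennreal_mult)
    finally show ?thesis using c l by (simp add: ennreal_le_iff)
  qed
  have lim0: "(\<lambda>n::nat. c * exp (- (l * n)) / l) \<longlonglongrightarrow> 0" "((\<lambda>t. c * exp (- (l * t)) / l) \<longlongrightarrow> 0) at_top"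
    using l by real_asymp+
  have "Cauchy (\<lambda>n::nat. truncated_laplace l f n)"
  proof (rule metric_CauchyI)
    fix e :: real assume "0 < e"
    then have "\<forall>\<^sub>F n::nat in sequentially. c * exp (- (l * n)) / l < e / 2"
      using lim0(1) by (intro order_tendstoD(2)[where y = 0]) auto
    then obtain N :: nat where N: "c * exp (- (l * N)) / l < e / 2"
      by (auto simp: eventually_sequentially)
    have "dist (truncated_laplace l f n) (truncated_laplace l f N) < e / 2" if "N \<le> n" for n :: nat
      unfolding dist_norm by (rule le_less_trans[OF diff N]) (use that in auto)
    then show "\<exists>N. \<forall>m\<ge>N. \<forall>n\<ge>N. dist (truncated_laplace l f (real m)) (truncated_laplace l f (real n)) < e"
      using dist_triangle_half_l by blast
  qed
  then obtain y where y: "(\<lambda>n::nat. truncated_laplace l f n) \<longlonglongrightarrow> y"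
    by (auto simp: Cauchy_convergent_iff convergent_def)
  have "norm (y - truncated_laplace l f t) \<le> c * exp (- (l * t)) / l" if "0 \<le> t" for t
  proof (rule LIMSEQ_le_const2)
    show "(\<lambda>n::nat. norm (truncated_laplace l f n - truncated_laplace l f t)) \<longlonglongrightarrow> norm (y - truncated_laplace l f t)"
      by (intro tendsto_intros y)
    obtain N :: nat where "t \<le> N" using real_arch_simple by blast
    then show "\<exists>N. \<forall>n\<ge>N. norm (truncated_laplace l f (real n) - truncated_laplace l f t) \<le> c * exp (- (l * t)) / l"
      using that diff by (intro exI[of _ N] allI impI) (auto intro!: diff)
  qed
  then have "((\<lambda>t. y - truncated_laplace l f t) \<longlongrightarrow> 0) at_top"
    by (intro Lim_null_comparison[OF _ lim0(2)] eventually_mono[OF eventually_ge_at_top[of 0]])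
  then have "((\<lambda>t. y - (y - truncated_laplace l f t)) \<longlongrightarrow> y - 0) at_top"
    by (intro tendsto_diff tendsto_const)
  then show ?thesis using that by simp
qed

lemma laplace_norm_le:
  fixes f :: "real \<Rightarrow> 'a::banach"
  assumes lim: "(truncated_laplace l f \<longlongrightarrow> y) at_top" and f: "continuous_on {0..} f"
  shows "ennreal (norm y) \<le> (\<integral>\<^sup>+s. ennreal (exp (- (l * s)) * norm (f s)) * indicator {0..} s \<partial>lborel)"
proof (rule tendsto_upperbound)
  show "((\<lambda>b. ennreal (norm (truncated_laplace l f b))) \<longlongrightarrow> ennreal (norm y)) at_top"
    by (intro tendsto_ennrealI tendsto_norm lim)
  have "ennreal (norm (truncated_laplace l f b))
      \<le> (\<integral>\<^sup>+s. ennreal (exp (- (l * s)) * norm (f s)) * indicator {0..} s \<partial>lborel)" for b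
    by (rule order_trans[OF norm_integral_exp_le[OF continuous_on_subset[OF f]]])
      (auto intro!: nn_integral_mono simp: indicator_def)
  then show "\<forall>\<^sub>F b in at_top. ennreal (norm (truncated_laplace l f b))
      \<le> (\<integral>\<^sup>+s. ennreal (exp (- (l * s)) * norm (f s)) * indicator {0..} s \<partial>lborel)" by simp
qed simp

lemma truncated_laplace_bounded_linear:
  fixes f :: "real \<Rightarrow> 'a::banach" and c :: "'a \<Rightarrow> 'b::banach"
  assumes lim: "(truncated_laplace l f \<longlongrightarrow> y) at_top" and f: "continuous_on {0..} f"
    and c: "bounded_linear c"
  shows "(truncated_laplace l (\<lambda>s. c (f s)) \<longlongrightarrow> c y) at_top"
proof -
  have "truncated_laplace l (\<lambda>s. c (f s)) b = c (truncated_laplace l f b)" for b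
  proof -
    have "(\<lambda>s. exp (- (l * s)) *\<^sub>R f s) integrable_on {0..b}"
      by (intro integrable_continuous_interval continuous_on_exp_scaleR continuous_on_subset[OF f]) auto
    from integral_linear[OF this c] show ?thesis by (simp add: o_def linear_simps[OF c])
  qed
  then show ?thesis using bounded_linear.tendsto[OF c lim] by simp
qed

section \<open>Resolvents of bounded semigroups\<close>

lemma resolvent_set_resolvent:
  assumes "\<mu> \<in> resolvent_set A"
  shows "bounded_clinear (resolvent A \<mu>)" "A (resolvent A \<mu> y) = Some (\<mu> *\<^sub>C resolvent A \<mu> y - y)"
    "A x = Some (\<mu> *\<^sub>C x - y) \<Longrightarrow> resolvent A \<mu> y = x"
proof -
  have ex1: "\<exists>!x. x \<in> dom A \<and> \<mu> *\<^sub>C x - the (A x) = y" for y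
    using assms by (simp add: resolvent_set_def)
  show "bounded_clinear (resolvent A \<mu>)" using assms by (simp add: resolvent_set_def)
  show "A (resolvent A \<mu> y) = Some (\<mu> *\<^sub>C resolvent A \<mu> y - y)"
  proof -
    have "resolvent A \<mu> y \<in> dom A \<and> \<mu> *\<^sub>C resolvent A \<mu> y - the (A (resolvent A \<mu> y)) = y"
      unfolding resolvent_def by (rule theI'[OF ex1])
    then obtain z where z: "A (resolvent A \<mu> y) = Some z" "\<mu> *\<^sub>C resolvent A \<mu> y - z = y" by auto
    have "z = \<mu> *\<^sub>C resolvent A \<mu> y - (\<mu> *\<^sub>C resolvent A \<mu> y - z)" by simp
    then show ?thesis using z(1) unfolding z(2) by simp
  qed
  show "A x = Some (\<mu> *\<^sub>C x - y) \<Longrightarrow> resolvent A \<mu> y = x"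
    unfolding resolvent_def by (rule the1_equality[OF ex1]) auto
qed

text \<open>One bound for all times puts every \<open>l > 0\<close> within reach of the Laplace
  transform. For the closed loop it comes from strong stability.\<close>

locale bounded_semigroup =
  fixes A :: "'a::complex_banach \<rightharpoonup> 'a" and T :: "real \<Rightarrow> 'a \<Rightarrow> 'a" and M :: real
  assumes generates: "generates A T"
    and bound: "0 \<le> t \<Longrightarrow> norm (T t x) \<le> M * norm x"
    and M_nonneg: "0 \<le> M"
begin

lemmas C0 = generatesD(1)[OF generates]
lemmas T_clinear = C0_semigroupD(1)[OF C0] and T_linear = C0_semigroupD(2)[OF C0]
  and T_0 = C0_semigroupD(3)[OF C0] and T_add = C0_semigroupD(4)[OF C0]
  and T_at_0 = C0_semigroupD(5)[OF C0]
lemmas T_simps = linear_simps[OF T_linear]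
lemmas T_continuous = C0_semigroup_continuous_on[OF C0]

text \<open>The difference of two solutions is an eigenvector with eigenvalue \<open>l > 0\<close>;
  unless it is zero its orbit grows like \<open>exp (l * t)\<close> and breaks the bound.\<close>

lemma resolvent_unique:
  assumes l: "0 < l" and x: "A x = Some (complex_of_real l *\<^sub>C x - y)"
    and z: "A z = Some (complex_of_real l *\<^sub>C z - y)"
  shows "x = z"
proof -
  have "A (x - z) = Some (complex_of_real l *\<^sub>C (x - z))"
    using generator_linear(2)[OF generates x z] by (simp add: scaleC_right_simps)
  then have eq: "T t (x - z) = exp (complex_of_real l * of_real t) *\<^sub>C (x - z)" if "0 \<le> t" for t
    using semigroup_eigenvector[OF generates] that by blast
  have "exp (l * t) * norm (x - z) \<le> M * norm (x - z)" if "0 \<le> t" for t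
    using bound[OF that, of "x - z"] eq[OF that]
    by (simp add: norm_scaleC flip: exp_of_real of_real_mult)
  then have "norm (x - z) = 0"
  proof (rule_tac ccontr)
    assume *: "norm (x - z) \<noteq> 0"
    have "filterlim (\<lambda>t. exp (l * t)) at_top at_top" using l by real_asymp
    then have "\<forall>\<^sub>F t in at_top. M < exp (l * t) \<and> 0 \<le> t"
      by (intro eventually_conj eventually_ge_at_top) (simp add: filterlim_at_top_dense)
    then obtain t where t: "M < exp (l * t)" "0 \<le> t" by (auto simp: eventually_at_top_linorder)
    with * \<open>\<And>t. 0 \<le> t \<Longrightarrow> exp (l * t) * norm (x - z) \<le> M * norm (x - z)\<close>[OF t(2)]
    show False by simp
  qed
  then show ?thesis by simp
qed

text \<open>By the formula for \<open>T h y\<close> the difference quotient of \<open>y\<close>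
  equals \<open>((exp (l * h) - 1) / h) *\<^sub>R y\<close> minus \<open>exp (l * h)\<close> times
  the mean of the weighted orbit over [0, h]; these tend to \<open>l *\<^sub>R y\<close> and
  \<open>x\<close>.\<close>

lemma laplace_in_domain:
  assumes l: "0 < l" and lim: "(truncated_laplace l (\<lambda>s. T s x) \<longlongrightarrow> y) at_top"
  shows "A y = Some (l *\<^sub>R y - x)"
proof -
  let ?I = "truncated_laplace l (\<lambda>s. T s x)"
  \<comment> \<open>Shifting time by \<open>h\<close> reproduces the transform without its initial
    piece; the factor \<open>exp (l * h)\<close> corrects the weight.\<close>
  have T_y: "T h y = exp (l * h) *\<^sub>R (y - ?I h)" if h: "0 \<le> h" for h
  proof (rule tendsto_unique)
    show "((\<lambda>b. T h (?I b)) \<longlongrightarrow> T h y) at_top"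
      by (rule bounded_linear.tendsto[OF T_linear[OF h] lim])
    have eq: "T h (?I b) = exp (l * h) *\<^sub>R (?I (b + h) - ?I h)" if b: "0 \<le> b" for b
    proof -
      have "(\<lambda>s. exp (- (l * s)) *\<^sub>R T s x) integrable_on {0..b}"
        by (intro integrable_continuous_interval continuous_on_exp_scaleR
            continuous_on_subset[OF T_continuous]) auto
      from integral_linear[OF this T_linear[OF h]]
      have "T h (?I b) = integral {0..b} (\<lambda>s. exp (- (l * s)) *\<^sub>R T h (T s x))"
        by (simp add: o_def T_simps h)
      also have "\<dots> = integral {h - h..(b + h) - h} (\<lambda>s. (\<lambda>r. exp (l * h) *\<^sub>R exp (- (l * r)) *\<^sub>R T r x) (s + h))"
      proof -
        have "exp (- (l * s)) *\<^sub>R T h (T s x) = exp (l * h) *\<^sub>R exp (- (l * (s + h))) *\<^sub>R T (s + h) x"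
          if "s \<in> {0..b}" for s
        proof -
          have "exp (l * h) * exp (- (l * (s + h))) = exp (- (l * s))"
            by (simp add: algebra_simps flip: exp_add)
          then show ?thesis using that h T_add[of h s x] by (simp add: add.commute)
        qed
        then show ?thesis by (auto intro: integral_cong)
      qed
      also have "\<dots> = integral {h..b + h} (\<lambda>r. exp (l * h) *\<^sub>R exp (- (l * r)) *\<^sub>R T r x)"
        by (rule integral_shift_real_ivl)
      also have "\<dots> = exp (l * h) *\<^sub>R integral {h..b + h} (\<lambda>r. exp (- (l * r)) *\<^sub>R T r x)"
        by (rule integral_cmul)
      also have "integral {h..b + h} (\<lambda>r. exp (- (l * r)) *\<^sub>R T r x) = ?I (b + h) - ?I h"
        using truncated_laplace_combine[OF T_continuous h, of "b + h" l x] b by simp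
      finally show ?thesis .
    qed
    have "filterlim (\<lambda>b. b + h) at_top at_top" by real_asymp
    then have "((\<lambda>b. exp (l * h) *\<^sub>R (?I (b + h) - ?I h)) \<longlongrightarrow> exp (l * h) *\<^sub>R (y - ?I h)) at_top"
      by (intro tendsto_intros filterlim_compose[OF lim])
    then show "((\<lambda>b. T h (?I b)) \<longlongrightarrow> exp (l * h) *\<^sub>R (y - ?I h)) at_top"
      by (rule Lim_transform_eventually)
        (use eventually_ge_at_top[of 0] in eventually_elim, simp add: eq)
  qed simp
  have "((\<lambda>u. ?I u) has_vector_derivative exp (- (l * 0)) *\<^sub>R T 0 x) (at 0 within {0..1})"
    by (rule integral_has_vector_derivative)
      (auto intro!: continuous_on_exp_scaleR continuous_on_subset[OF T_continuous])
  then have "((\<lambda>h. (?I h - ?I 0 - (h - 0) *\<^sub>R x) /\<^sub>R norm (h - 0)) \<longlongrightarrow> 0) (at 0 within {0..1})"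
    by (simp add: has_vector_derivative_def has_derivative_within T_0 inverse_eq_divide diff_diff_add)
  then have I0: "((\<lambda>h. (?I h - h *\<^sub>R x) /\<^sub>R \<bar>h\<bar>) \<longlongrightarrow> 0) (at_right 0)"
    by (simp add: at_within_Icc_at_right)
  have I1: "((\<lambda>h. ?I h /\<^sub>R h) \<longlongrightarrow> x) (at_right 0)"
    by (rule Lim_transform_eventually[OF tendsto_add[OF I0 tendsto_const[of x], simplified]])
      (auto simp: eventually_at_filter scaleR_diff_right)
  have "((\<lambda>h. ((exp (l * h) - 1) / h) *\<^sub>R y - exp (l * h) *\<^sub>R (?I h /\<^sub>R h)) \<longlongrightarrow> l *\<^sub>R y - 1 *\<^sub>R x) (at_right 0)"
  proof (intro tendsto_intros I1)
    show "((\<lambda>h. (exp (l * h) - 1) / h) \<longlongrightarrow> l) (at_right 0)" using l by real_asymp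
    show "((\<lambda>h. exp (l * h)) \<longlongrightarrow> 1) (at_right 0)" by real_asymp
  qed
  then have "((\<lambda>h. (T h y - y) /\<^sub>R h) \<longlongrightarrow> l *\<^sub>R y - x) (at_right 0)"
    unfolding scaleR_one
    by (rule Lim_transform_eventually)
      (auto simp: eventually_at_filter T_y algebra_simps divide_inverse)
  then show ?thesis unfolding generatesD(2)[OF generates] .
qed

lemma laplace_resolvent:
  assumes l: "0 < l"
  shows "(truncated_laplace l (\<lambda>s. T s x) \<longlongrightarrow> resolvent A (of_real l) x) at_top"
    and "A (resolvent A (of_real l) x) = Some (l *\<^sub>R resolvent A (of_real l) x - x)"
    and "A z = Some (l *\<^sub>R z - x) \<Longrightarrow> resolvent A (of_real l) x = z"
proof -
  obtain y where lim: "(truncated_laplace l (\<lambda>s. T s x) \<longlongrightarrow> y) at_top"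
    by (rule truncated_laplace_converges[OF T_continuous bound l])
  have y: "A y = Some (l *\<^sub>R y - x)" by (rule laplace_in_domain[OF l lim])
  have res: "resolvent A (of_real l) x = z" if "A z = Some (l *\<^sub>R z - x)" for z
    unfolding resolvent_def
  proof (rule the_equality)
    show "z \<in> dom A \<and> complex_of_real l *\<^sub>C z - the (A z) = x"
      using that by (auto simp: scaleC_of_real)
    show "w = z" if "w \<in> dom A \<and> complex_of_real l *\<^sub>C w - the (A w) = x" for w
      using that \<open>A z = _\<close> by (intro resolvent_unique[OF l, of _ x]) (auto simp: scaleC_of_real)
  qed
  from res[OF y] lim y
  show "(truncated_laplace l (\<lambda>s. T s x) \<longlongrightarrow> resolvent A (of_real l) x) at_top"
    "A (resolvent A (of_real l) x) = Some (l *\<^sub>R resolvent A (of_real l) x - x)" by simp_all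
  show "A z = Some (l *\<^sub>R z - x) \<Longrightarrow> resolvent A (of_real l) x = z" by (rule res)
qed

text \<open>The operator \<open>c\<close> is left general because it will be the bounded operator
  that replaces the observation on the domain.\<close>

lemma norm_resolvent_le:
  fixes c :: "'a \<Rightarrow> 'b::banach"
  assumes "0 < l" "bounded_linear c"
  shows "ennreal (norm (c (resolvent A (of_real l) x)))
    \<le> (\<integral>\<^sup>+s. ennreal (exp (- (l * s)) * norm (c (T s x))) * indicator {0..} s \<partial>lborel)"
  by (rule laplace_norm_le[OF truncated_laplace_bounded_linear[OF laplace_resolvent(1)[OF assms(1)]
          T_continuous assms(2)] bounded_linear.continuous_on[OF assms(2) T_continuous]])

lemma resolvent_bound:
  assumes l: "0 < l"
  shows "l * norm (resolvent A (of_real l) x) \<le> M * norm x"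
proof -
  have "ennreal (norm (resolvent A (of_real l) x))
      \<le> (\<integral>\<^sup>+s. ennreal (exp (- (l * s)) * norm (T s x)) * indicator {0..} s \<partial>lborel)"
    using norm_resolvent_le[OF l bounded_linear_ident] .
  also have "\<dots> \<le> (\<integral>\<^sup>+s. ennreal (M * norm x) * (ennreal (exp (- (l * s))) * indicator {0..} s) \<partial>lborel)"
    using bound M_nonneg by (intro nn_integral_mono)
      (auto simp: indicator_def mult.commute[of "exp _"] mult_right_mono simp flip: ennreal_mult intro!: ennreal_leI)
  also have "\<dots> = ennreal (M * norm x / l)"
    using M_nonneg l by (simp add: nn_integral_cmult nn_integral_exp_atLeast flip: ennreal_mult)
  finally show ?thesis using M_nonneg l by (simp add: ennreal_le_iff field_simps)
qed

lemma bounded_clinear_resolvent: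
  assumes l: "0 < l"
  shows "bounded_clinear (resolvent A (of_real l))"
proof -
  note A = laplace_resolvent(2)[OF l] and unique = laplace_resolvent(3)[OF l]
  have "resolvent A (of_real l) (x + y) = resolvent A (of_real l) x + resolvent A (of_real l) y" for x y
    by (rule unique) (simp add: generator_linear(1)[OF generates A A] scaleR_add_right)
  moreover have C: "resolvent A (of_real l) (a *\<^sub>C x) = a *\<^sub>C resolvent A (of_real l) x" for a x
    by (rule unique) (simp add: generator_linear(3)[OF generates A A] scaleC_right_simps)
  moreover have "resolvent A (of_real l) (r *\<^sub>R x) = r *\<^sub>R resolvent A (of_real l) x" for r x
    using C[of "of_real r" x] by (simp add: scaleC_of_real)
  moreover have "norm (resolvent A (of_real l) x) \<le> norm x * (M / l)" for x
    using resolvent_bound[OF l, of x] l by (simp add: field_simps)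
  ultimately show ?thesis
    unfolding bounded_clinear_def by (auto intro: bounded_linear_intro[where K = "M / l"])
qed

text \<open>Since \<open>l * exp (- (l * s))\<close> has integral 1 on the half-line, the error is
  the average of \<open>T s x - x\<close> under a weight that concentrates at 0.\<close>

lemma resolvent_tendsto: "((\<lambda>l. l *\<^sub>R resolvent A (of_real l) x) \<longlongrightarrow> x) at_top"
proof (rule tendstoI)
  fix e :: real assume e: "0 < e"
  have "\<forall>\<^sub>F s in at_right 0. dist (T s x) x < e / 2"
    using T_at_0[of x] e by (intro tendstoD) auto
  then obtain d where d: "0 < d" "\<And>s. 0 < s \<Longrightarrow> s < d \<Longrightarrow> norm (T s x - x) < e / 2"
    by (auto simp: eventually_at_right_field dist_norm)
  \<comment> \<open>The slope is chosen so that \<open>k * d\<close> is the global bound of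
    \<open>norm (T s x - x)\<close>. Then \<open>e / 2 + k * s\<close> dominates for all times:
    continuity covers \<open>s < d\<close>, boundedness the rest.\<close>
  define k where "k = (M + 1) * norm x / d"
  have k: "0 \<le> k" using M_nonneg d(1) by (simp add: k_def)
  have le: "norm (T s x - x) \<le> e / 2 + k * s" if s: "0 \<le> s" for s
  proof (cases "s < d")
    case True
    then have "norm (T s x - x) \<le> e / 2"
      using d(2)[of s] s e by (cases "s = 0") (auto simp: T_0)
    then show ?thesis using k s by (simp add: add_increasing2)
  next
    case False
    have "norm (T s x - x) \<le> (M + 1) * norm x"
      using norm_triangle_ineq4[of "T s x" x] bound[OF s, of x] by (simp add: algebra_simps)
    also have "\<dots> = k * d" using d(1) by (simp add: k_def)
    also have "\<dots> \<le> k * s" using False k by (intro mult_left_mono) auto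
    finally show ?thesis using e by simp
  qed
  have main: "norm (l *\<^sub>R resolvent A (of_real l) x - x) \<le> e / 2 + k / l" if l: "0 < l" for l
  proof -
    have const: "(truncated_laplace l (\<lambda>_. x) \<longlongrightarrow> x /\<^sub>R l) at_top"
    proof -
      have "((\<lambda>b. ((1 - exp (- (l * b))) / l) *\<^sub>R x) \<longlongrightarrow> (1 / l) *\<^sub>R x) at_top"
      proof (rule tendsto_scaleR[OF _ tendsto_const])
        have "((\<lambda>b. exp (- (l * b))) \<longlongrightarrow> 0) at_top" using l by real_asymp
        from tendsto_divide[OF tendsto_diff[OF tendsto_const this] tendsto_const, of l 1] l
        show "((\<lambda>b. (1 - exp (- (l * b))) / l) \<longlongrightarrow> 1 / l) at_top" by simp
      qed
      moreover have "truncated_laplace l (\<lambda>_. x) b = ((1 - exp (- (l * b))) / l) *\<^sub>R x" if "0 \<le> b" for b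
      proof -
        have "((\<lambda>s. exp (- (l * s))) has_integral (- exp (- (l * b)) / l - (- exp (- (l * 0)) / l))) {0..b}"
          using that l by (intro fundamental_theorem_of_calculus)
            (auto intro!: derivative_eq_intros simp flip: has_real_derivative_iff_has_vector_derivative)
        from has_integral_scaleR_left[OF this, of x] show ?thesis
          by (simp add: integral_unique diff_divide_distrib)
      qed
      ultimately show ?thesis
        unfolding inverse_eq_divide
        by (elim Lim_transform_eventually) (auto intro!: eventually_mono[OF eventually_ge_at_top[of 0]])
    qed
    have "((\<lambda>b. truncated_laplace l (\<lambda>s. T s x) b - truncated_laplace l (\<lambda>_. x) b) \<longlongrightarrow> resolvent A (of_real l) x - x /\<^sub>R l) at_top"
      by (intro tendsto_diff laplace_resolvent(1) const l)
    moreover have "truncated_laplace l (\<lambda>s. T s x) b - truncated_laplace l (\<lambda>_. x) b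
        = truncated_laplace l (\<lambda>s. T s x - x) b" for b
      unfolding scaleR_diff_right
      by (intro integral_diff[symmetric] integrable_continuous_interval continuous_on_exp_scaleR
          continuous_on_subset[OF T_continuous] continuous_on_const) auto
    ultimately have "(truncated_laplace l (\<lambda>s. T s x - x) \<longlongrightarrow> resolvent A (of_real l) x - x /\<^sub>R l) at_top"
      by simp
    then have "ennreal (norm (resolvent A (of_real l) x - x /\<^sub>R l))
        \<le> (\<integral>\<^sup>+s. ennreal (exp (- (l * s)) * norm (T s x - x)) * indicator {0..} s \<partial>lborel)"
      by (intro laplace_norm_le continuous_intros T_continuous)
    also have "\<dots> \<le> (\<integral>\<^sup>+s. ennreal (exp (- (l * s)) * (e / 2 + k * s)) * indicator {0..} s \<partial>lborel)"
      by (intro nn_integral_mono) (auto simp: indicator_def intro!: ennreal_leI le)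
    also have "\<dots> = ennreal (e / 2 / l + k / l\<^sup>2)"
      using l e k by (intro nn_integral_linear_exp_atLeast) auto
    finally have *: "norm (resolvent A (of_real l) x - x /\<^sub>R l) \<le> e / 2 / l + k / l\<^sup>2"
      using l e k by (subst (asm) ennreal_le_iff) auto
    have "norm (l *\<^sub>R resolvent A (of_real l) x - x) = l * norm (resolvent A (of_real l) x - x /\<^sub>R l)"
      using l by (simp add: scaleR_diff_right flip: norm_scaleR[of l, unfolded abs_of_pos[OF l]])
    also have "\<dots> \<le> l * (e / 2 / l + k / l\<^sup>2)" using l * by (intro mult_left_mono) auto
    also have "\<dots> = e / 2 + k / l" using l by (simp add: field_simps power2_eq_square)
    finally show ?thesis .
  qed
  have "((\<lambda>l. e / 2 + k / l) \<longlongrightarrow> e / 2) at_top" by real_asymp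
  then have "\<forall>\<^sub>F l in at_top. e / 2 + k / l < e"     by (rule order_tendstoD(2)) (use e in simp)
  then show "\<forall>\<^sub>F l in at_top. dist (l *\<^sub>R resolvent A (of_real l) x) x < e"
    using eventually_gt_at_top[of 0]
    by eventually_elim (auto simp: dist_norm intro: le_less_trans[OF main])
qed

lemma domain_scaleR: "x \<in> dom A \<Longrightarrow> r *\<^sub>R x \<in> dom A"
  using generator_linear(3)[OF generates, of x _ x _ "of_real r"] by (auto simp: scaleC_of_real)

lemma resolvent_in_domain: "0 < l \<Longrightarrow> resolvent A (of_real l) x \<in> dom A"
  using laplace_resolvent(2) by blast

lemma closure_domain: "closure (dom A) = UNIV"
proof -
  have "x \<in> closure (dom A)" for x
    unfolding closure_approachable
  proof (intro allI impI)
    fix e :: real assume "0 < e"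
    then have "\<forall>\<^sub>F l in at_top. dist (l *\<^sub>R resolvent A (of_real l) x) x < e \<and> 0 < l"
      by (intro eventually_conj tendstoD[OF resolvent_tendsto] eventually_gt_at_top)
    then obtain l where "dist (l *\<^sub>R resolvent A (of_real l) x) x < e" "0 < l"
      by (auto simp: eventually_at_top_linorder)
    then show "\<exists>y\<in>dom A. dist y x < e"
      using domain_scaleR resolvent_in_domain by blast
  qed
  then show ?thesis by blast
qed

lemma domain_invariant:
  assumes t: "0 \<le> t" and x: "A x = Some y"
  shows "A (T t x) = Some (T t y)"
proof -
  have "((\<lambda>h. T t ((T h x - x) /\<^sub>R h)) \<longlongrightarrow> T t y) (at_right 0)"
    using x unfolding generatesD(2)[OF generates]
    by (rule bounded_linear.tendsto[OF T_linear[OF t]])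
  then have "((\<lambda>h. (T h (T t x) - T t x) /\<^sub>R h) \<longlongrightarrow> T t y) (at_right 0)"
    by (rule Lim_transform_eventually)
      (auto simp: eventually_at_filter T_simps t T_add[symmetric] add.commute)
  then show ?thesis unfolding generatesD(2)[OF generates] .
qed

end


section \<open>The extrapolation space and the mild solution\<close>

text \<open>Isometry makes \<open>f\<close> uniformly continuous, hence extendable. It also makes
  preimages of convergent sequences Cauchy, which together with the dense image gives
  surjectivity.\<close>

lemma extend_isometry:
  fixes f :: "'a::complex_banach \<Rightarrow> 'b::complex_banach"
  assumes dense: "closure V = UNIV"
    and add: "\<And>x y. x \<in> V \<Longrightarrow> y \<in> V \<Longrightarrow> x + y \<in> V \<and> f (x + y) = f x + f y"
    and scale: "\<And>a x. x \<in> V \<Longrightarrow> a *\<^sub>C x \<in> V \<and> f (a *\<^sub>C x) = a *\<^sub>C f x"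
    and norm: "\<And>x. x \<in> V \<Longrightarrow> norm (f x) = norm x"
    and range: "closure (f ` V) = UNIV"
  obtains J where "bounded_clinear J" "\<And>x. x \<in> V \<Longrightarrow> J x = f x" "\<And>x. norm (J x) = norm x" "surj J"
proof -
  have diff: "x - y \<in> V \<and> f (x - y) = f x - f y" if "x \<in> V" "y \<in> V" for x y
    using add[of x "(-1) *\<^sub>C y"] scale[of y "-1"] that by (simp add: scaleC_minus_left scaleC_one)
  have "dist (f x) (f y) = dist x y" if "x \<in> V" "y \<in> V" for x y
    using diff[OF that] norm unfolding dist_norm by metis
  then have "uniformly_continuous_on V f" unfolding uniformly_continuous_on_def by metis
  then obtain J where J: "uniformly_continuous_on (closure V) J" "\<And>x. x \<in> V \<Longrightarrow> f x = J x"
    by (rule uniformly_continuous_on_extension_on_closure) blast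
  have cont: "continuous_on UNIV J"
    using J(1) dense uniformly_continuous_imp_continuous by metis
  have approx: "\<exists>X. (\<forall>n. X n \<in> V) \<and> X \<longlonglongrightarrow> x" for x
    using dense closure_sequential[of x V] by auto
  have lim: "(\<lambda>n. J (X n)) \<longlonglongrightarrow> J x" if "X \<longlonglongrightarrow> x" for X x
    using continuous_on_tendsto_compose[OF cont that] by simp
  have J_norm: "norm (J x) = norm x" for x
  proof -
    obtain X where X: "\<And>n. X n \<in> V" "X \<longlonglongrightarrow> x" using approx by blast
    have "(\<lambda>n. norm (J (X n))) \<longlonglongrightarrow> norm x"
      using tendsto_norm[OF X(2)] norm[OF X(1)] J(2)[OF X(1)] by simp
    then show ?thesis using LIMSEQ_unique tendsto_norm[OF lim[OF X(2)]] by blast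
  qed
  have J_add: "J (x + y) = J x + J y" for x y
  proof -
    obtain X Y where X: "\<And>n. X n \<in> V" "X \<longlonglongrightarrow> x" and Y: "\<And>n. Y n \<in> V" "Y \<longlonglongrightarrow> y"
      using approx by metis
    have "J (X n + Y n) = J (X n) + J (Y n)" for n
      using add[OF X(1) Y(1), of n n] J(2) X(1) Y(1) by metis
    then have "(\<lambda>n. J (X n + Y n)) \<longlonglongrightarrow> J x + J y"
      using tendsto_add[OF lim[OF X(2)] lim[OF Y(2)]] by simp
    then show ?thesis using LIMSEQ_unique lim[OF tendsto_add[OF X(2) Y(2)]] by blast
  qed
  have J_scale: "J (a *\<^sub>C x) = a *\<^sub>C J x" for a x
  proof -
    obtain X where X: "\<And>n. X n \<in> V" "X \<longlonglongrightarrow> x" using approx by blast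
    have "J (a *\<^sub>C X n) = a *\<^sub>C J (X n)" for n
      using scale[OF X(1), of a n] J(2) X(1) by metis
    then have "(\<lambda>n. J (a *\<^sub>C X n)) \<longlonglongrightarrow> a *\<^sub>C J x"
      using bounded_linear.tendsto[OF bounded_linear_scaleC lim[OF X(2)], of a] by simp
    then show ?thesis
      using LIMSEQ_unique lim[OF bounded_linear.tendsto[OF bounded_linear_scaleC X(2)]] by blast
  qed
  have J_scaleR: "J (r *\<^sub>R x) = r *\<^sub>R J x" for r x
    using J_scale[of "of_real r" x] by (simp add: scaleC_of_real)
  have J_clinear: "bounded_clinear J"
    unfolding bounded_clinear_def
    using bounded_linear_intro[of J 1] J_add J_scaleR J_scale J_norm by simp
  have "surj J"
  proof (unfold surj_def, rule allI)
    fix y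
    have "y \<in> closure (f ` V)" using range by simp
    then obtain Y where Y: "\<And>n. Y n \<in> f ` V" "Y \<longlonglongrightarrow> y" unfolding closure_sequential by blast
    from Y(1) have "\<forall>n. \<exists>x. x \<in> V \<and> Y n = f x" by blast
    then obtain X where X: "\<And>n. X n \<in> V" "\<And>n. Y n = f (X n)" by metis
    have "dist (X m) (X n) = dist (Y m) (Y n)" for m n
      using diff[OF X(1) X(1), of m n] norm[of "X m - X n"] X(2) by (simp add: dist_norm)
    then have "Cauchy X"
      using LIMSEQ_imp_Cauchy[OF Y(2)] by (simp add: Cauchy_def)
    then obtain x where x: "X \<longlonglongrightarrow> x" by (auto simp: Cauchy_convergent_iff convergent_def)
    have "(\<lambda>n. J (X n)) = Y" using J(2)[OF X(1)] X(2) by auto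
    then have "J x = y" using lim[OF x] LIMSEQ_unique Y(2) by metis
    then show "\<exists>x. y = J x" by blast
  qed
  then show ?thesis using that J_clinear J(2) J_norm by metis
qed

section \<open>Convolution integrals in the state space\<close>

context bounded_semigroup
begin

text \<open>Strong continuity suffices although time and argument vary together: the uniform bound
  absorbs the change of the argument, and the rest is a single orbit.\<close>

lemma continuous_on_convolution:
  assumes w: "continuous_on {0..t} w"
  shows "continuous_on {0..t} (\<lambda>s. T (t - s) (w s))"
  unfolding continuous_on_def
proof
  fix r assume r: "r \<in> {0..t}"
  have "((\<lambda>s. T (t - s) (w s) - T (t - r) (w r)) \<longlongrightarrow> 0) (at r within {0..t})"
  proof (rule Lim_null_comparison)
    have "continuous_on {0..t} (\<lambda>s. T (t - s) (w r))"
      by (rule continuous_on_compose2[OF T_continuous]) (auto intro!: continuous_intros)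
    then have "((\<lambda>s. T (t - s) (w r) - T (t - r) (w r)) \<longlongrightarrow> 0) (at r within {0..t})"
      using r by (simp add: continuous_on_def LIM_zero)
    moreover have "((\<lambda>s. w s - w r) \<longlongrightarrow> 0) (at r within {0..t})"
      using w r by (simp add: continuous_on_def LIM_zero)
    ultimately show "((\<lambda>s. M * norm (w s - w r) + norm (T (t - s) (w r) - T (t - r) (w r))) \<longlongrightarrow> 0)
        (at r within {0..t})"
      by (intro tendsto_add_zero tendsto_mult_right_zero tendsto_norm_zero)
    have "norm (T (t - s) (w s) - T (t - r) (w r))
        \<le> M * norm (w s - w r) + norm (T (t - s) (w r) - T (t - r) (w r))" if "s \<in> {0..t}" for s
    proof -
      have "T (t - s) (w s) - T (t - r) (w r) = T (t - s) (w s - w r) + (T (t - s) (w r) - T (t - r) (w r))"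
        using that by (simp add: T_simps)
      then have "norm (T (t - s) (w s) - T (t - r) (w r))
          \<le> norm (T (t - s) (w s - w r)) + norm (T (t - s) (w r) - T (t - r) (w r))"
        by (metis norm_triangle_ineq)
      then show ?thesis using that bound[of "t - s" "w s - w r"] by simp
    qed
    then show "\<forall>\<^sub>F s in at r within {0..t}. norm (T (t - s) (w s) - T (t - r) (w r))
        \<le> M * norm (w s - w r) + norm (T (t - s) (w r) - T (t - r) (w r))"
      by (auto simp: eventually_at_filter)
  qed
  then show "((\<lambda>s. T (t - s) (w s)) \<longlongrightarrow> T (t - r) (w r)) (at r within {0..t})"
    by (simp add: LIM_zero_iff)
qed



text \<open>The integrand is the derivative of
  \<open>exp (\<mu> * of_real s) *\<^sub>C T (t - s) y\<close>; differentiability requires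
  \<open>y\<close> in the domain.\<close>

lemma has_integral_convolution_exp:
  assumes t: "0 \<le> t" and y: "A y = Some z"
  shows "((\<lambda>s. exp (\<mu> * of_real s) *\<^sub>C T (t - s) (\<mu> *\<^sub>C y - z)) has_integral
    (exp (\<mu> * of_real t) *\<^sub>C y - T t y)) {0..t}"
proof -
  have "((\<lambda>s. exp (\<mu> * of_real s) *\<^sub>C T (t - s) y) has_vector_derivative
      exp (\<mu> * of_real s) *\<^sub>C T (t - s) (\<mu> *\<^sub>C y - z)) (at s within {0..t})" if s: "s \<in> {0..t}" for s
  proof -
    have ts: "0 \<le> t - s" using s by simp
    have "((\<lambda>r. T r y) has_vector_derivative T (t - s) z) (at (t - s) within (\<lambda>s. t - s) ` {0..t})"
      by (rule has_vector_derivative_within_subset[OF generator_vector_derivative[OF generates y ts]]) auto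
    moreover have "((\<lambda>s. t - s) has_vector_derivative -1) (at s within {0..t})"
      by (auto intro!: derivative_eq_intros)
    ultimately have "((\<lambda>r. T r y) \<circ> (\<lambda>s. t - s) has_vector_derivative (-1) *\<^sub>R T (t - s) z) (at s within {0..t})"
      by (intro vector_diff_chain_within)
    from has_vector_derivative_exp_scaleC[OF this, of \<mu>]
    show ?thesis by (simp add: o_def T_simps[OF ts] bounded_clinear_scaleC[OF T_clinear[OF ts]])
  qed
  then have "((\<lambda>s. exp (\<mu> * of_real s) *\<^sub>C T (t - s) (\<mu> *\<^sub>C y - z)) has_integral
      (exp (\<mu> * of_real t) *\<^sub>C T (t - t) y - exp (\<mu> * of_real 0) *\<^sub>C T (t - 0) y)) {0..t}"
    by (intro fundamental_theorem_of_calculus t)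
  then show ?thesis by (simp add: T_0 scaleC_one)
qed

end

locale extrapolated_semigroup = bounded_semigroup A T M
  for A :: "'a::complex_banach \<rightharpoonup> 'a" and T M +
  fixes \<alpha> :: complex and i :: "'a \<Rightarrow> 'm::complex_banach"
  assumes extrapolation: "extrapolation_space A \<alpha> i"
begin

section \<open>The extrapolation space as an isometric copy of the state space\<close>

lemma \<alpha>_resolvent_set: "\<alpha> \<in> resolvent_set A"
  and i_clinear: "bounded_clinear i"
  and norm_i: "norm (i x) = norm (resolvent A \<alpha> x)"
  and closure_range_i: "closure (range i) = UNIV"
  using extrapolation by (auto simp: extrapolation_space_def)

lemmas A_R = resolvent_set_resolvent(2)[OF \<alpha>_resolvent_set]
  and R_eqI = resolvent_set_resolvent(3)[OF \<alpha>_resolvent_set]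

lemma R_T: "0 \<le> t \<Longrightarrow> resolvent A \<alpha> (T t x) = T t (resolvent A \<alpha> x)"
  using domain_invariant[OF _ A_R]
  by (intro R_eqI) (simp add: T_simps bounded_clinear_scaleC[OF T_clinear])

text \<open>On \<open>dom A\<close> the map is \<alpha> - A followed by \<open>i\<close>. The norm
  of \<open>i x\<close> is that of the resolvent applied to \<open>x\<close>, so this map preserves
  the norm of the state space; its image contains \<open>range i\<close> and is dense.\<close>

lemma isometry_exists:
  "\<exists>J. bounded_clinear J \<and> (\<forall>x. norm (J x) = norm x) \<and> surj J \<and> (\<forall>x. J (resolvent A \<alpha> x) = i x)"
proof -
  define f where "f x = i (\<alpha> *\<^sub>C x - the (A x))" for x
  have R_f: "resolvent A \<alpha> (\<alpha> *\<^sub>C x - y) = x" if "A x = Some y" for x y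
    using that by (intro R_eqI) simp
  have f_R: "f (resolvent A \<alpha> x) = i x" for x by (simp add: f_def A_R)
  note lin = linear_simps[OF bounded_clinear_imp_bounded_linear[OF i_clinear]]
  obtain J where J: "bounded_clinear J" "\<And>x. x \<in> dom A \<Longrightarrow> J x = f x" "\<And>x. norm (J x) = norm x" "surj J"
  proof (rule extend_isometry[OF closure_domain, of f])
    show "x + y \<in> dom A \<and> f (x + y) = f x + f y" if "x \<in> dom A" "y \<in> dom A" for x y
      using that generator_linear(1)[OF generates, of x _ y]
      by (auto simp: f_def scaleC_add_right lin[symmetric] algebra_simps)
    show "a *\<^sub>C x \<in> dom A \<and> f (a *\<^sub>C x) = a *\<^sub>C f x" if "x \<in> dom A" for a x
      using that generator_linear(3)[OF generates, of x _ x _ a]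
      by (auto simp: f_def scaleC_right_simps scaleC_scaleC mult.commute
          simp flip: bounded_clinear_scaleC[OF i_clinear])
    show "norm (f x) = norm x" if "x \<in> dom A" for x
      using that R_f by (auto simp: f_def norm_i)
    have "range i \<subseteq> f ` dom A"
      using f_R A_R by (metis domI image_subsetI imageI)
    then show "closure (f ` dom A) = UNIV"
      using closure_mono closure_range_i by blast
  qed (blast intro: that)
  moreover have "J (resolvent A \<alpha> x) = i x" for x
    using J(2)[of "resolvent A \<alpha> x"] f_R A_R by (auto simp: dom_def)
  ultimately show ?thesis by blast
qed

text \<open>\<open>J\<close> is the inverse of the isometry from \<open>X\<^sub>-\<^sub>1\<close> onto \<open>X\<close> that extends \<open>R(\<alpha>, A)\<close>.\<close>

definition J :: "'a \<Rightarrow> 'm" where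
  "J = (SOME J. bounded_clinear J \<and> (\<forall>x. norm (J x) = norm x) \<and> surj J \<and> (\<forall>x. J (resolvent A \<alpha> x) = i x))"

lemma J_clinear: "bounded_clinear J" and norm_J: "norm (J x) = norm x" and surj_J: "surj J"
  and J_R: "J (resolvent A \<alpha> x) = i x"
  using someI_ex[OF isometry_exists] unfolding J_def[symmetric] by auto

lemmas J_linear = bounded_clinear_imp_bounded_linear[OF J_clinear]

lemma inj_J: "inj J"
proof (rule injI)
  fix x y assume "J x = J y"
  then have "norm (J (x - y)) = 0" by (simp add: linear_simps[OF J_linear])
  then show "x = y" by (simp add: norm_J)
qed

lemma inv_J_clinear: "bounded_clinear (inv J)"
proof -
  have inv: "J (inv J b) = b" for b by (rule surj_f_inv_f[OF surj_J])
  have "inv J (a + b) = inv J a + inv J b" for a b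
    by (rule injD[OF inj_J]) (simp add: linear_simps[OF J_linear] inv)
  moreover have "inv J (r *\<^sub>R a) = r *\<^sub>R inv J a" for r a
    by (rule injD[OF inj_J]) (simp add: linear_simps[OF J_linear] inv)
  moreover have "inv J (c *\<^sub>C a) = c *\<^sub>C inv J a" for c a
    by (rule injD[OF inj_J]) (simp add: bounded_clinear_scaleC[OF J_clinear] inv)
  moreover have "norm (inv J b) \<le> norm b * 1" for b
    using norm_J[of "inv J b"] by (simp add: inv)
  ultimately show ?thesis
    unfolding bounded_clinear_def by (auto intro: bounded_linear_intro[where K = 1])
qed

lemma inv_J_i: "inv J (i x) = resolvent A \<alpha> x"
  by (metis J_R inj_J inv_f_f)

lemma inj_i: "inj i"
proof (rule injI)
  fix x y assume "i x = i y"
  then have "resolvent A \<alpha> x = resolvent A \<alpha> y" by (metis inv_J_i)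
  then have "Some (\<alpha> *\<^sub>C resolvent A \<alpha> x - x) = Some (\<alpha> *\<^sub>C resolvent A \<alpha> x - y)"
    by (metis A_R)
  then show "x = y" by simp
qed

text \<open>\<open>J\<close> plays the role of \<alpha> - A on the whole state space, and density of
  \<open>dom A\<close> singles out this extension.\<close>

lemma op_ext_eq: "op_ext A i x = \<alpha> *\<^sub>C i x - J x"
proof -
  have clin: "bounded_clinear (\<lambda>x. \<alpha> *\<^sub>C i x - J x)"
    unfolding bounded_clinear_def
    using bounded_clinear_imp_bounded_linear[OF i_clinear] J_linear
    by (auto intro!: bounded_linear_sub bounded_linear_compose[OF bounded_linear_scaleC, of i]
        simp: bounded_clinear_scaleC[OF i_clinear] bounded_clinear_scaleC[OF J_clinear]
          scaleC_right_simps scaleC_scaleC mult.commute)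
  have ext: "\<alpha> *\<^sub>C i x - J x = i y" if "A x = Some y" for x y
  proof -
    have "x = resolvent A \<alpha> (\<alpha> *\<^sub>C x - y)" by (rule R_eqI[symmetric]) (simp add: that)
    then have "J x = i (\<alpha> *\<^sub>C x - y)" by (metis J_R)
    then show ?thesis
      by (simp add: linear_simps[OF bounded_clinear_imp_bounded_linear[OF i_clinear]]
          bounded_clinear_scaleC[OF i_clinear])
  qed
  have "op_ext A i = (\<lambda>x. \<alpha> *\<^sub>C i x - J x)"
    unfolding op_ext_def
  proof (rule the_equality)
    show "bounded_clinear (\<lambda>x. \<alpha> *\<^sub>C i x - J x) \<and> (\<forall>x y. A x = Some y \<longrightarrow> \<alpha> *\<^sub>C i x - J x = i y)"
      using clin ext by blast
    show "g = (\<lambda>x. \<alpha> *\<^sub>C i x - J x)" if "bounded_clinear g \<and> (\<forall>x y. A x = Some y \<longrightarrow> g x = i y)" for g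
      using that clin ext
      by (intro bounded_linear_eq_on_dense[OF _ _ closure_domain]) (auto simp: bounded_clinear_def dom_def)
  qed
  then show ?thesis by simp
qed

text \<open>The resolvent commutes with the semigroup, so conjugation by \<open>J\<close> extends
  \<open>T\<close>; density of \<open>range i\<close> singles out this extension.\<close>

lemma semigroup_ext_eq:
  assumes t: "0 \<le> t"
  shows "semigroup_ext T i t b = J (T t (inv J b))"
proof -
  have clin: "bounded_clinear (\<lambda>b. J (T t (inv J b)))"
    by (rule bounded_clinear_compose[OF J_clinear bounded_clinear_compose[OF T_clinear[OF t] inv_J_clinear]])
  have ext: "J (T t (inv J (i x))) = i (T t x)" for x
    by (simp add: inv_J_i R_T[OF t, symmetric] J_R)
  have "semigroup_ext T i t = (\<lambda>b. J (T t (inv J b)))"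
    unfolding semigroup_ext_def
  proof (rule the_equality)
    show "bounded_clinear (\<lambda>b. J (T t (inv J b))) \<and> (\<forall>x. J (T t (inv J (i x))) = i (T t x))"
      using clin ext by blast
    show "g = (\<lambda>b. J (T t (inv J b)))" if "bounded_clinear g \<and> (\<forall>x. g (i x) = i (T t x))" for g
      using that clin ext
      by (intro bounded_linear_eq_on_dense[OF _ _ closure_range_i]) (auto simp: bounded_clinear_def)
  qed
  then show ?thesis by simp
qed

text \<open>For \<open>y\<close>, the resolvent applied to \<open>\<Sigma> v\<close>, one has
  \<open>J y = i (\<Sigma> v)\<close>, and the Sylvester equation at \<open>v\<close> reads
  \<open>B v = J (\<mu> *\<^sub>C y - z)\<close> with \<open>A y = Some z\<close>. The integral is
  therefore the image under \<open>J\<close> of an exact one.\<close>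

lemma mild_integral_eigenvector:
  assumes \<Sigma>: "bounded_clinear \<Sigma>" and B: "bounded_clinear B" and syl: "sylvester_equation S A i B \<Sigma>"
    and v: "S v = Some (\<mu> *\<^sub>C v)" and t: "0 \<le> t"
  shows "((\<lambda>s. semigroup_ext T i (t - s) (B (exp (\<mu> * of_real s) *\<^sub>C v))) has_integral
    (i (\<Sigma> (exp (\<mu> * of_real t) *\<^sub>C v)) - i (T t (\<Sigma> v)))) {0..t}"
proof -
  define y where "y = resolvent A \<alpha> (\<Sigma> v)"
  define z where "z = \<alpha> *\<^sub>C y - \<Sigma> v"
  have y: "A y = Some z" by (simp add: y_def z_def A_R)
  have J_y: "J y = i (\<Sigma> v)" by (simp add: y_def J_R)
  note scale = bounded_clinear_scaleC[OF i_clinear] bounded_clinear_scaleC[OF J_clinear]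
    bounded_clinear_scaleC[OF inv_J_clinear] bounded_clinear_scaleC[OF \<Sigma>] bounded_clinear_scaleC[OF B]
    bounded_clinear_scaleC[OF T_clinear]
  have "i (\<Sigma> (\<mu> *\<^sub>C v)) = op_ext A i (\<Sigma> v) + B v"
    using syl v unfolding sylvester_equation_def by force
  then have "B v = \<mu> *\<^sub>C J y - (\<alpha> *\<^sub>C J y - J (\<Sigma> v))"
    by (simp add: op_ext_eq scale J_y algebra_simps)
  also have "\<dots> = J (\<mu> *\<^sub>C y - z)"
    by (simp add: z_def linear_simps[OF J_linear] scale)
  finally have "inv J (B v) = \<mu> *\<^sub>C y - z" by (simp add: inj_J)
  then have 1: "semigroup_ext T i (t - s) (B (exp (\<mu> * of_real s) *\<^sub>C v))
      = J (exp (\<mu> * of_real s) *\<^sub>C T (t - s) (\<mu> *\<^sub>C y - z))" if "s \<in> {0..t}" for s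
    using that by (simp add: semigroup_ext_eq scale)
  have 2: "((\<lambda>s. J (exp (\<mu> * of_real s) *\<^sub>C T (t - s) (\<mu> *\<^sub>C y - z))) has_integral
      J (exp (\<mu> * of_real t) *\<^sub>C y - T t y)) {0..t}"
    using has_integral_linear[OF has_integral_convolution_exp[OF t y] J_linear] by (simp add: o_def)
  have 3: "J (exp (\<mu> * of_real t) *\<^sub>C y - T t y) = i (\<Sigma> (exp (\<mu> * of_real t) *\<^sub>C v)) - i (T t (\<Sigma> v))"
    by (simp add: linear_simps[OF J_linear] scale J_y) (simp add: y_def R_T[OF t, symmetric] J_R)
  show ?thesis by (rule has_integral_eq[OF 1[symmetric] 2[unfolded 3]])
qed

text \<open>The vectors \<open>v\<close> that satisfy the formula form a closed subspace containing
  the eigenvectors of \<open>S\<close>. The hypothesis \<open>closed_induct\<close> expresses that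
  eigenvectors span a dense subspace, in a form that leaves the space abstract.\<close>

lemma mild_integral:
  assumes \<Sigma>: "bounded_clinear \<Sigma>" and B: "bounded_clinear B" and syl: "sylvester_equation S A i B \<Sigma>"
    and S: "generates S TS" and t: "0 \<le> t"
    and closed_induct: "\<And>V. closed V \<Longrightarrow> (\<And>v w. v \<in> V \<Longrightarrow> w \<in> V \<Longrightarrow> v + w \<in> V) \<Longrightarrow>
      (\<And>a v. v \<in> V \<Longrightarrow> a *\<^sub>C v \<in> V) \<Longrightarrow> (\<And>v \<mu>. S v = Some (\<mu> *\<^sub>C v) \<Longrightarrow> v \<in> V) \<Longrightarrow> V = UNIV"
  shows "((\<lambda>s. semigroup_ext T i (t - s) (B (TS s v))) has_integral
    (i (\<Sigma> (TS t v)) - i (T t (\<Sigma> (v::'w::complex_banach))))) {0..t}"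
proof -
  note TS = generatesD(1)[OF S]
  note i_linear = bounded_clinear_imp_bounded_linear[OF i_clinear]
  note lin = linear_simps[OF i_linear] linear_simps[OF T_linear[OF t]]
    linear_simps[OF bounded_clinear_imp_bounded_linear[OF \<Sigma>]]
    linear_simps[OF C0_semigroupD(2)[OF TS]]
  note scale = bounded_clinear_scaleC[OF i_clinear] bounded_clinear_scaleC[OF T_clinear]
    bounded_clinear_scaleC[OF \<Sigma>] bounded_clinear_scaleC[OF C0_semigroupD(1)[OF TS]]
  define b where "b = (\<lambda>v. inv J (B v))"
  have b: "bounded_clinear b" unfolding b_def by (rule bounded_clinear_compose[OF inv_J_clinear B])
  note b_linear = bounded_clinear_imp_bounded_linear[OF b]
  define g where "g v s = J (T (t - s) (b (TS s v)))" for v s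
  define h where "h v = i (\<Sigma> (TS t v)) - i (T t (\<Sigma> v))" for v
  define V where "V = {v. (g v has_integral h v) {0..t}}"
  have g_continuous: "continuous_on {0..t} (g v)" for v
    unfolding g_def
    by (intro bounded_linear.continuous_on[OF J_linear] continuous_on_convolution
        bounded_linear.continuous_on[OF b_linear] continuous_on_subset[OF C0_semigroup_continuous_on[OF TS]]) auto
  have g_simps: "g (v + w) s = g v s + g w s" "g (a *\<^sub>C v) s = a *\<^sub>C g v s" "g (v - w) s = g v s - g w s"
    if "s \<in> {0..t}" for v w a s
    using that linear_simps[OF J_linear] T_simps[of "t - s"] linear_simps[OF b_linear] lin
    by (simp_all add: g_def bounded_clinear_scaleC[OF J_clinear] scale bounded_clinear_scaleC[OF b])
  have h_simps: "h (v + w) = h v + h w" "h (a *\<^sub>C v) = a *\<^sub>C h v" for v w a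
    using t by (simp_all add: h_def lin scale scaleC_right_simps)
  have \<Sigma>_linear: "bounded_linear \<Sigma>" by (rule bounded_clinear_imp_bounded_linear[OF \<Sigma>])
  have h_linear: "bounded_linear h"
    unfolding h_def
    by (intro bounded_linear_sub
        bounded_linear_compose[OF i_linear bounded_linear_compose[OF \<Sigma>_linear C0_semigroupD(2)[OF TS t]]]
        bounded_linear_compose[OF i_linear bounded_linear_compose[OF T_linear[OF t] \<Sigma>_linear]])
  obtain N where N: "0 \<le> N" "\<And>s v. 0 \<le> s \<Longrightarrow> s \<le> t \<Longrightarrow> norm (TS s v) \<le> N * norm v"
    using C0_semigroup_locally_bounded[OF TS] by blast
  obtain c where c: "0 \<le> c" "\<And>v. norm (b v) \<le> norm v * c"
    using bounded_linear.nonneg_bounded[OF b_linear] by blast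
  \<comment> \<open>The bound is uniform in \<open>s\<close> and linear in \<open>v\<close>: applied
    to differences it gives uniform convergence of the integrands, so limits pass under the integral
    and \<open>V\<close> is closed.\<close>
  have g_le: "norm (g v s) \<le> M * (c * N) * norm v" if s: "s \<in> {0..t}" for v s
  proof -
    have "norm (g v s) \<le> M * norm (b (TS s v))"
      using s by (simp add: g_def norm_J bound)
    also have "\<dots> \<le> M * (norm (TS s v) * c)" using M_nonneg c(2) by (intro mult_left_mono)
    also have "\<dots> \<le> M * (N * norm v * c)"
      using M_nonneg c(1) N(2)[of s v] s by (intro mult_left_mono mult_right_mono) auto
    finally show ?thesis by (simp add: algebra_simps)
  qed
  have "V = UNIV"
  proof (rule closed_induct)
    show "v + w \<in> V" if "v \<in> V" "w \<in> V" for v w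
      using that has_integral_eq[OF g_simps(1)[symmetric] has_integral_add[of "g v" "h v" "{0..t}" "g w" "h w"]]
      by (simp add: V_def h_simps)
    show "a *\<^sub>C v \<in> V" if "v \<in> V" for a v
      using that has_integral_eq[OF g_simps(2)[symmetric] has_integral_linear[OF _ bounded_linear_scaleC[of a],
            of "g v" "h v" "{0..t}", unfolded o_def]]
      by (simp add: V_def h_simps)
    show "v \<in> V" if v: "S v = Some (\<mu> *\<^sub>C v)" for v \<mu>
    proof -
      have "g v s = semigroup_ext T i (t - s) (B (exp (\<mu> * of_real s) *\<^sub>C v))" if "s \<in> {0..t}" for s
        using that by (simp add: g_def b_def semigroup_ext_eq semigroup_eigenvector[OF S v])
      from has_integral_eq[OF this[symmetric] mild_integral_eigenvector[OF \<Sigma> B syl v t]]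
      show ?thesis by (simp add: V_def h_def semigroup_eigenvector[OF S v t])
    qed
    show "closed V"
      unfolding closed_sequential_limits
    proof (intro allI impI, elim conjE)
      fix X v assume X: "\<forall>n. X n \<in> V" and lim: "X \<longlonglongrightarrow> v"
      have "uniform_limit {0..t} (\<lambda>n. g (X n)) (g v) sequentially"
      proof (rule uniform_limitI)
        fix e :: real assume "0 < e"
        have "(\<lambda>n. M * (c * N) * norm (X n - v)) \<longlonglongrightarrow> 0"
          using lim by (intro tendsto_mult_right_zero tendsto_norm_zero LIM_zero)
        then have "\<forall>\<^sub>F n in sequentially. M * (c * N) * norm (X n - v) < e"
          using \<open>0 < e\<close> by (intro order_tendstoD(2))
        then show "\<forall>\<^sub>F n in sequentially. \<forall>s\<in>{0..t}. dist (g (X n) s) (g v s) < e"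
          by eventually_elim (auto simp: dist_norm g_simps(3)[symmetric] intro: le_less_trans[OF g_le])
      qed
      then obtain I K where I: "\<And>n. (g (X n) has_integral I n) {0..t}" "(g v has_integral K) {0..t}" "I \<longlonglongrightarrow> K"
        by (rule uniform_limit_integral[OF _ g_continuous sequentially_bot]) blast
      have "I n = h (X n)" for n using I(1) X has_integral_unique unfolding V_def by blast
      then have "(\<lambda>n. h (X n)) \<longlonglongrightarrow> K" using I(3) by presburger
      then have "K = h v" using bounded_linear.tendsto[OF h_linear lim] LIMSEQ_unique by blast
      then show "v \<in> V" using I(2) by (simp add: V_def)
    qed
  qed
  then have "(g v has_integral h v) {0..t}" by (auto simp: V_def)
  moreover have "g v s = semigroup_ext T i (t - s) (B (TS s v))" if "s \<in> {0..t}" for s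
    using that by (simp add: g_def b_def semigroup_ext_eq)
  ultimately show ?thesis unfolding h_def by (rule has_integral_eq[rotated])
qed

text \<open>The definite description is settled by uniqueness of integrals together with injectivity
  of \<open>i\<close>.\<close>

lemma mild_state_eq:
  assumes t: "0 \<le> t" and int: "((\<lambda>s. semigroup_ext T i (t - s) (B (f s))) has_integral (i y - i (T t w))) {0..t}"
  shows "mild_state T i B f x t = T t (x - w) + y"
proof -
  note i_linear = bounded_clinear_imp_bounded_linear[OF i_clinear]
  have *: "i (T t (x - w) + y) - i (T t x) = i y - i (T t w)"
    by (simp add: linear_simps[OF i_linear] linear_simps[OF T_linear[OF t]])
  show ?thesis
    unfolding mild_state_def
  proof (rule the_equality)
    show "((\<lambda>s. semigroup_ext T i (t - s) (B (f s))) has_integral (i (T t (x - w) + y) - i (T t x))) {0..t}"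
      using int by (simp only: *)
    fix z assume "((\<lambda>s. semigroup_ext T i (t - s) (B (f s))) has_integral (i z - i (T t x))) {0..t}"
    from has_integral_unique[OF this int] have "i z = i (T t (x - w) + y)"
      using * by (metis diff_eq_eq)
    then show "z = T t (x - w) + y" by (rule injD[OF inj_i])
  qed
qed

end


section \<open>A weak type maximal inequality\<close>

text \<open>Vitali covering for one-sided averages: among the intervals whose average exceeds
  \<open>c\<close> a disjoint family is selected whose fivefold enlargements cover all bad points,
  and each length is at most the integral over the interval divided by \<open>c\<close>. A
  measurable cover \<open>U\<close> is returned, which avoids measurability of the bad set
  itself.\<close>

lemma maximal_function_weak_type:
  fixes f :: "real \<Rightarrow> ennreal"
  assumes f [measurable]: "f \<in> borel_measurable borel" and int: "(\<integral>\<^sup>+s. f s \<partial>lborel) \<le> ennreal I"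
    and c: "0 < c" and I: "0 \<le> I"
  obtains U where "U \<in> sets lborel" "emeasure lborel U \<le> ennreal (5 * I / c)"
    "\<And>t h. 0 < h \<Longrightarrow> ennreal (c * h) < (\<integral>\<^sup>+s\<in>{t..t + h}. f s \<partial>lborel) \<Longrightarrow> t \<in> U"
proof -
  define E where "E = {t. \<exists>h>0. ennreal (c * h) < (\<integral>\<^sup>+s\<in>{t..t + h}. f s \<partial>lborel)}"
  have "\<forall>t\<in>E. \<exists>h>0. ennreal (c * h) < (\<integral>\<^sup>+s\<in>{t..t + h}. f s \<partial>lborel)" by (simp add: E_def)
  then obtain h where h: "\<And>t. t \<in> E \<Longrightarrow> 0 < h t"
    and h_int: "\<And>t. t \<in> E \<Longrightarrow> ennreal (c * h t) < (\<integral>\<^sup>+s\<in>{t..t + h t}. f s \<partial>lborel)"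
    by (metis (no_types))
  have h_le: "h t \<le> I / c" if "t \<in> E" for t
  proof -
    have "ennreal (c * h t) \<le> (\<integral>\<^sup>+s. f s \<partial>lborel)"
      using h_int[OF that]
      by (rule less_imp_le[THEN order_trans]) (auto intro!: nn_integral_mono simp: indicator_def)
    then have "ennreal (c * h t) \<le> ennreal I" using int by (rule order_trans)
    then show ?thesis using c I by (simp add: ennreal_le_iff field_simps)
  qed
  \<comment> \<open>The ball of centre \<open>a t\<close> and radius \<open>r t\<close> is the
    interval from \<open>t\<close> to \<open>t + h t\<close>.\<close>
  define a where "a t = t + h t / 2" for t
  define r where "r t = h t / 2" for t
  have "E \<subseteq> (\<Union>t\<in>E. cball (a t) (r t))"
    using h by (force simp: a_def r_def cball_eq_atLeastAtMost)
  moreover have "0 < r t \<and> r t \<le> I / (2 * c)" if "t \<in> E" for t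
    using h[OF that] h_le[OF that] by (simp add: r_def)
  ultimately obtain D where D: "countable D" "D \<subseteq> E"
    "pairwise (\<lambda>s t. disjnt (cball (a s) (r s)) (cball (a t) (r t))) D"
    "E \<subseteq> (\<Union>t\<in>D. cball (a t) (5 * r t))"
    by (rule Vitali_covering_lemma_cballs[of E a r E])
  \<comment> \<open>The selected intervals are numbered by naturals, with empty sets outside
    \<open>N\<close>, so that a finite selection needs no separate treatment.\<close>
  define N where "N = to_nat_on D ` D"
  define t where "t n = from_nat_into D n" for n
  have t: "t n \<in> D" "0 < h (t n)" "ennreal (c * h (t n)) \<le> (\<integral>\<^sup>+s\<in>{t n..t n + h (t n)}. f s \<partial>lborel)" if "n \<in> N" for n
  proof -
    show "t n \<in> D" using that D(1) by (auto simp: N_def t_def)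
    then have "t n \<in> E" using D(2) by blast
    then show "0 < h (t n)" "ennreal (c * h (t n)) \<le> (\<integral>\<^sup>+s\<in>{t n..t n + h (t n)}. f s \<partial>lborel)"
      using h h_int less_imp_le by blast+
  qed
  define X where "X n = (if n \<in> N then cball (a (t n)) (5 * r (t n)) else {})" for n
  define Y where "Y n = (if n \<in> N then {t n..t n + h (t n)} else {})" for n
  have Y_cball: "Y n = cball (a (t n)) (r (t n))" if "n \<in> N" for n
    using that by (simp add: Y_def a_def r_def cball_eq_atLeastAtMost)
  have disj: "disjoint_family Y"
    unfolding disjoint_family_on_def
  proof (intro ballI impI)
    fix m n :: nat assume mn: "m \<noteq> n"
    show "Y m \<inter> Y n = {}"
    proof (cases "m \<in> N \<and> n \<in> N")
      case True
      then have "t m \<noteq> t n"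
        using mn D(1) by (auto simp: N_def t_def)
      then show ?thesis
        using D(3) True t(1) Y_cball unfolding pairwise_def disjnt_def by metis
    next
      case False
      then show ?thesis by (auto simp: Y_def)
    qed
  qed
  have Y_sets: "Y n \<in> sets lborel" for n by (simp add: Y_def)
  have X_le: "emeasure lborel (X n) \<le> ennreal (5 / c) * (\<integral>\<^sup>+s\<in>Y n. f s \<partial>lborel)" for n
  proof (cases "n \<in> N")
    case True
    have "emeasure lborel (X n) = ennreal (5 / c) * ennreal (c * h (t n))"
      using True t(2)[OF True] c
      by (simp add: X_def a_def r_def cball_eq_atLeastAtMost flip: ennreal_mult)
    also have "\<dots> \<le> ennreal (5 / c) * (\<integral>\<^sup>+s\<in>Y n. f s \<partial>lborel)"
      using True t(3)[OF True] by (intro mult_left_mono) (auto simp: Y_def)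
    finally show ?thesis .
  qed (simp add: X_def)
  show ?thesis
  proof (rule that)
    show "(\<Union>n. X n) \<in> sets lborel" by (auto simp: X_def)
    have "emeasure lborel (\<Union>n. X n) \<le> (\<Sum>n. emeasure lborel (X n))"
      by (rule emeasure_subadditive_countably) (auto simp: X_def)
    also have "\<dots> \<le> (\<Sum>n. ennreal (5 / c) * (\<integral>\<^sup>+s\<in>Y n. f s \<partial>lborel))"
      by (intro suminf_le X_le) auto
    also have "\<dots> = ennreal (5 / c) * (\<Sum>n. \<integral>\<^sup>+s\<in>Y n. f s \<partial>lborel)"
      by (rule ennreal_suminf_cmult)
    also have "(\<Sum>n. \<integral>\<^sup>+s\<in>Y n. f s \<partial>lborel) = (\<integral>\<^sup>+s\<in>(\<Union>n. Y n). f s \<partial>lborel)"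
      by (rule nn_integral_disjoint_family[symmetric]) (use disj Y_sets in auto)
    also have "\<dots> \<le> (\<integral>\<^sup>+s. f s \<partial>lborel)"
      by (intro nn_integral_mono) (auto simp: indicator_def)
    also have "\<dots> \<le> ennreal I" by (rule int)
    also have "ennreal (5 / c) * ennreal I = ennreal (5 * I / c)"
      using c I by (simp flip: ennreal_mult)
    finally show "emeasure lborel (\<Union>n. X n) \<le> ennreal (5 * I / c)"
      by (simp add: mult_left_mono)
    fix s d assume "0 < d" "ennreal (c * d) < (\<integral>\<^sup>+r\<in>{s..s + d}. f r \<partial>lborel)"
    then have "s \<in> E" by (auto simp: E_def)
    then obtain u where u: "u \<in> D" "s \<in> cball (a u) (5 * r u)" using D(4) by blast
    then have "s \<in> X (to_nat_on D u)" using D(1) by (simp add: X_def N_def t_def)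
    then show "s \<in> (\<Union>n. X n)" by blast
  qed
qed

text \<open>The exponential kernel is an average of the kernels \<open>1\<^bsub>[0, h]\<^esub> / h\<close>:
  \<open>exp (- l s)\<close> is the integral of \<open>l exp (- l h)\<close> over \<open>h \<ge> s\<close>.\<close>

lemma exp_average_le:
  fixes f :: "real \<Rightarrow> ennreal"
  assumes f [measurable]: "f \<in> borel_measurable borel" and l: "0 < l" and c: "0 \<le> c"
    and avg: "\<And>h. 0 < h \<Longrightarrow> (\<integral>\<^sup>+s\<in>{t..t + h}. f s \<partial>lborel) \<le> ennreal (c * h)"
  shows "(\<integral>\<^sup>+s\<in>{0..}. ennreal (exp (- (l * s))) * f (t + s) \<partial>lborel) \<le> ennreal (c / l)"
proof -
  let ?k = "\<lambda>s h. f (t + s) * (if 0 \<le> s \<and> s \<le> h then 1 else 0) * ennreal (l * exp (- (l * h)))"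
  have avg': "(\<integral>\<^sup>+s. f (t + s) * (if 0 \<le> s \<and> s \<le> h then 1 else 0) \<partial>lborel) \<le> ennreal (c * h)"
    if "0 \<le> h" for h
  proof -
    have "(\<integral>\<^sup>+s\<in>{t..t + h}. f s \<partial>lborel) = (\<integral>\<^sup>+s. f (t + s) * (if 0 \<le> s \<and> s \<le> h then 1 else 0) \<partial>lborel)"
      by (subst nn_integral_real_affine[where t = t and c = 1])
        (auto simp: indicator_def intro!: nn_integral_cong)
    moreover have "(\<integral>\<^sup>+s\<in>{t..t + h}. f s \<partial>lborel) \<le> ennreal (c * h)"
      using avg[of h] that by (cases "h = 0") auto
    ultimately show ?thesis by simp
  qed
  have "(\<integral>\<^sup>+s\<in>{0..}. ennreal (exp (- (l * s))) * f (t + s) \<partial>lborel) = (\<integral>\<^sup>+s. (\<integral>\<^sup>+h. ?k s h \<partial>lborel) \<partial>lborel)"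
  proof (rule nn_integral_cong)
    fix s :: real
    show "ennreal (exp (- (l * s))) * f (t + s) * indicator {0..} s = (\<integral>\<^sup>+h. ?k s h \<partial>lborel)"
    proof (cases "0 \<le> s")
      case True
      have "(\<integral>\<^sup>+h. ?k s h \<partial>lborel)
          = (\<integral>\<^sup>+h. (f (t + s) * ennreal l) * (ennreal (exp (- (l * h))) * indicator {s..} h) \<partial>lborel)"
        using True l by (intro nn_integral_cong) (auto simp: indicator_def ennreal_mult mult.assoc)
      also have "\<dots> = f (t + s) * ennreal l * ennreal (exp (- (l * s)) / l)"
        using l by (simp add: nn_integral_cmult nn_integral_exp_atLeast)
      also have "\<dots> = f (t + s) * ennreal (l * (exp (- (l * s)) / l))"
        using l by (subst ennreal_mult) (auto simp: mult.assoc)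
      also have "\<dots> = f (t + s) * ennreal (exp (- (l * s)))" using l by simp
      finally show ?thesis using True by (simp add: mult.commute)
    qed simp
  qed
  also have "\<dots> = (\<integral>\<^sup>+h. (\<integral>\<^sup>+s. ?k s h \<partial>lborel) \<partial>lborel)"
    by (rule lborel_pair.Fubini') measurable
  \<comment> \<open>After the exchange the inner integral is bounded by \<open>c * h\<close>, and
    \<open>l\<close> times the integral of \<open>h * exp (- (l * h))\<close> over the half-line is
    \<open>1 / l\<close>.\<close>
  also have "\<dots> \<le> (\<integral>\<^sup>+h. ennreal l * (ennreal (exp (- (l * h)) * (0 + c * h)) * indicator {0..} h) \<partial>lborel)"
  proof (rule nn_integral_mono)
    fix h :: real
    show "(\<integral>\<^sup>+s. ?k s h \<partial>lborel) \<le> ennreal l * (ennreal (exp (- (l * h)) * (0 + c * h)) * indicator {0..} h)"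
    proof (cases "0 \<le> h")
      case True
      have "(\<integral>\<^sup>+s. ?k s h \<partial>lborel)
          = (\<integral>\<^sup>+s. f (t + s) * (if 0 \<le> s \<and> s \<le> h then 1 else 0) \<partial>lborel) * ennreal (l * exp (- (l * h)))"
        by (rule nn_integral_multc) measurable
      also have "\<dots> \<le> ennreal (c * h) * ennreal (l * exp (- (l * h)))"
        by (intro mult_right_mono avg' True) simp
      also have "\<dots> = ennreal l * ennreal (exp (- (l * h)) * (c * h))"
        using l c True by (simp add: mult_ac flip: ennreal_mult)
      finally show ?thesis using True by simp
    next
      case False
      then have "(\<integral>\<^sup>+s. ?k s h \<partial>lborel) = (\<integral>\<^sup>+s. 0 \<partial>(lborel :: real measure))"
        by (intro nn_integral_cong) auto
      then show ?thesis by simp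
    qed
  qed
  also have "\<dots> = ennreal l * (\<integral>\<^sup>+h. ennreal (exp (- (l * h)) * (0 + c * h)) * indicator {0..} h \<partial>lborel)"
    by (rule nn_integral_cmult) measurable
  also have "\<dots> = ennreal l * ennreal (0 / l + c / l\<^sup>2)"
    using l c by (subst nn_integral_linear_exp_atLeast) auto
  also have "\<dots> = ennreal (c / l)"
    using l c by (simp add: power2_eq_square flip: ennreal_mult)
  finally show ?thesis .
qed

text \<open>For fixed \<open>c\<close> the bad set of index \<open>n\<close> has measure at most
  \<open>5 * I n / c\<close>, which tends to 0, so points bad for every \<open>n\<close> form a null
  set. The thresholds \<open>1 / (p + 1)\<close> reduce all \<open>c\<close> to countably
  many.\<close>

lemma AE_small_averages:
  fixes G :: "nat \<Rightarrow> real \<Rightarrow> ennreal"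
  assumes G [measurable]: "\<And>n. G n \<in> borel_measurable borel"
    and int: "\<And>n. (\<integral>\<^sup>+s. G n s \<partial>lborel) \<le> ennreal (I n)" and I: "\<And>n. 0 \<le> I n" "I \<longlonglongrightarrow> 0"
  shows "AE t in lborel. \<forall>c>0. \<exists>n. \<forall>h>0. (\<integral>\<^sup>+s\<in>{t..t + h}. G n s \<partial>lborel) \<le> ennreal (c * h)"
proof -
  have *: "AE t in lborel. \<exists>n. \<forall>h>0. (\<integral>\<^sup>+s\<in>{t..t + h}. G n s \<partial>lborel) \<le> ennreal (c * h)"
    if c: "0 < c" for c
  proof -
    have "\<exists>U. U \<in> sets lborel \<and> emeasure lborel U \<le> ennreal (5 * I n / c) \<and>
        (\<forall>t h. 0 < h \<longrightarrow> ennreal (c * h) < (\<integral>\<^sup>+s\<in>{t..t + h}. G n s \<partial>lborel) \<longrightarrow> t \<in> U)" for n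
      by (rule maximal_function_weak_type[OF G int c I(1)]) blast
    then obtain U where U: "\<And>n. U n \<in> sets lborel" "\<And>n. emeasure lborel (U n) \<le> ennreal (5 * I n / c)"
      "\<And>n t h. 0 < h \<Longrightarrow> ennreal (c * h) < (\<integral>\<^sup>+s\<in>{t..t + h}. G n s \<partial>lborel) \<Longrightarrow> t \<in> U n"
      by metis
    have "(\<lambda>n. ennreal (5 * I n / c)) \<longlonglongrightarrow> ennreal (5 * 0 / c)"
      using c by (intro tendsto_ennrealI tendsto_intros I(2)) auto
    moreover have "emeasure lborel (\<Inter>n. U n) \<le> ennreal (5 * I n / c)" for n
      by (rule order_trans[OF emeasure_mono[OF _ U(1)] U(2)]) auto
    ultimately have "emeasure lborel (\<Inter>n. U n) \<le> ennreal 0"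
      by (intro LIMSEQ_le_const) auto
    then have "(\<Inter>n. U n) \<in> null_sets lborel"
      using U(1) by (intro null_setsI sets.countable_INT'') auto
    then show ?thesis
      by (rule AE_I') (use U(3) in \<open>force simp: not_le\<close>)
  qed
  have "AE t in lborel. \<forall>p. \<exists>n. \<forall>h>0. (\<integral>\<^sup>+s\<in>{t..t + h}. G n s \<partial>lborel) \<le> ennreal (inverse (real (Suc p)) * h)"
    unfolding AE_all_countable by (intro allI *) simp
  then show ?thesis
  proof eventually_elim
    case (elim t)
    show ?case
    proof (intro allI impI)
      fix c :: real assume "0 < c"
      then obtain p where p: "inverse (real (Suc p)) < c" using reals_Archimedean by blast
      obtain n where n: "\<And>h. h > 0 \<Longrightarrow> (\<integral>\<^sup>+s\<in>{t..t + h}. G n s \<partial>lborel) \<le> ennreal (inverse (real (Suc p)) * h)"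
        using elim by blast
      have "(\<integral>\<^sup>+s\<in>{t..t + h}. G n s \<partial>lborel) \<le> ennreal (c * h)" if "0 < h" for h
        using p that by (intro order_trans[OF n[OF that]] ennreal_leI mult_right_mono) auto
      then show "\<exists>n. \<forall>h>0. (\<integral>\<^sup>+s\<in>{t..t + h}. G n s \<partial>lborel) \<le> ennreal (c * h)" by blast
    qed
  qed
qed


section \<open>Admissible observation and the \<open>\<Lambda>\<close>-extension\<close>

lemma Lambda_ext_tendsto:
  "x \<in> Lambda_dom A C \<Longrightarrow> ((\<lambda>\<mu>::real. \<mu> *\<^sub>R C (resolvent A (of_real \<mu>) x)) \<longlongrightarrow> Lambda_ext A C x) at_top"
  unfolding Lambda_dom_def Lambda_ext_def by (auto simp: tendsto_Lim)

lemma Lambda_extI: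
  "((\<lambda>\<mu>::real. \<mu> *\<^sub>R C (resolvent A (of_real \<mu>) x)) \<longlongrightarrow> y) at_top
    \<Longrightarrow> x \<in> Lambda_dom A C \<and> Lambda_ext A C x = y"
  unfolding Lambda_dom_def Lambda_ext_def by (auto simp: tendsto_Lim)

locale observed_semigroup = bounded_semigroup A T M
  for A :: "'a::complex_banach \<rightharpoonup> 'a" and T M +
  fixes \<alpha> :: complex and C :: "'a \<Rightarrow> 'y::complex_banach"
  assumes \<alpha>: "\<alpha> \<in> resolvent_set A" and observation: "admissible_observation A T \<alpha> C"
begin

text \<open>The observation is meaningful only on \<open>dom A\<close>, where it equals this bounded
  operator applied to \<open>\<alpha> *\<^sub>C y - z\<close> for \<open>A y = Some z\<close>.
  Continuity, measurability and Laplace estimates of outputs are obtained through it.\<close>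

definition CR :: "'a \<Rightarrow> 'y" where "CR x = C (resolvent A \<alpha> x)"

lemma C_bounded_X1: "bounded_clinear_X1 A \<alpha> C"
  using observation by (simp add: admissible_observation_def)

lemma CR_linear: "bounded_linear CR"
proof -
  note R = resolvent_set_resolvent[OF \<alpha>]
  note R_simps = linear_simps[OF bounded_clinear_imp_bounded_linear[OF R(1)]]
  have dom: "resolvent A \<alpha> x \<in> dom A" for x using R(2) by blast
  obtain N where N: "\<And>x. x \<in> dom A \<Longrightarrow> norm (C x) \<le> N * norm (\<alpha> *\<^sub>C x - the (A x))"
    using C_bounded_X1 unfolding bounded_clinear_X1_def by metis
  show ?thesis
  proof (rule bounded_linear_intro[where K = N])
    show "CR (x + y) = CR x + CR y" for x y
      using C_bounded_X1 dom by (simp add: CR_def R_simps bounded_clinear_X1_def)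
    show "CR (r *\<^sub>R x) = r *\<^sub>R CR x" for r x
      using C_bounded_X1 dom
      by (simp add: CR_def bounded_clinear_scaleC[OF R(1)] bounded_clinear_X1_def flip: scaleC_of_real)
    show "norm (CR x) \<le> norm x * N" for x
      using N[OF dom[of x]] R(2)[of x] by (simp add: CR_def mult.commute)
  qed
qed

lemmas CR_simps = linear_simps[OF CR_linear]

lemma C_eq: "A y = Some z \<Longrightarrow> C y = CR (\<alpha> *\<^sub>C y - z)"
  using resolvent_set_resolvent(3)[OF \<alpha>, of y "\<alpha> *\<^sub>C y - z"] by (simp add: CR_def)

lemma C_T: "0 \<le> t \<Longrightarrow> A y = Some z \<Longrightarrow> C (T t y) = CR (T t (\<alpha> *\<^sub>C y - z))"
  using C_eq[OF domain_invariant] by (simp add: T_simps bounded_clinear_scaleC[OF T_clinear])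

lemma C_diff: "x \<in> dom A \<Longrightarrow> y \<in> dom A \<Longrightarrow> x - y \<in> dom A \<and> C (x - y) = C x - C y"
proof -
  assume "x \<in> dom A" "y \<in> dom A"
  then obtain x' y' where x: "A x = Some x'" and y: "A y = Some y'" by blast
  have xy: "A (x - y) = Some (x' - y')" by (rule generator_linear(2)[OF generates x y])
  show ?thesis
    using xy unfolding C_eq[OF x] C_eq[OF y] C_eq[OF xy]
    by (auto simp: scaleC_right_simps algebra_simps simp flip: CR_simps)
qed

lemma T_in_domain: "0 \<le> t \<Longrightarrow> y \<in> dom A \<Longrightarrow> T t y \<in> dom A"
  using domain_invariant by blast

lemma C_resolvent_linear:
  assumes l: "0 < l"
  shows "bounded_linear (\<lambda>x. C (resolvent A (of_real l) x))"
proof -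
  have "C (resolvent A (of_real l) x) = CR ((\<alpha> - of_real l) *\<^sub>C resolvent A (of_real l) x + x)" for x
    using C_eq[OF laplace_resolvent(2)[OF l, of x]]
    by (simp add: scaleC_diff_left scaleC_of_real algebra_simps)
  moreover have "bounded_linear (\<lambda>x. CR ((\<alpha> - of_real l) *\<^sub>C resolvent A (of_real l) x + x))"
    by (rule bounded_linear_compose[OF CR_linear bounded_linear_add[OF bounded_linear_compose[OF
          bounded_linear_scaleC bounded_clinear_imp_bounded_linear[OF bounded_clinear_resolvent[OF l]]]
          bounded_linear_ident]])
  ultimately show ?thesis by simp
qed

lemma C_resolvent_scaleC:
  "0 < l \<Longrightarrow> C (resolvent A (of_real l) (a *\<^sub>C x)) = a *\<^sub>C C (resolvent A (of_real l) x)"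
  using C_bounded_X1 resolvent_in_domain
  by (simp add: bounded_clinear_scaleC[OF bounded_clinear_resolvent] bounded_clinear_X1_def)

text \<open>The resolvent at \<open>l\<close> commutes with \<alpha> - A on the domain, so the
  observation can be replaced by \<open>CR\<close> and moved inside the Laplace integral.\<close>

lemma C_resolvent_domain:
  assumes l: "0 < l" and y: "A y = Some z"
  shows "C (resolvent A (of_real l) y) = CR (resolvent A (of_real l) (\<alpha> *\<^sub>C y - z))"
proof -
  let ?R = "resolvent A (of_real l)"
  note R_simps = linear_simps[OF bounded_clinear_imp_bounded_linear[OF bounded_clinear_resolvent[OF l]]]
    bounded_clinear_scaleC[OF bounded_clinear_resolvent[OF l]]
  have "?R (l *\<^sub>R y - z) = y" by (rule laplace_resolvent(3)[OF l]) (simp add: y)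
  then have "?R z = l *\<^sub>R ?R y - y" by (simp add: R_simps algebra_simps)
  then show ?thesis
    using C_eq[OF laplace_resolvent(2)[OF l, of y]] by (simp add: R_simps)
qed

lemma C_resolvent_tendsto:
  assumes "y \<in> dom A"
  shows "((\<lambda>l. l *\<^sub>R C (resolvent A (of_real l) y)) \<longlongrightarrow> C y) at_top"
proof -
  obtain z where y: "A y = Some z" using assms by blast
  have "((\<lambda>l. CR (l *\<^sub>R resolvent A (of_real l) (\<alpha> *\<^sub>C y - z))) \<longlongrightarrow> CR (\<alpha> *\<^sub>C y - z)) at_top"
    by (intro bounded_linear.tendsto[OF CR_linear] resolvent_tendsto)
  then show ?thesis
    unfolding C_eq[OF y]
    by (rule Lim_transform_eventually)
      (auto intro!: eventually_mono[OF eventually_gt_at_top[of 0]] simp: C_resolvent_domain[OF _ y] CR_simps)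
qed

text \<open>The indicator removes negative times, where values of \<open>T\<close> carry no
  meaning.\<close>

definition output_norm :: "'a \<Rightarrow> real \<Rightarrow> ennreal" where
  "output_norm y s = ennreal (norm (C (T s y))) * indicator {0..} s"

lemma output_norm_measurable [measurable]:
  assumes "y \<in> dom A"
  shows "output_norm y \<in> borel_measurable borel"
proof -
  obtain z where y: "A y = Some z" using assms by blast
  have "(\<lambda>s. indicator {0..} s *\<^sub>R norm (CR (T s (\<alpha> *\<^sub>C y - z)))) \<in> borel_measurable borel"
    by (intro borel_measurable_continuous_on_indicator continuous_on_norm
        bounded_linear.continuous_on[OF CR_linear] T_continuous) auto
  moreover have "output_norm y = (\<lambda>s. ennreal (indicator {0..} s *\<^sub>R norm (CR (T s (\<alpha> *\<^sub>C y - z)))))"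
    by (auto simp: output_norm_def indicator_def C_T[OF _ y])
  ultimately show ?thesis by simp
qed

lemma output_norm_T: "0 \<le> t \<Longrightarrow> 0 \<le> s \<Longrightarrow> output_norm y (t + s) = output_norm (T t y) s"
  using T_add[of s t y] by (simp add: output_norm_def add.commute)

lemma norm_C_resolvent_le:
  assumes l: "0 < l" and "y \<in> dom A"
  shows "ennreal (norm (C (resolvent A (of_real l) y)))
    \<le> (\<integral>\<^sup>+s\<in>{0..}. ennreal (exp (- (l * s))) * output_norm y s \<partial>lborel)"
proof -
  obtain z where y: "A y = Some z" using assms by blast
  have "ennreal (norm (C (resolvent A (of_real l) y)))
      \<le> (\<integral>\<^sup>+s\<in>{0..}. ennreal (exp (- (l * s)) * norm (CR (T s (\<alpha> *\<^sub>C y - z)))) \<partial>lborel)"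
    unfolding C_resolvent_domain[OF l y] by (rule norm_resolvent_le[OF l CR_linear])
  also have "\<dots> = (\<integral>\<^sup>+s\<in>{0..}. ennreal (exp (- (l * s))) * output_norm y s \<partial>lborel)"
    by (intro nn_integral_cong) (auto simp: output_norm_def indicator_def C_T[OF _ y] ennreal_mult)
  finally show ?thesis .
qed

text \<open>Admissibility bounds the square of the output; the estimates below need its first power,
  with a bound linear in the norm of the initial state.\<close>

lemma output_norm_integral_local:
  "\<exists>\<tau>>0. \<exists>k\<ge>0. \<forall>y\<in>dom A. (\<integral>\<^sup>+s\<in>{0..\<tau>}. output_norm y s \<partial>lborel) \<le> ennreal (k * norm y)"
proof -
  obtain \<tau> N where \<tau>: "0 < \<tau>" and N: "\<And>x. x \<in> dom A \<Longrightarrow>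
      (\<integral>\<^sup>+t\<in>{0..\<tau>}. ennreal ((norm (C (T t x)))\<^sup>2) \<partial>lebesgue) \<le> ennreal (N * (norm x)\<^sup>2)"
    using observation unfolding admissible_observation_def by blast
  define N' where "N' = max N 0"
  have "(\<integral>\<^sup>+s\<in>{0..\<tau>}. output_norm y s \<partial>lborel) \<le> ennreal ((\<tau> + N') * norm y)" if y: "y \<in> dom A" for y
  proof (cases "y = 0")
    case True
    obtain z where z: "A y = Some z" using y by blast
    have "A 0 = Some (0 *\<^sub>C z)" using generator_linear(3)[OF generates z z, of 0] by (simp add: scaleC_zero_left)
    then have "C 0 = 0" using C_eq[of 0] by (simp add: scaleC_zero_left scaleC_right_simps CR_simps)
    then have "output_norm y = (\<lambda>s. 0)"
      using True linear_simps(3)[OF T_linear] by (auto simp: output_norm_def fun_eq_iff indicator_def)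
    then show ?thesis by simp
  next
    case False
    define n where "n = norm y"
    have n: "0 < n" using False by (simp add: n_def)
    \<comment> \<open>This replaces the Cauchy-Schwarz inequality. With \<open>n = norm y\<close>
      both terms integrate to multiples of \<open>norm y\<close>; the division explains the separate
      case \<open>y = 0\<close>.\<close>
    have "a \<le> n + inverse n * a\<^sup>2" if "0 \<le> a" for a
    proof (cases "a \<le> n")
      case True
      then show ?thesis using n by (simp add: add_increasing2)
    next
      case False
      then have "n * a \<le> a * a" using that by (intro mult_right_mono) auto
      then have "a \<le> inverse n * a\<^sup>2" using n by (simp add: field_simps power2_eq_square)
      then show ?thesis using n by simp
    qed
    then have le: "output_norm y s * indicator {0..\<tau>} s
        \<le> ennreal n * indicator {0..\<tau>} s + ennreal (inverse n) * (ennreal ((norm (C (T s y)))\<^sup>2) * indicator {0..\<tau>} s)" for s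
      using n by (auto simp: output_norm_def indicator_def simp flip: ennreal_mult ennreal_plus intro!: ennreal_leI)
    obtain z where z: "A y = Some z" using y by blast
    have [measurable]: "(\<lambda>s. ennreal ((norm (C (T s y)))\<^sup>2) * indicator {0..\<tau>} s) \<in> borel_measurable borel"
    proof -
      have "(\<lambda>s. indicator {0..\<tau>} s *\<^sub>R (norm (CR (T s (\<alpha> *\<^sub>C y - z))))\<^sup>2) \<in> borel_measurable borel"
        by (intro borel_measurable_continuous_on_indicator continuous_intros
            bounded_linear.continuous_on[OF CR_linear] continuous_on_subset[OF T_continuous]) auto
      moreover have "(\<lambda>s. ennreal ((norm (C (T s y)))\<^sup>2) * indicator {0..\<tau>} s)
          = (\<lambda>s. ennreal (indicator {0..\<tau>} s *\<^sub>R (norm (CR (T s (\<alpha> *\<^sub>C y - z))))\<^sup>2))"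
        by (auto simp: indicator_def C_T[OF _ z])
      ultimately show ?thesis by simp
    qed
    have "(\<integral>\<^sup>+s\<in>{0..\<tau>}. output_norm y s \<partial>lborel)
        \<le> (\<integral>\<^sup>+s. ennreal n * indicator {0..\<tau>} s + ennreal (inverse n) * (ennreal ((norm (C (T s y)))\<^sup>2) * indicator {0..\<tau>} s) \<partial>lborel)"
      by (intro nn_integral_mono le)
    also have "\<dots> = ennreal n * ennreal \<tau> + ennreal (inverse n) * (\<integral>\<^sup>+s\<in>{0..\<tau>}. ennreal ((norm (C (T s y)))\<^sup>2) \<partial>lborel)"
      using \<tau> by (subst nn_integral_add) (auto simp: nn_integral_cmult nn_integral_cmult_indicator)
    also have "\<dots> \<le> ennreal n * ennreal \<tau> + ennreal (inverse n) * ennreal (N' * n\<^sup>2)"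
      using order_trans[OF N[OF y] ennreal_leI, of "N' * n\<^sup>2"]
      by (intro add_left_mono mult_left_mono) (auto simp: nn_integral_completion N'_def n_def mult_right_mono)
    also have "\<dots> = ennreal ((\<tau> + N') * n)"
      using n \<tau> by (simp add: N'_def power2_eq_square field_simps flip: ennreal_mult ennreal_plus)
    finally show ?thesis by (simp add: n_def)
  qed
  then show ?thesis using \<tau> by (intro exI[of _ \<tau>] exI[of _ "\<tau> + N'"] conjI) (auto simp: N'_def)
qed

text \<open>The half-line is cut into intervals of length \<tau>. On the \<open>n\<close>-th the
  weight is at most \<open>q ^ n\<close>, and the local estimate applies to
  \<open>T (n * \<tau>) y\<close>, whose norm is at most \<open>M * norm y\<close>; a geometric
  series remains.\<close>

lemma output_norm_integral:
  "\<exists>k\<ge>0. \<forall>y\<in>dom A. (\<integral>\<^sup>+s. ennreal (exp (- s)) * output_norm y s \<partial>lborel) \<le> ennreal (k * norm y)"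
proof -
  obtain \<tau> k where \<tau>: "0 < \<tau>" and k: "0 \<le> k"
    and local: "\<And>y. y \<in> dom A \<Longrightarrow> (\<integral>\<^sup>+s\<in>{0..\<tau>}. output_norm y s \<partial>lborel) \<le> ennreal (k * norm y)"
    using output_norm_integral_local by blast
  define q where "q = exp (- \<tau>)"
  have q: "0 < q" "q < 1" using \<tau> by (auto simp: q_def)
  have "(\<integral>\<^sup>+s. ennreal (exp (- s)) * output_norm y s \<partial>lborel) \<le> ennreal (k * M / (1 - q) * norm y)"
    if y: "y \<in> dom A" for y
  proof -
    note [measurable] = output_norm_measurable[OF y]
    let ?I = "\<lambda>n::nat. {n * \<tau>..n * \<tau> + \<tau>}"
    let ?g = "\<lambda>n s. ennreal (exp (- s)) * output_norm y s * indicator (?I n) s"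
    have piece: "(\<integral>\<^sup>+s. ?g n s \<partial>lborel) \<le> ennreal (k * M * norm y * q ^ n)" for n :: nat
    proof -
      have n: "0 \<le> n * \<tau>" using \<tau> by simp
      have "(\<integral>\<^sup>+s. ?g n s \<partial>lborel) = (\<integral>\<^sup>+s. ?g n (n * \<tau> + 1 * s) \<partial>lborel)"
        by (subst nn_integral_real_affine[where t = "n * \<tau>" and c = 1]) auto
      also have "\<dots> \<le> (\<integral>\<^sup>+s. ennreal (q ^ n) * (output_norm (T (n * \<tau>) y) s * indicator {0..\<tau>} s) \<partial>lborel)"
      proof (rule nn_integral_mono)
        fix s :: real
        show "?g n (n * \<tau> + 1 * s) \<le> ennreal (q ^ n) * (output_norm (T (n * \<tau>) y) s * indicator {0..\<tau>} s)"
        proof (cases "s \<in> {0..\<tau>}")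
          case True
          have "exp (- (n * \<tau> + s)) \<le> exp (- (n * \<tau>))" using True by simp
          also have "\<dots> = q ^ n" by (simp add: q_def flip: exp_of_nat_mult)
          finally show ?thesis
            using True n by (auto simp: output_norm_T mult.assoc intro!: mult_right_mono ennreal_leI)
        next
          case False
          then show ?thesis by (auto simp: indicator_def)
        qed
      qed
      also have "\<dots> = ennreal (q ^ n) * (\<integral>\<^sup>+s\<in>{0..\<tau>}. output_norm (T (n * \<tau>) y) s \<partial>lborel)"
        using output_norm_measurable[OF T_in_domain[OF n y]] by (intro nn_integral_cmult) simp
      also have "\<dots> \<le> ennreal (q ^ n) * ennreal (k * (M * norm y))"
        using k by (intro mult_left_mono order_trans[OF local[OF T_in_domain[OF n y]]] ennreal_leI
            bound n) auto
      also have "\<dots> = ennreal (k * M * norm y * q ^ n)"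
        using k q M_nonneg by (simp add: mult_ac flip: ennreal_mult)
      finally show ?thesis .
    qed
    \<comment> \<open>The closed intervals share endpoints, hence an inequality rather than an
      equality.\<close>
    have cover: "ennreal (exp (- s)) * output_norm y s \<le> (\<Sum>n. ?g n s)" for s
    proof (cases "0 \<le> s")
      case True
      define n where "n = nat \<lfloor>s / \<tau>\<rfloor>"
      have "real n = of_int \<lfloor>s / \<tau>\<rfloor>" using True \<tau> by (simp add: n_def)
      then have "real n \<le> s / \<tau>" "s / \<tau> < real n + 1" by linarith+
      then have "s \<in> ?I n" using \<tau> by (simp add: field_simps)
      then have "ennreal (exp (- s)) * output_norm y s = ?g n s" by simp
      also have "\<dots> = (\<Sum>m\<in>{n}. ?g m s)" by (subst sum.insert) simp_all
      also have "\<dots> \<le> (\<Sum>n. ?g n s)" by (intro sum_le_suminf) auto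
      finally show ?thesis .
    qed (simp add: output_norm_def)
    have "(\<integral>\<^sup>+s. ennreal (exp (- s)) * output_norm y s \<partial>lborel) \<le> (\<integral>\<^sup>+s. (\<Sum>n. ?g n s) \<partial>lborel)"
      by (intro nn_integral_mono cover)
    also have "\<dots> = (\<Sum>n. \<integral>\<^sup>+s. ?g n s \<partial>lborel)"
      by (rule nn_integral_suminf) measurable
    also have "\<dots> \<le> (\<Sum>n. ennreal (k * M * norm y * q ^ n))"
      by (intro suminf_le piece) auto
    also have "\<dots> = ennreal (k * M * norm y * (1 / (1 - q)))"
      using k M_nonneg q by (intro suminf_ennreal_eq sums_mult geometric_sums) auto
    finally show ?thesis by (simp add: field_simps)
  qed
  moreover have "0 \<le> k * M / (1 - q)" using k M_nonneg q by simp
  ultimately show ?thesis by blast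
qed

text \<open>For fixed \<open>l\<close> the map \<open>C (resolvent A (of_real l) (T t z))\<close> is
  bounded in \<open>z\<close>, so its norm at the sum \<open>w\<close> is at most the sum over the
  increments. Each of these is a Laplace integral of an output, and small averages control all of
  them at once, uniformly in \<open>l\<close>.\<close>

lemma norm_C_resolvent_tail_le:
  assumes d: "\<And>m. d m \<in> dom A" and sums: "d sums w" and t: "0 \<le> t" and c: "0 \<le> c" and l: "2 \<le> l"
    and avg: "\<And>h. 0 < h \<Longrightarrow>
      (\<integral>\<^sup>+s\<in>{t..t + h}. (\<Sum>m. ennreal (exp (- s)) * output_norm (d m) s) \<partial>lborel) \<le> ennreal (c * h)"
  shows "norm (l *\<^sub>R C (resolvent A (of_real l) (T t w))) \<le> 2 * exp t * c"
proof -
  note [measurable] = output_norm_measurable[OF d]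
  let ?F = "\<lambda>z. C (resolvent A (of_real l) (T t z))"
  let ?G = "\<lambda>s. \<Sum>m. ennreal (exp (- s)) * output_norm (d m) s"
  have l0: "0 < l" "0 < l - 1" using l by auto
  have F: "bounded_linear ?F"
    by (rule bounded_linear_compose[OF C_resolvent_linear[OF l0(1)] T_linear[OF t]])
  have F_d: "ennreal (norm (?F (d m)))
      \<le> (\<integral>\<^sup>+s\<in>{0..}. ennreal (exp (- (l * s))) * output_norm (d m) (t + s) \<partial>lborel)" for m
  proof -
    have "ennreal (norm (?F (d m))) \<le> (\<integral>\<^sup>+s\<in>{0..}. ennreal (exp (- (l * s))) * output_norm (T t (d m)) s \<partial>lborel)"
      by (rule norm_C_resolvent_le[OF l0(1) T_in_domain[OF t d]])
    also have "\<dots> = (\<integral>\<^sup>+s\<in>{0..}. ennreal (exp (- (l * s))) * output_norm (d m) (t + s) \<partial>lborel)"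
      by (intro nn_integral_cong) (auto simp: indicator_def output_norm_T t)
    finally show ?thesis .
  qed
  have "ennreal (norm (?F w)) \<le> (\<Sum>m. ennreal (norm (?F (d m))))"
  proof (rule LIMSEQ_le_const2)
    show "(\<lambda>n. ennreal (norm (\<Sum>m<n. ?F (d m)))) \<longlonglongrightarrow> ennreal (norm (?F w))"
      using bounded_linear.sums[OF F sums] by (intro tendsto_ennrealI tendsto_norm) (simp add: sums_def)
    have "ennreal (norm (\<Sum>m<n. ?F (d m))) \<le> (\<Sum>m. ennreal (norm (?F (d m))))" for n
    proof -
      have "ennreal (norm (\<Sum>m<n. ?F (d m))) \<le> (\<Sum>m<n. ennreal (norm (?F (d m))))"
        by (simp add: norm_sum ennreal_leI)
      also have "\<dots> \<le> (\<Sum>m. ennreal (norm (?F (d m))))" by (intro sum_le_suminf) auto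
      finally show ?thesis .
    qed
    then show "\<exists>N. \<forall>n\<ge>N. ennreal (norm (\<Sum>m<n. ?F (d m))) \<le> (\<Sum>m. ennreal (norm (?F (d m))))" by blast
  qed
  also have "\<dots> \<le> (\<Sum>m. \<integral>\<^sup>+s\<in>{0..}. ennreal (exp (- (l * s))) * output_norm (d m) (t + s) \<partial>lborel)"
    by (intro suminf_le F_d) auto
  also have "\<dots> = (\<integral>\<^sup>+s. (\<Sum>m. ennreal (exp (- (l * s))) * output_norm (d m) (t + s) * indicator {0..} s) \<partial>lborel)"
    by (rule nn_integral_suminf[symmetric]) measurable
  also have "\<dots> = (\<integral>\<^sup>+s. ennreal (exp t) * (ennreal (exp (- ((l - 1) * s))) * ?G (t + s) * indicator {0..} s) \<partial>lborel)"
  proof (rule nn_integral_cong)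
    fix s :: real
    \<comment> \<open>One unit of decay, evaluated at the shifted time \<open>t + s\<close>, is
      moved into the weight of the averaged function; the rate \<open>l - 1\<close> remains, at the
      price of the factor \<open>exp t\<close>.\<close>
    have "exp (- (l * s)) = exp t * exp (- ((l - 1) * s)) * exp (- (t + s))"
      by (simp add: algebra_simps flip: exp_add)
    then have "ennreal (exp (- (l * s))) = ennreal (exp t) * ennreal (exp (- ((l - 1) * s))) * ennreal (exp (- (t + s)))"
      by (simp flip: ennreal_mult)
    then show "(\<Sum>m. ennreal (exp (- (l * s))) * output_norm (d m) (t + s) * indicator {0..} s)
        = ennreal (exp t) * (ennreal (exp (- ((l - 1) * s))) * ?G (t + s) * indicator {0..} s)"
      by (simp add: mult.assoc indicator_def ennreal_suminf_cmult)
  qed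
  also have "\<dots> = ennreal (exp t) * (\<integral>\<^sup>+s\<in>{0..}. ennreal (exp (- ((l - 1) * s))) * ?G (t + s) \<partial>lborel)"
    by (rule nn_integral_cmult) measurable
  also have "\<dots> \<le> ennreal (exp t) * ennreal (c / (l - 1))"
    by (intro mult_left_mono exp_average_le avg l0 c) measurable
  also have "\<dots> = ennreal (exp t * (c / (l - 1)))" using c l0 by (simp flip: ennreal_mult)
  finally have "norm (?F w) \<le> exp t * (c / (l - 1))"
    using c l0 by (simp add: ennreal_le_iff)
  then have "l * norm (?F w) \<le> l * (exp t * (c / (l - 1)))" using l0 by (intro mult_left_mono) auto
  also have "\<dots> = (l / (l - 1)) * (exp t * c)" by simp
  \<comment> \<open>The assumption \<open>2 \<le> l\<close> bounds \<open>l / (l - 1)\<close> by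
    2.\<close>
  also have "\<dots> \<le> 2 * (exp t * c)"
    using l c by (intro mult_right_mono) (auto simp: field_simps)
  finally show ?thesis using l0 by simp
qed

text \<open>Distances below 2 to the power -(n + 2) leave room for the triangle inequality between
  neighbours.\<close>

lemma domain_approximation:
  obtains X where "\<And>n. X n \<in> dom A" "X \<longlonglongrightarrow> x" "\<And>n. norm (X (Suc n) - X n) \<le> (1/2) ^ n"
proof -
  have "x \<in> closure (dom A)" using closure_domain by simp
  then have "\<forall>n. \<exists>y\<in>dom A. dist y x < (1/2) ^ Suc (Suc n)"
    unfolding closure_approachable by (meson zero_less_power half_gt_zero_iff zero_less_one)
  then obtain X where X: "\<And>n. X n \<in> dom A" "\<And>n. dist (X n) x < (1/2) ^ Suc (Suc n)" by metis
  have "norm (X (Suc n) - X n) \<le> (1/2) ^ n" for n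
  proof -
    have "dist (X (Suc n)) (X n) \<le> dist (X (Suc n)) x + dist (X n) x" by (rule dist_triangle2)
    also have "\<dots> \<le> (1/2) ^ Suc (Suc (Suc n)) + (1/2) ^ Suc (Suc n)"
      by (intro add_mono less_imp_le X(2))
    also have "\<dots> \<le> (1/2) ^ n" by simp
    finally show ?thesis by (simp add: dist_norm)
  qed
  moreover have "X \<longlonglongrightarrow> x"
  proof (rule metric_tendsto_imp_tendsto)
    show "(\<lambda>n. (1/2::real) ^ Suc (Suc n)) \<longlonglongrightarrow> 0" by real_asymp
    show "\<forall>\<^sub>F n in sequentially. dist (X n) x \<le> dist ((1/2::real) ^ Suc (Suc n)) 0"
      using X(2) by (auto simp: dist_real_def intro!: always_eventually less_imp_le)
  qed
  ultimately show ?thesis using that X(1) by blast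
qed

text \<open>The integrals of the tails \<open>G n\<close> tend to 0, so for almost every
  \<open>t\<close> their averages from \<open>t\<close> onwards become arbitrarily small. For such
  \<open>t\<close> the approximants converge uniformly in \<open>l \<ge> 2\<close>, and the limits
  in \<open>l\<close> and in \<open>n\<close> may be exchanged.\<close>

lemma AE_Lambda_dom:
  assumes X: "\<And>n. X n \<in> dom A" and lim: "X \<longlonglongrightarrow> x" and fast: "\<And>n. norm (X (Suc n) - X n) \<le> (1/2) ^ n"
  shows "AE t in lborel. 0 \<le> t \<longrightarrow> T t x \<in> Lambda_dom A C \<and> (\<lambda>n. C (T t (X n))) \<longlonglongrightarrow> Lambda_ext A C (T t x)"
proof -
  obtain k where k: "0 \<le> k"
    and int: "\<And>y. y \<in> dom A \<Longrightarrow> (\<integral>\<^sup>+s. ennreal (exp (- s)) * output_norm y s \<partial>lborel) \<le> ennreal (k * norm y)"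
    using output_norm_integral by blast
  define d where "d n = X (Suc n) - X n" for n
  have d: "d n \<in> dom A" for n using C_diff X by (simp add: d_def)
  note [measurable] = output_norm_measurable[OF d]
  define G where "G n s = (\<Sum>m. ennreal (exp (- s)) * output_norm (d (m + n)) s)" for n s
  have G_measurable: "G n \<in> borel_measurable borel" for n unfolding G_def by measurable
  have G_int: "(\<integral>\<^sup>+s. G n s \<partial>lborel) \<le> ennreal (2 * k * (1/2) ^ n)" for n
  proof -
    have "(\<integral>\<^sup>+s. G n s \<partial>lborel) = (\<Sum>m. \<integral>\<^sup>+s. ennreal (exp (- s)) * output_norm (d (m + n)) s \<partial>lborel)"
      unfolding G_def by (rule nn_integral_suminf) measurable
    also have "\<dots> \<le> (\<Sum>m. ennreal (k * (1/2) ^ n * (1/2) ^ m))"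
    proof (intro suminf_le)
      fix m
      have "k * norm (d (m + n)) \<le> k * (1/2) ^ (m + n)"
        using fast k by (intro mult_left_mono) (auto simp: d_def)
      then have "ennreal (k * norm (d (m + n))) \<le> ennreal (k * (1/2) ^ n * (1/2) ^ m)"
        by (intro ennreal_leI) (simp add: power_add mult_ac)
      then show "(\<integral>\<^sup>+s. ennreal (exp (- s)) * output_norm (d (m + n)) s \<partial>lborel) \<le> ennreal (k * (1/2) ^ n * (1/2) ^ m)"
        using int[OF d] order_trans by blast
    qed auto
    also have "\<dots> = ennreal (k * (1/2) ^ n * (1 / (1 - 1/2)))"
      using k by (intro suminf_ennreal_eq sums_mult geometric_sums) auto
    finally show ?thesis by (simp add: mult_ac)
  qed
  have "(\<lambda>n. 2 * k * (1/2) ^ n) \<longlonglongrightarrow> 2 * k * 0"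
    by (intro tendsto_mult tendsto_const LIMSEQ_power_zero) auto
  then have "AE t in lborel. \<forall>c>0. \<exists>n. \<forall>h>0. (\<integral>\<^sup>+s\<in>{t..t + h}. G n s \<partial>lborel) \<le> ennreal (c * h)"
    using k by (intro AE_small_averages[OF G_measurable G_int]) auto
  then show ?thesis
  proof eventually_elim
    case (elim t)
    show ?case
    proof
      assume t: "0 \<le> t"
      define f where "f n l = l *\<^sub>R C (resolvent A (of_real l) (T t (X n)))" for n l
      define f' where "f' l = l *\<^sub>R C (resolvent A (of_real l) (T t x))" for l
      have tail: "\<exists>n. \<forall>m\<ge>n. \<forall>l\<ge>2. norm (f' l - f m l) \<le> e" if e: "0 < e" for e
      proof -
        \<comment> \<open>This cancels the constant \<open>2 * exp t\<close> of the tail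
          estimate.\<close>
        define c where "c = e / (2 * exp t)"
        have c: "0 < c" using e by (simp add: c_def)
        then obtain n where n: "\<And>h. 0 < h \<Longrightarrow> (\<integral>\<^sup>+s\<in>{t..t + h}. G n s \<partial>lborel) \<le> ennreal (c * h)"
          using elim by blast
        have "norm (f' l - f m l) \<le> e" if m: "n \<le> m" and l: "2 \<le> l" for m l
        proof -
          have l0: "0 < l" using l by simp
          \<comment> \<open>Small averages are known for a single index \<open>n\<close>; the tails
            decrease, so every later index inherits them.\<close>
          have G_le: "G m s \<le> G n s" for s
          proof -
            have "G m s = (\<Sum>p. ennreal (exp (- s)) * output_norm (d ((p + (m - n)) + n)) s)"
              using m by (simp add: G_def add.assoc)
            also have "\<dots> \<le> G n s"
              unfolding G_def
              using suminf_offset[of "\<lambda>p. ennreal (exp (- s)) * output_norm (d (p + n)) s" "m - n"]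
              by simp
            finally show ?thesis .
          qed
          have "(\<lambda>p. X (Suc (p + m)) - X (p + m)) sums (x - X (0 + m))"
            using telescope_sums[OF LIMSEQ_ignore_initial_segment[OF lim, of m]] by simp
          then have "(\<lambda>p. d (p + m)) sums (x - X m)" by (simp add: d_def)
          then have "norm (l *\<^sub>R C (resolvent A (of_real l) (T t (x - X m)))) \<le> 2 * exp t * c"
          proof (rule norm_C_resolvent_tail_le[OF d _ t _ l])
            show "0 \<le> c" using c by simp
            fix h :: real assume "0 < h"
            then show "(\<integral>\<^sup>+s\<in>{t..t + h}. (\<Sum>p. ennreal (exp (- s)) * output_norm (d (p + m)) s) \<partial>lborel) \<le> ennreal (c * h)"
              using G_le[unfolded G_def] n unfolding G_def
              by (rule_tac order_trans[OF nn_integral_mono n[unfolded G_def]]) (auto intro!: mult_right_mono)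
          qed
          also have "l *\<^sub>R C (resolvent A (of_real l) (T t (x - X m))) = f' l - f m l"
            by (simp add: f_def f'_def T_simps t linear_simps[OF C_resolvent_linear[OF l0]] scaleR_diff_right)
          finally show ?thesis by (simp add: c_def)
        qed
        then show ?thesis by blast
      qed
      have f_lim: "(f m \<longlongrightarrow> C (T t (X m))) at_top" for m
        unfolding f_def by (rule C_resolvent_tendsto[OF T_in_domain[OF t X]])
      have unif: "uniform_limit {2..} f f' sequentially"
      proof (rule uniform_limitI)
        fix e :: real assume "0 < e"
        then obtain n where n: "\<And>m l. n \<le> m \<Longrightarrow> 2 \<le> l \<Longrightarrow> norm (f' l - f m l) \<le> e / 2"
          using tail[of "e / 2"] by auto
        have "dist (f m l) (f' l) < e" if "n \<le> m" "2 \<le> l" for m l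
          using n[OF that] \<open>0 < e\<close> by (simp add: dist_norm norm_minus_commute)
        then show "\<forall>\<^sub>F m in sequentially. \<forall>l\<in>{2..}. dist (f m l) (f' l) < e"
          by (auto simp: eventually_sequentially)
      qed
      have "Cauchy (\<lambda>m. C (T t (X m)))"
      proof (rule metric_CauchyI)
        fix e :: real assume e: "0 < e"
        then obtain n where n: "\<And>m l. n \<le> m \<Longrightarrow> 2 \<le> l \<Longrightarrow> norm (f' l - f m l) \<le> e / 4"
          using tail[of "e / 4"] by auto
        have "dist (C (T t (X p))) (C (T t (X m))) < e" if pm: "n \<le> p" "n \<le> m" for p m
        proof -
          have "dist (f p l) (f m l) \<le> e / 2" if "2 \<le> l" for l
            using norm_triangle_ineq4[of "f' l - f m l" "f' l - f p l"] n[OF pm(1) that] n[OF pm(2) that]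
            by (simp add: dist_norm)
          then have "\<forall>\<^sub>F l in at_top. dist (f p l) (f m l) \<le> e / 2"
            by (auto intro: eventually_mono[OF eventually_ge_at_top[of 2]])
          then have "dist (C (T t (X p))) (C (T t (X m))) \<le> e / 2"
            by (rule tendsto_upperbound[OF tendsto_dist[OF f_lim f_lim]]) simp
          then show ?thesis using e by simp
        qed
        then show "\<exists>M. \<forall>m\<ge>M. \<forall>n\<ge>M. dist (C (T t (X m))) (C (T t (X n))) < e" by blast
      qed
      then obtain y where y: "(\<lambda>m. C (T t (X m))) \<longlonglongrightarrow> y"
        by (auto simp: Cauchy_convergent_iff convergent_def)
      \<comment> \<open>Uniformity in \<open>l\<close> together with the limits \<open>f_lim\<close>
        justifies the exchange; the existence of the limit of \<open>f'\<close> is what membership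
        in \<open>Lambda_dom A C\<close> means.\<close>
      have "(f' \<longlongrightarrow> y) at_top"
        by (rule swap_uniform_limit'[OF _ y unif]) (auto simp: f_lim)
      then have "T t x \<in> Lambda_dom A C \<and> Lambda_ext A C (T t x) = y"
        unfolding f'_def by (rule Lambda_extI)
      then show "T t x \<in> Lambda_dom A C \<and> (\<lambda>n. C (T t (X n))) \<longlonglongrightarrow> Lambda_ext A C (T t x)"
        using y by simp
    qed
  qed
qed

lemma AE_T_in_Lambda_dom: "AE t in lborel. 0 \<le> t \<longrightarrow> T t x \<in> Lambda_dom A C"
proof -
  obtain X where "\<And>n. X n \<in> dom A" "X \<longlonglongrightarrow> x" "\<And>n. norm (X (Suc n) - X n) \<le> (1/2) ^ n"
    by (rule domain_approximation[where x = x]) blast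
  from AE_Lambda_dom[OF this] show ?thesis by eventually_elim blast
qed

text \<open>On the domain the weight exp(-s) is at least exp(-1) over a unit interval, whence the
  factor \<open>exp 1\<close>; Fatou's lemma along the almost everywhere convergent outputs reaches
  all states. The bound involves \<open>T t x\<close> rather than \<open>x\<close>, and so tends to
  0 under strong stability.\<close>

lemma Lambda_ext_integral_le:
  "\<exists>k\<ge>0. \<forall>x. \<forall>t\<ge>0. (\<integral>\<^sup>+s\<in>{t..t + 1}. ennreal (norm (Lambda_ext A C (T s x))) \<partial>lborel) \<le> ennreal (k * norm (T t x))"
proof -
  obtain k where k: "0 \<le> k"
    and int: "\<And>y. y \<in> dom A \<Longrightarrow> (\<integral>\<^sup>+s. ennreal (exp (- s)) * output_norm y s \<partial>lborel) \<le> ennreal (k * norm y)"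
    using output_norm_integral by blast
  have domain: "(\<integral>\<^sup>+s\<in>{t..t + 1}. output_norm y s \<partial>lborel) \<le> ennreal (exp 1 * k * norm (T t y))"
    if y: "y \<in> dom A" and t: "0 \<le> t" for y t
  proof -
    note [measurable] = output_norm_measurable[OF y] output_norm_measurable[OF T_in_domain[OF t y]]
    have "(\<integral>\<^sup>+s\<in>{t..t + 1}. output_norm y s \<partial>lborel)
        = (\<integral>\<^sup>+s. output_norm y (t + 1 * s) * indicator {t..t + 1} (t + 1 * s) \<partial>lborel)"
      by (subst nn_integral_real_affine[where t = t and c = 1]) auto
    also have "\<dots> \<le> (\<integral>\<^sup>+s. ennreal (exp 1) * (ennreal (exp (- s)) * output_norm (T t y) s) \<partial>lborel)"
    proof (rule nn_integral_mono)
      fix s :: real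
      show "output_norm y (t + 1 * s) * indicator {t..t + 1} (t + 1 * s)
          \<le> ennreal (exp 1) * (ennreal (exp (- s)) * output_norm (T t y) s)"
      proof (cases "s \<in> {0..1}")
        case True
        have "1 \<le> exp 1 * exp (- s)" using True by (simp flip: exp_add)
        then have "1 \<le> ennreal (exp 1 * exp (- s))" by (metis ennreal_1 ennreal_leI)
        then have "1 * output_norm (T t y) s \<le> ennreal (exp 1 * exp (- s)) * output_norm (T t y) s"
          by (intro mult_right_mono) auto
        then show ?thesis using True t by (simp add: output_norm_T ennreal_mult mult.assoc)
      qed (auto simp: indicator_def)
    qed
    also have "\<dots> = ennreal (exp 1) * (\<integral>\<^sup>+s. ennreal (exp (- s)) * output_norm (T t y) s \<partial>lborel)"
      by (rule nn_integral_cmult) measurable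
    also have "\<dots> \<le> ennreal (exp 1) * ennreal (k * norm (T t y))"
      by (intro mult_left_mono int T_in_domain t y) simp
    also have "\<dots> = ennreal (exp 1 * k * norm (T t y))"
      using k by (simp add: mult.assoc flip: ennreal_mult)
    finally show ?thesis .
  qed
  have "(\<integral>\<^sup>+s\<in>{t..t + 1}. ennreal (norm (Lambda_ext A C (T s x))) \<partial>lborel) \<le> ennreal (exp 1 * k * norm (T t x))"
    if t: "0 \<le> t" for x t
  proof -
    obtain X where X: "\<And>n. X n \<in> dom A" "X \<longlonglongrightarrow> x" "\<And>n. norm (X (Suc n) - X n) \<le> (1/2) ^ n"
      by (rule domain_approximation[where x = x]) blast
    note [measurable] = output_norm_measurable[OF X(1)]
    have "AE s in lborel. ennreal (norm (Lambda_ext A C (T s x))) * indicator {t..t + 1} s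
        \<le> liminf (\<lambda>n. output_norm (X n) s * indicator {t..t + 1} s)"
      using AE_Lambda_dom[OF X]
    proof eventually_elim
      case (elim s)
      show ?case
      proof (cases "s \<in> {t..t + 1}")
        case True
        then have s: "0 \<le> s" using t by simp
        have "(\<lambda>n. ennreal (norm (C (T s (X n))))) \<longlonglongrightarrow> ennreal (norm (Lambda_ext A C (T s x)))"
          using elim s by (intro tendsto_ennrealI tendsto_norm) simp
        from lim_imp_Liminf[OF _ this] show ?thesis
          using True s by (simp add: output_norm_def)
      qed simp
    qed
    then have "(\<integral>\<^sup>+s\<in>{t..t + 1}. ennreal (norm (Lambda_ext A C (T s x))) \<partial>lborel)
        \<le> (\<integral>\<^sup>+s. liminf (\<lambda>n. output_norm (X n) s * indicator {t..t + 1} s) \<partial>lborel)"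
      by (rule nn_integral_mono_AE)
    also have "\<dots> \<le> liminf (\<lambda>n. \<integral>\<^sup>+s\<in>{t..t + 1}. output_norm (X n) s \<partial>lborel)"
      by (rule nn_integral_liminf) measurable
    also have "\<dots> \<le> liminf (\<lambda>n. ennreal (exp 1 * k * norm (T t (X n))))"
      by (intro Liminf_mono always_eventually allI domain X(1) t)
    also have "\<dots> = ennreal (exp 1 * k * norm (T t x))"
      by (intro lim_imp_Liminf tendsto_ennrealI tendsto_intros bounded_linear.tendsto[OF T_linear[OF t]] X(2)) simp
    finally show ?thesis .
  qed
  moreover have "0 \<le> exp 1 * k" using k by simp
  ultimately show ?thesis by blast
qed

section \<open>Linearity and boundedness of the \<Lambda>-extension\<close>

lemma Lambda_ext_add:
  assumes "x \<in> Lambda_dom A C" "y \<in> Lambda_dom A C"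
  shows "x + y \<in> Lambda_dom A C \<and> Lambda_ext A C (x + y) = Lambda_ext A C x + Lambda_ext A C y"
proof (rule Lambda_extI)
  show "((\<lambda>\<mu>. \<mu> *\<^sub>R C (resolvent A (of_real \<mu>) (x + y))) \<longlongrightarrow> Lambda_ext A C x + Lambda_ext A C y) at_top"
    by (rule Lim_transform_eventually[OF tendsto_add[OF Lambda_ext_tendsto[OF assms(1)] Lambda_ext_tendsto[OF assms(2)]]])
      (auto intro!: eventually_mono[OF eventually_gt_at_top[of 0]]
        simp: linear_simps[OF C_resolvent_linear] scaleR_add_right)
qed

lemma Lambda_ext_scaleC:
  assumes "x \<in> Lambda_dom A C"
  shows "a *\<^sub>C x \<in> Lambda_dom A C \<and> Lambda_ext A C (a *\<^sub>C x) = a *\<^sub>C Lambda_ext A C x"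
proof (rule Lambda_extI)
  show "((\<lambda>\<mu>. \<mu> *\<^sub>R C (resolvent A (of_real \<mu>) (a *\<^sub>C x))) \<longlongrightarrow> a *\<^sub>C Lambda_ext A C x) at_top"
    by (rule Lim_transform_eventually[OF bounded_linear.tendsto[OF bounded_linear_scaleC Lambda_ext_tendsto[OF assms]]])
      (auto intro!: eventually_mono[OF eventually_gt_at_top[of 0]] simp: C_resolvent_scaleC scaleC_right_simps)
qed

lemma bounded_clinear_Lambda_ext:
  fixes \<Sigma> :: "'w::complex_banach \<Rightarrow> 'a"
  assumes \<Sigma>: "bounded_clinear \<Sigma>" and range: "range \<Sigma> \<subseteq> Lambda_dom A C"
  shows "bounded_clinear (\<lambda>v. Lambda_ext A C (\<Sigma> v))"
proof -
  have dom: "\<Sigma> v \<in> Lambda_dom A C" for v using range by blast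
  have "bounded_linear (\<lambda>v. Lambda_ext A C (\<Sigma> v))"
  proof (rule bounded_linear_pointwise_limit)
    fix n :: nat
    \<comment> \<open>The sequence starts at 1 because the operators are known to be bounded only
      for positive parameters.\<close>
    show "bounded_linear (\<lambda>v. real (Suc n) *\<^sub>R C (resolvent A (of_real (real (Suc n))) (\<Sigma> v)))"
      by (rule bounded_linear_const_scaleR[OF bounded_linear_compose[OF C_resolvent_linear
          bounded_clinear_imp_bounded_linear[OF \<Sigma>]]]) simp
  next
    fix v
    have "filterlim (\<lambda>n. real (Suc n)) at_top sequentially" by real_asymp
    from filterlim_compose[OF Lambda_ext_tendsto[OF dom] this]
    show "(\<lambda>n. real (Suc n) *\<^sub>R C (resolvent A (of_real (real (Suc n))) (\<Sigma> v))) \<longlonglongrightarrow> Lambda_ext A C (\<Sigma> v)" .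
  qed
  then show ?thesis
    using Lambda_ext_scaleC[OF dom] by (simp add: bounded_clinear_def bounded_clinear_scaleC[OF \<Sigma>])
qed

end


section \<open>Output regulation\<close>

lemma coord_phi: "coord (phi n) l = (if l = n then 1 else 0)"
proof -
  have "(\<lambda>k. (cmod (if k = n then 1 else 0))\<^sup>2) summable_on UNIV"
    by (rule finite_nonzero_values_imp_summable_on) (auto intro: finite_subset[of _ "{n}"])
  then show ?thesis unfolding phi_def by (subst ell2_inverse) auto
qed

lemma diag_op_phi: "diag_op a (phi n) = Some (a n *\<^sub>C phi n)"
proof -
  have "(\<lambda>k. (cmod (a k * coord (phi n) k))\<^sup>2) summable_on UNIV"
    by (rule finite_nonzero_values_imp_summable_on)
      (auto simp: coord_phi intro: finite_subset[of _ "{n}"])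
  moreover have "(\<lambda>k. a k * coord (phi n) k) = (\<lambda>k. a n * coord (phi n) k)"
    by (auto simp: coord_phi)
  ultimately show ?thesis by (simp add: diag_op_def scaleC_ell2_def)
qed

text \<open>Truncations to finitely many coordinates lie in the span of the basis, and the squared
  error is the tail of a convergent sum. This provides the density hypothesis of
  \<open>mild_integral\<close>.\<close>

lemma ell2_closed_subspace_UNIV:
  assumes V: "closed V" and add: "\<And>v w. v \<in> V \<Longrightarrow> w \<in> V \<Longrightarrow> v + w \<in> V"
    and scale: "\<And>a v. v \<in> V \<Longrightarrow> a *\<^sub>C v \<in> V" and phi: "\<And>n. phi n \<in> V"
  shows "V = UNIV"
proof -
  have "0 \<in> V" using scale[OF phi, of 0] by (simp add: scaleC_zero_left)
  have span: "(\<Sum>k\<in>I. coord v k *\<^sub>C phi k) \<in> V" if "finite I" for v I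
    using that by induction (auto intro: \<open>0 \<in> V\<close> add scale phi)
  have coord_sum: "coord (\<Sum>k\<in>I. coord v k *\<^sub>C phi k) l = (if l \<in> I then coord v l else 0)"
    if "finite I" for v I l
    using that by induction (auto simp: coord_zero coord_add coord_scaleC coord_phi)
  have "v \<in> closure V" for v
    unfolding closure_approachable
  proof (intro allI impI)
    fix e :: real assume e: "0 < e"
    let ?f = "\<lambda>k. (cmod (coord v k))\<^sup>2"
    have sum: "(?f has_sum infsum ?f UNIV) UNIV" by (rule has_sum_infsum[OF coord_summable])
    then have "(sum ?f \<longlongrightarrow> infsum ?f UNIV) (finite_subsets_at_top UNIV)" by (simp add: has_sum_def)
    then have "\<forall>\<^sub>F I in finite_subsets_at_top UNIV. dist (sum ?f I) (infsum ?f UNIV) < e\<^sup>2"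
      using e by (intro tendstoD) auto
    then obtain I where I: "finite I" "dist (sum ?f I) (infsum ?f UNIV) < e\<^sup>2"
      by (auto simp: eventually_finite_subsets_at_top)
    let ?w = "\<Sum>k\<in>I. coord v k *\<^sub>C phi k"
    have "(\<Sum>\<^sub>\<infinity>k. (cmod (coord (?w - v) k))\<^sup>2) = infsum ?f (UNIV - I)"
      by (rule infsum_cong_neutral) (auto simp: coord_diff coord_sum[OF I(1)])
    also have "\<dots> = infsum ?f UNIV - sum ?f I"
      using infsum_Diff[of ?f UNIV I] coord_summable[of v] I(1) by (simp add: summable_on_finite)
    also have "\<dots> < e\<^sup>2" using I(2) by (simp add: dist_real_def)
    finally have "sqrt (\<Sum>\<^sub>\<infinity>k. (cmod (coord (?w - v) k))\<^sup>2) < e"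
      using e by (metis less_imp_le real_sqrt_less_iff real_sqrt_unique)
    then have "dist ?w v < e" by (simp add: dist_norm norm_ell2_def)
    then show "\<exists>w\<in>V. dist w v < e" using span[OF I(1)] by blast
  qed
  then show ?thesis using V by auto
qed

lemma bounded_clinear_ell2_eq_0:
  assumes f: "bounded_clinear f" and "\<And>n. f (phi n) = 0"
  shows "f v = 0"
proof -
  note f_linear = bounded_clinear_imp_bounded_linear[OF f]
  have "{v. f v = 0} = UNIV"
  proof (rule ell2_closed_subspace_UNIV)
    show "closed {v. f v = 0}"
      by (intro closed_Collect_eq linear_continuous_on f_linear continuous_on_const)
  qed (use assms(2) in \<open>auto simp: linear_simps[OF f_linear] bounded_clinear_scaleC[OF f] scaleC_right_simps\<close>)
  then show ?thesis by blast
qed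

theorem theorem8:
  fixes A :: "'x::complex_banach \<rightharpoonup> 'x" and T :: "real \<Rightarrow> 'x \<Rightarrow> 'x"
    and \<alpha> :: complex and i :: "'x \<Rightarrow> 'xm::complex_banach"
    and B :: "'u::complex_hilbert \<Rightarrow> 'xm" and Bd :: "'ud::complex_banach \<Rightarrow> 'xm"
    and C :: "'x \<Rightarrow> 'y::complex_hilbert" and D :: "'u \<Rightarrow> 'y"
    and \<omega> :: "int \<Rightarrow> real" and S :: "ell2 \<rightharpoonup> ell2" and TS :: "real \<Rightarrow> ell2 \<Rightarrow> ell2"
    and E :: "ell2 \<Rightarrow> 'ud" and F :: "ell2 \<Rightarrow> 'y"
    and G1 :: "'z::complex_banach \<rightharpoonup> 'z" and TG :: "real \<Rightarrow> 'z \<Rightarrow> 'z"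
    and \<beta> :: complex and j :: "'z \<Rightarrow> 'zm::complex_banach"
    and G2 :: "'y \<Rightarrow> 'zm" and K :: "'z \<Rightarrow> 'u"
    and Ae :: "'x \<times> 'z \<rightharpoonup> 'x \<times> 'z" and Te :: "real \<Rightarrow> 'x \<times> 'z \<Rightarrow> 'x \<times> 'z"
    and \<gamma> :: complex and k :: "'x \<times> 'z \<Rightarrow> 'em::complex_banach"
    and Be :: "ell2 \<Rightarrow> 'em" and Ce :: "'x \<times> 'z \<Rightarrow> 'y" and De :: "ell2 \<Rightarrow> 'y"
  assumes plant: "generates A T" "extrapolation_space A \<alpha> i"
      "admissible_control T i B" "admissible_control T i Bd"
      "admissible_observation A T \<alpha> C" "bounded_clinear D"
      "regular A \<alpha> i (\<lambda>(u, w). B u + Bd w) C"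
    and frequencies: "inj \<omega>" "0 < (INF (m, n)\<in>{(m, n). m \<noteq> n}. \<bar>\<omega> m - \<omega> n\<bar>)"
    and exosystem: "S = diag_op (\<lambda>n. \<i> * of_real (\<omega> n))" "generates S TS"
    and E: "bounded_clinear E" "(\<lambda>n. (norm (E (phi n)))\<^sup>2) summable_on UNIV"
    and F: "bounded_clinear F" "(\<lambda>n. (norm (F (phi n)))\<^sup>2) summable_on UNIV"
    and controller: "regular_linear_system G1 TG \<beta> j G2 K (\<lambda>_. 0)"
    and Ae: "Ae = closed_loop_generator A \<alpha> i B C D G1 \<beta> j G2 K"
    and Be: "\<And>v. closed_loop_identified A \<alpha> i B Bd C D G1 \<beta> j G2 K k (Bd (E v), G2 (F v)) (Be v)"
    and Ce: "Ce = closed_loop_output A C D G1 K"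
    and De: "De = F"
    and closed_loop: "regular_linear_system Ae Te \<gamma> k Be Ce De"
    and stable: "strongly_stable Te"
    and sylvester: "\<exists>\<Sigma>. bounded_clinear \<Sigma> \<and> sylvester_equation S Ae k Be \<Sigma> \<and>
      range \<Sigma> \<subseteq> Lambda_dom Ae Ce"
  shows "solves_output_regulation Ae Te k Be Ce De TS \<longleftrightarrow>
    (\<exists>\<Sigma>. bounded_clinear \<Sigma> \<and> sylvester_equation S Ae k Be \<Sigma> \<and>
      (\<forall>v\<in>dom S. 0 = Lambda_ext Ae Ce (\<Sigma> v) + De v) \<and> range \<Sigma> \<subseteq> Lambda_dom Ae Ce)"
proof -
  have gen: "generates Ae Te" and ext: "extrapolation_space Ae \<gamma> k" and obs: "admissible_observation Ae Te \<gamma> Ce"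
    and De_clinear: "bounded_clinear De" and Be_clinear: "bounded_clinear Be"
    using closed_loop by (auto simp: regular_linear_system_def admissible_control_def)
  obtain M where M: "0 \<le> M" "\<And>t x. 0 \<le> t \<Longrightarrow> norm (Te t x) \<le> M * norm x"
    using strongly_stable_imp_bounded[OF generatesD(1)[OF gen] stable] by blast
  interpret extrapolated_semigroup Ae Te M \<gamma> k
    by unfold_locales (fact gen M ext)+
  interpret observed_semigroup Ae Te M \<gamma> Ce
    by unfold_locales (fact \<alpha>_resolvent_set obs)+

  have S_phi: "S (phi n) = Some ((\<i> * of_real (\<omega> n)) *\<^sub>C phi n)" for n
    by (simp add: exosystem(1) diag_op_phi)
  \<comment> \<open>The eigenvectors \<open>phi n\<close> of \<open>S\<close> meet the density
    hypothesis of \<open>mild_integral\<close>.\<close>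
  have mild: "mild_state Te k Be (\<lambda>r. TS r v) x t = Te t (x - \<Sigma> v) + \<Sigma> (TS t v)"
    if "bounded_clinear \<Sigma>" "sylvester_equation S Ae k Be \<Sigma>" "0 \<le> t" for \<Sigma> v x t
    using that S_phi
    by (intro mild_state_eq mild_integral[OF _ Be_clinear _ exosystem(2)] ell2_closed_subspace_UNIV) auto

  \<comment> \<open>The residual of the second regulator equation, and also the part of the error
    that remains once the transient has decayed.\<close>
  define e where "e \<Sigma> v = Lambda_ext Ae Ce (\<Sigma> v) + De v" for \<Sigma> v
  have e_clinear: "bounded_clinear (e \<Sigma>)" if "bounded_clinear \<Sigma>" "range \<Sigma> \<subseteq> Lambda_dom Ae Ce" for \<Sigma>
    using bounded_clinear_Lambda_ext[OF that] De_clinear unfolding e_def bounded_clinear_def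
    by (auto intro: bounded_linear_add simp: scaleC_add_right)

  show ?thesis
  proof
    assume solves: "solves_output_regulation Ae Te k Be Ce De TS"
    \<comment> \<open>Regulation forces the output equation on any solution of the Sylvester
      equation with range in \<open>Lambda_dom Ae Ce\<close>, so the assumed one already
      serves.\<close>
    obtain \<Sigma> where \<Sigma>: "bounded_clinear \<Sigma>" "sylvester_equation S Ae k Be \<Sigma>" "range \<Sigma> \<subseteq> Lambda_dom Ae Ce"
      using sylvester by blast
    note e_\<Sigma> = e_clinear[OF \<Sigma>(1,3)]
    have "e \<Sigma> (phi n) = 0" for n
    proof -
      let ?err = "regulation_error Ae Te k Be Ce De (\<lambda>r. TS r (phi n)) (\<Sigma> (phi n))"
      have err: "norm (?err s) = norm (e \<Sigma> (phi n))" if s: "0 \<le> s" for s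
      proof -
        have TS: "TS s (phi n) = exp (\<i> * of_real (\<omega> n) * of_real s) *\<^sub>C phi n"
          by (rule semigroup_eigenvector[OF exosystem(2) S_phi s])
        have "?err s = e \<Sigma> (TS s (phi n))"
          by (simp add: regulation_error_def e_def mild[OF \<Sigma>(1,2) s] linear_simps[OF T_linear[OF s]])
        then show ?thesis
          by (simp add: TS bounded_clinear_scaleC[OF e_\<Sigma>] norm_scaleC)
      qed
      have "((\<lambda>t. \<integral>\<^sup>+s\<in>{t..t + 1}. ennreal (norm (?err s)) \<partial>lebesgue) \<longlongrightarrow> 0) at_top"
        using solves unfolding solves_output_regulation_def by blast
      then have "((\<lambda>t. ennreal (norm (e \<Sigma> (phi n)))) \<longlongrightarrow> 0) (at_top :: real filter)"
      proof (rule Lim_transform_eventually)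
        show "\<forall>\<^sub>F t in at_top. (\<integral>\<^sup>+s\<in>{t..t + 1}. ennreal (norm (?err s)) \<partial>lebesgue) = ennreal (norm (e \<Sigma> (phi n)))"
          using eventually_ge_at_top[of "0::real"]
        proof eventually_elim
          case (elim t)
          have "(\<integral>\<^sup>+s\<in>{t..t + 1}. ennreal (norm (?err s)) \<partial>lebesgue)
              = (\<integral>\<^sup>+s\<in>{t..t + 1}. ennreal (norm (e \<Sigma> (phi n))) \<partial>lborel)"
            unfolding nn_integral_completion
            using elim by (intro nn_integral_cong) (auto simp: indicator_def err)
          then show ?case by (simp add: nn_integral_cmult_indicator)
        qed
      qed
      then show ?thesis by (simp add: tendsto_const_iff)
    qed
    then have "e \<Sigma> v = 0" for v by (rule bounded_clinear_ell2_eq_0[OF e_\<Sigma>])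
    then show "\<exists>\<Sigma>. bounded_clinear \<Sigma> \<and> sylvester_equation S Ae k Be \<Sigma> \<and>
        (\<forall>v\<in>dom S. 0 = Lambda_ext Ae Ce (\<Sigma> v) + De v) \<and> range \<Sigma> \<subseteq> Lambda_dom Ae Ce"
      using \<Sigma> unfolding e_def by metis
  next
    assume "\<exists>\<Sigma>. bounded_clinear \<Sigma> \<and> sylvester_equation S Ae k Be \<Sigma> \<and>
        (\<forall>v\<in>dom S. 0 = Lambda_ext Ae Ce (\<Sigma> v) + De v) \<and> range \<Sigma> \<subseteq> Lambda_dom Ae Ce"
    then obtain \<Sigma> where \<Sigma>: "bounded_clinear \<Sigma>" "sylvester_equation S Ae k Be \<Sigma>" "range \<Sigma> \<subseteq> Lambda_dom Ae Ce"
      and "\<forall>v\<in>dom S. 0 = e \<Sigma> v" unfolding e_def by blast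
    \<comment> \<open>The output equation is given on \<open>dom S\<close> only. This contains every
      \<open>phi n\<close>, and boundedness of the residual extends it to all
      \<open>TS s v\<close>.\<close>
    then have "e \<Sigma> (phi n) = 0" for n using S_phi[of n] by (metis domI)
    then have e_0: "e \<Sigma> v = 0" for v by (rule bounded_clinear_ell2_eq_0[OF e_clinear[OF \<Sigma>(1,3)]])
    obtain c where c: "0 \<le> c" and le: "\<And>x t. 0 \<le> t \<Longrightarrow>
        (\<integral>\<^sup>+s\<in>{t..t + 1}. ennreal (norm (Lambda_ext Ae Ce (Te s x))) \<partial>lborel) \<le> ennreal (c * norm (Te t x))"
      using Lambda_ext_integral_le by blast
    have "((\<lambda>t. \<integral>\<^sup>+s\<in>{t..t + 1}. ennreal (norm (regulation_error Ae Te k Be Ce De (\<lambda>r. TS r v) x s)) \<partial>lebesgue)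
        \<longlongrightarrow> 0) at_top" for x v
    proof (rule tendsto_sandwich[OF _ _ tendsto_const])
      define z where "z = x - \<Sigma> v"
      have "((\<lambda>t. Te t z) \<longlongrightarrow> 0) at_top" using stable unfolding strongly_stable_def by blast
      then have "((\<lambda>t. ennreal (c * norm (Te t z))) \<longlongrightarrow> ennreal 0) at_top"
        by (intro tendsto_ennrealI tendsto_mult_right_zero tendsto_norm_zero)
      then show "((\<lambda>t. ennreal (c * norm (Te t z))) \<longlongrightarrow> 0) at_top" by simp
      \<comment> \<open>Splitting off the transient uses additivity of \<open>Lambda_ext\<close>,
        which holds where \<open>Te s z\<close> lies in \<open>Lambda_dom Ae Ce\<close>; the
        exceptional times form a null set and do not affect the integral.\<close>
      have AE: "AE s in lborel. 0 \<le> s \<longrightarrow>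
          regulation_error Ae Te k Be Ce De (\<lambda>r. TS r v) x s = Lambda_ext Ae Ce (Te s z)"
        using AE_T_in_Lambda_dom[of z]
      proof eventually_elim
        case (elim s)
        show ?case
        proof
          assume s: "0 \<le> s"
          have "regulation_error Ae Te k Be Ce De (\<lambda>r. TS r v) x s
              = Lambda_ext Ae Ce (Te s z) + e \<Sigma> (TS s v)"
            using Lambda_ext_add[of "Te s z" "\<Sigma> (TS s v)"] elim s \<Sigma>(3)
            by (simp add: regulation_error_def e_def mild[OF \<Sigma>(1,2) s] z_def range_subsetD)
          then show "regulation_error Ae Te k Be Ce De (\<lambda>r. TS r v) x s = Lambda_ext Ae Ce (Te s z)"
            by (simp add: e_0)
        qed
      qed
      show "\<forall>\<^sub>F t in at_top. (\<integral>\<^sup>+s\<in>{t..t + 1}. ennreal (norm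
          (regulation_error Ae Te k Be Ce De (\<lambda>r. TS r v) x s)) \<partial>lebesgue) \<le> ennreal (c * norm (Te t z))"
        using eventually_ge_at_top[of "0::real"]
      proof eventually_elim
        case (elim t)
        have "(\<integral>\<^sup>+s\<in>{t..t + 1}. ennreal (norm (regulation_error Ae Te k Be Ce De (\<lambda>r. TS r v) x s)) \<partial>lebesgue)
            = (\<integral>\<^sup>+s\<in>{t..t + 1}. ennreal (norm (Lambda_ext Ae Ce (Te s z))) \<partial>lborel)"
          unfolding nn_integral_completion
          by (rule nn_integral_cong_AE, use AE in eventually_elim) (use elim in \<open>auto simp: indicator_def\<close>)
        also have "\<dots> \<le> ennreal (c * norm (Te t z))" by (rule le[OF elim])
        finally show ?case .
      qed
    qed simp
    then show "solves_output_regulation Ae Te k Be Ce De TS"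
      using stable unfolding solves_output_regulation_def by blast
  qed
qed

end
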